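(* Let $S$ be a countably infinite set and $K$ a standard Borel space. For every exchangeable random $K$-coloured graph $\mu$ on $S$ (a Borel probability measure on $K^{\binom{S}{2}}$ invariant under the vertex-permuting action of $\mathrm{Sym}_0(S)$) there are ingredients $(Z_0,\mu_0),(Z_1,P_1),(K,P_2)$ which yield $\mu$ upon following the standard recipe.
   Context: $\binom{S}{2}$ is the set of $2$-element subsets of $S$. $\mathrm{Sym}_0(S)$ is the group of finitely-supported permutations of $S$, acting on $K^{\binom{S}{2}}$ by $\tau^g((\omega_e)_e)=(\omega_{g(e)})_e$. A probability kernel $P:Y\rightsquigarrow X$ between standard Borel spaces is a map $(y,A)\mapsto P(y,A)$ that is measurable in $y\in Y$ for each measurable $A\subseteq X$ and a probability measure on $X$ in $A$ for each $y$. Ingredients $(Z_0,\mu_0),(Z_1,P_1),(K,P_2)$ consist of standard Borel spaces $Z_0,Z_1$, a probability measure $\mu_0$ on $Z_0$, a probability kernel $P_1:Z_0\rightsquigarrow Z_1$, and a probability kernel $P_2:Z_0\times Z_1\times Z_1\rightsquigarrow K$ that is symmetric under exchanging the two $Z_1$ coordinates. The standard recipe: choose $z_\emptyset\in Z_0$ with law $\mu_0$; given this, choose for each $s\in S$ a point $z_s\in Z_1$ independently with law $P_1(z_\emptyset,\cdot)$; given all of these, choose for each $e=\{s,t\}\in\binom{S}{2}$ a colour $\omega_e\in K$ independently with law $P_2(z_\emptyset,z_s,z_t,\cdot)$. The ingredients yield $\mu$ if $\mu$ is the law of $(\omega_e)_{e\in\binom{S}{2}}$. *)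

theory Defs
  imports
    "HOL-Probability.Probability"
    "HOL-Library.Ramsey"
    "HOL-Combinatorics.Permutations"
begin

text \<open>
  Measurable spaces are represented by values of type \<^typ>\<open>'a measure\<close>, of which only \<^const>\<open>space\<close>
  and \<^const>\<open>sets\<close> matter.
\<close>

definition standard_borel :: "'a measure \<Rightarrow> bool" where
  "standard_borel M \<longleftrightarrow>
     (\<exists>X. completely_metrizable_space X \<and> second_countable X \<and>
          space M = topspace X \<and> sets M = sigma_sets (topspace X) {U. openin X U})"

abbreviation prob_kernel :: "'y measure \<Rightarrow> 'x measure \<Rightarrow> ('y \<Rightarrow> 'x measure) \<Rightarrow> bool" where
  "prob_kernel Y X P \<equiv> P \<in> Y \<rightarrow>\<^sub>M prob_algebra X"

lemma prob_kernel_iff: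
  "prob_kernel Y X P \<longleftrightarrow>
     (\<forall>y\<in>space Y. prob_space (P y) \<and> sets (P y) = sets X) \<and>
     (\<forall>A\<in>sets X. (\<lambda>y. emeasure (P y) A) \<in> borel_measurable Y)"
proof (intro iffI conjI ballI; (elim conjE)?)
  assume P: "prob_kernel Y X P"
  show "prob_space (P y)" "sets (P y) = sets X" if "y \<in> space Y" for y
    using measurable_space[OF P that] by (auto simp: space_prob_algebra)
  show "(\<lambda>y. emeasure (P y) A) \<in> borel_measurable Y" if "A \<in> sets X" for A
    using measurable_compose[OF measurable_prob_algebraD[OF P]
        measurable_emeasure_subprob_algebra[OF that]] .
next
  assume *: "\<forall>y\<in>space Y. prob_space (P y) \<and> sets (P y) = sets X"
    and "\<forall>A\<in>sets X. (\<lambda>y. emeasure (P y) A) \<in> borel_measurable Y"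
  then have "P \<in> Y \<rightarrow>\<^sub>M subprob_algebra X"
    by (intro measurable_subprob_algebra) (auto intro: prob_space_imp_subprob_space)
  with * show "prob_kernel Y X P"
    by (intro measurable_prob_algebraI) auto
qed

text \<open>The space \<open>K\<close> to the power \<open>[S]\<^bsup>2\<^esup>\<close> of \<open>K\<close>-coloured graphs on \<open>S\<close>.\<close>

definition coloured_graphs :: "'s set \<Rightarrow> 'k measure \<Rightarrow> ('s set \<Rightarrow> 'k) measure" where
  "coloured_graphs S K = (\<Pi>\<^sub>M e\<in>[S]\<^bsup>2\<^esup>. K)"

definition Sym0 :: "'s set \<Rightarrow> ('s \<Rightarrow> 's) set" where
  "Sym0 S = {g. g permutes S \<and> finite {s\<in>S. g s \<noteq> s}}"

definition vertex_action :: "'s set \<Rightarrow> ('s \<Rightarrow> 's) \<Rightarrow> ('s set \<Rightarrow> 'k) \<Rightarrow> ('s set \<Rightarrow> 'k)" where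
  "vertex_action S g \<omega> = (\<lambda>e\<in>[S]\<^bsup>2\<^esup>. \<omega> (g ` e))"

definition exchangeable_random_coloured_graph ::
    "'s set \<Rightarrow> 'k measure \<Rightarrow> ('s set \<Rightarrow> 'k) measure \<Rightarrow> bool" where
  "exchangeable_random_coloured_graph S K \<mu> \<longleftrightarrow>
     prob_space \<mu> \<and> sets \<mu> = sets (coloured_graphs S K) \<and>
     (\<forall>g\<in>Sym0 S. distr \<mu> (coloured_graphs S K) (vertex_action S g) = \<mu>)"

definition ingredients ::
    "'z0 measure \<Rightarrow> 'z0 measure \<Rightarrow> 'z1 measure \<Rightarrow> ('z0 \<Rightarrow> 'z1 measure) \<Rightarrow>
     'k measure \<Rightarrow> ('z0 \<times> 'z1 \<times> 'z1 \<Rightarrow> 'k measure) \<Rightarrow> bool" where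
  "ingredients Z\<^sub>0 \<mu>\<^sub>0 Z\<^sub>1 P\<^sub>1 K P\<^sub>2 \<longleftrightarrow>
     standard_borel Z\<^sub>0 \<and> standard_borel Z\<^sub>1 \<and> standard_borel K \<and>
     prob_space \<mu>\<^sub>0 \<and> sets \<mu>\<^sub>0 = sets Z\<^sub>0 \<and>
     prob_kernel Z\<^sub>0 Z\<^sub>1 P\<^sub>1 \<and>
     prob_kernel (Z\<^sub>0 \<Otimes>\<^sub>M Z\<^sub>1 \<Otimes>\<^sub>M Z\<^sub>1) K P\<^sub>2 \<and>
     (\<forall>z\<in>space Z\<^sub>0. \<forall>x\<in>space Z\<^sub>1. \<forall>y\<in>space Z\<^sub>1. P\<^sub>2 (z, x, y) = P\<^sub>2 (z, y, x))"

text \<open>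
  The conditional law of the colour of an edge \<open>e = {s, t}\<close>. The two endpoints are not ordered; the
  description is unique because of the symmetry of \<open>P\<^sub>2\<close>, see \<open>edge_law_eq\<close>.
\<close>

definition edge_law ::
    "('z0 \<times> 'z1 \<times> 'z1 \<Rightarrow> 'k measure) \<Rightarrow> 'z0 \<Rightarrow> ('s \<Rightarrow> 'z1) \<Rightarrow> 's set \<Rightarrow> 'k measure" where
  "edge_law P\<^sub>2 z\<^sub>0 z e = (THE Q. \<exists>s t. e = {s, t} \<and> s \<noteq> t \<and> Q = P\<^sub>2 (z\<^sub>0, z s, z t))"

text \<open>
  The law of the colours only: the points \<open>z\<^sub>0\<close> (written \<open>z\<^sub>\<emptyset>\<close> in the usual description of the recipe)
  and \<open>z\<close> are integrated out by the Giry bind. The product measures express the conditional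
  independence in each step.
\<close>

definition recipe_law ::
    "'s set \<Rightarrow> 'z0 measure \<Rightarrow> ('z0 \<Rightarrow> 'z1 measure) \<Rightarrow> ('z0 \<times> 'z1 \<times> 'z1 \<Rightarrow> 'k measure) \<Rightarrow>
     ('s set \<Rightarrow> 'k) measure" where
  "recipe_law S \<mu>\<^sub>0 P\<^sub>1 P\<^sub>2 =
     do {
       z\<^sub>0 \<leftarrow> \<mu>\<^sub>0;
       z \<leftarrow> (\<Pi>\<^sub>M s\<in>S. P\<^sub>1 z\<^sub>0);
       (\<Pi>\<^sub>M e\<in>[S]\<^bsup>2\<^esup>. edge_law P\<^sub>2 z\<^sub>0 z e)
     }"

lemma edge_law_eq:
  assumes "ingredients Z\<^sub>0 \<mu>\<^sub>0 Z\<^sub>1 P\<^sub>1 K P\<^sub>2" "z\<^sub>0 \<in> space Z\<^sub>0"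
    and "s \<noteq> t" "z s \<in> space Z\<^sub>1" "z t \<in> space Z\<^sub>1"
  shows "edge_law P\<^sub>2 z\<^sub>0 z {s, t} = P\<^sub>2 (z\<^sub>0, z s, z t)"
  unfolding edge_law_def using assms
  by (intro the_equality) (auto simp: ingredients_def doubleton_eq_iff)

lemma prob_kernel_PiM:
  assumes P: "\<And>i. i \<in> I \<Longrightarrow> prob_kernel Y X (P i)"
  shows "prob_kernel Y (\<Pi>\<^sub>M i\<in>I. X) (\<lambda>y. \<Pi>\<^sub>M i\<in>I. P i y)"
proof (rule measurable_prob_algebra_generated[OF sets_PiM Int_stable_prod_algebra prod_algebra_sets_into_space])
  have P': "prob_space (P i y)" "sets (P i y) = sets X" if "i \<in> I" "y \<in> space Y" for i y
    using measurable_space[OF P[OF that(1)] that(2)] by (auto simp: space_prob_algebra)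
  show "prob_space (\<Pi>\<^sub>M i\<in>I. P i y)" if "y \<in> space Y" for y
    using P' that by (intro prob_space_PiM) auto
  show "sets (\<Pi>\<^sub>M i\<in>I. P i y) = sets (\<Pi>\<^sub>M i\<in>I. X)" if "y \<in> space Y" for y
    using P' that by (intro sets_PiM_cong) auto
  fix A assume "A \<in> prod_algebra I (\<lambda>_. X)"
  then obtain J E where A: "A = prod_emb I (\<lambda>_. X) J (Pi\<^sub>E J E)"
    and J: "finite J" "J \<subseteq> I" "\<And>j. j \<in> J \<Longrightarrow> E j \<in> sets X"
    by (auto elim!: prod_algebraE)
  have "emeasure (\<Pi>\<^sub>M i\<in>I. P i y) A = (\<Prod>j\<in>J. emeasure (P j y) (E j))" if y: "y \<in> space Y" for y
  proof -
    define Q where "Q i = (if i \<in> I then P i y else return (count_space {undefined}) undefined)" for i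
    interpret product_prob_space Q I
      by (rule product_prob_spaceI) (auto simp: Q_def P' y intro: prob_space_return)
    have [simp]: "(\<Pi>\<^sub>M i\<in>I. P i y) = (\<Pi>\<^sub>M i\<in>I. Q i)"
      by (rule PiM_cong) (auto simp: Q_def)
    have "A = prod_emb I Q J (Pi\<^sub>E J E)"
      using P' y sets_eq_imp_space_eq[OF P'(2)[OF _ y]]
      by (auto simp: A prod_emb_def Q_def PiE_iff cong: conj_cong)
    moreover have "E j \<in> sets (Q j)" "emeasure (Q j) (E j) = emeasure (P j y) (E j)"
      if "j \<in> J" for j
      using that J P'(2)[OF _ y] by (auto simp: Q_def)
    ultimately show ?thesis
      using J(1,2) by (simp add: emeasure_PiM_emb)
  qed
  moreover have "(\<lambda>y. \<Prod>j\<in>J. emeasure (P j y) (E j)) \<in> borel_measurable Y"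
    using J P by (intro borel_measurable_prod_ennreal) (auto simp: prob_kernel_iff)
  ultimately show "(\<lambda>y. emeasure (\<Pi>\<^sub>M i\<in>I. P i y) A) \<in> borel_measurable Y"
    by (simp cong: measurable_cong)
qed

lemma prob_kernel_edge_law:
  assumes I: "ingredients Z\<^sub>0 \<mu>\<^sub>0 Z\<^sub>1 P\<^sub>1 K P\<^sub>2" and e: "e \<in> [S]\<^bsup>2\<^esup>"
  shows "prob_kernel (Z\<^sub>0 \<Otimes>\<^sub>M (\<Pi>\<^sub>M s\<in>S. Z\<^sub>1)) K (\<lambda>(z\<^sub>0, z). edge_law P\<^sub>2 z\<^sub>0 z e)"
proof -
  obtain s t where st: "e = {s, t}" "s \<noteq> t" "s \<in> S" "t \<in> S"
    using e by (auto simp: nsets_def card_2_iff)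
  have P2: "P\<^sub>2 \<in> Z\<^sub>0 \<Otimes>\<^sub>M Z\<^sub>1 \<Otimes>\<^sub>M Z\<^sub>1 \<rightarrow>\<^sub>M prob_algebra K"
    using I by (simp add: ingredients_def)
  have "(\<lambda>x. P\<^sub>2 (fst x, snd x s, snd x t)) \<in> Z\<^sub>0 \<Otimes>\<^sub>M (\<Pi>\<^sub>M s\<in>S. Z\<^sub>1) \<rightarrow>\<^sub>M prob_algebra K"
    using st by (intro measurable_compose[OF _ P2]) measurable
  also have "?this \<longleftrightarrow> ?thesis"
    using st by (intro measurable_cong)
      (auto simp: space_pair_measure space_PiM PiE_iff edge_law_eq[OF I])
  finally show ?thesis .
qed

text \<open>All the Giry binds in \<open>recipe_law\<close> are over measurable kernels, so it is a genuine law.\<close>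

lemma recipe_law_in_prob_algebra:
  assumes I: "ingredients Z\<^sub>0 \<mu>\<^sub>0 Z\<^sub>1 P\<^sub>1 K P\<^sub>2"
  shows "recipe_law S \<mu>\<^sub>0 P\<^sub>1 P\<^sub>2 \<in> space (prob_algebra (coloured_graphs S K))"
proof -
  have \<mu>\<^sub>0: "\<mu>\<^sub>0 \<in> space (prob_algebra Z\<^sub>0)"
    using I by (simp add: ingredients_def space_prob_algebra)
  have 1: "prob_kernel Z\<^sub>0 (\<Pi>\<^sub>M s\<in>S. Z\<^sub>1) (\<lambda>z\<^sub>0. \<Pi>\<^sub>M s\<in>S. P\<^sub>1 z\<^sub>0)"
    using I by (intro prob_kernel_PiM) (simp add: ingredients_def)
  have 2: "prob_kernel (Z\<^sub>0 \<Otimes>\<^sub>M (\<Pi>\<^sub>M s\<in>S. Z\<^sub>1)) (coloured_graphs S K)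
     (\<lambda>(z\<^sub>0, z). \<Pi>\<^sub>M e\<in>[S]\<^bsup>2\<^esup>. edge_law P\<^sub>2 z\<^sub>0 z e)"
    using prob_kernel_PiM[OF prob_kernel_edge_law[OF I]]
    by (simp add: coloured_graphs_def case_prod_unfold)
  have "prob_kernel Z\<^sub>0 (coloured_graphs S K)
     (\<lambda>z\<^sub>0. (\<Pi>\<^sub>M s\<in>S. P\<^sub>1 z\<^sub>0) \<bind> (\<lambda>z. \<Pi>\<^sub>M e\<in>[S]\<^bsup>2\<^esup>. edge_law P\<^sub>2 z\<^sub>0 z e))"
    by (rule measurable_bind_prob_space2[OF 1 2])
  from prob_space_bind'[OF \<mu>\<^sub>0 this] sets_bind'[OF \<mu>\<^sub>0 this] show ?thesis
    by (simp add: recipe_law_def space_prob_algebra)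
qed

end

theory Submission
  imports Defs
begin

text \<open>
  The statement is the Aldous--Hoover theorem for symmetric arrays in its distributional form. The
  latent variables of the recipe need not be invented: since \<open>S\<close> is infinite, they can be read off
  from a part of the random graph itself.

  Split off disjoint infinite sets \<open>N\<^sub>1, N\<^sub>2 \<subseteq> S\<close> and an injective copy \<open>\<psi> ` S\<close> of \<open>S\<close> that avoids
  \<open>N = N\<^sub>1 \<union> N\<^sub>2\<close>. By exchangeability the graph spanned by \<open>\<psi> ` S\<close> has the law \<open>\<mu>\<close>, so it suffices to
  generate that graph. Let \<open>z\<^sub>\<emptyset>\<close> be the whole coloured graph on \<open>N\<close>, and let \<open>z\<^sub>s\<close> be the family of
  the colours of \<open>{\<psi> s, n}\<close> for \<open>n \<in> N\<^sub>1\<close>. With \<open>P\<^sub>1\<close> the conditional law of \<open>z\<^sub>s\<close> given \<open>z\<^sub>\<emptyset>\<close> and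
  \<open>P\<^sub>2\<close> the conditional law of the colour of \<open>{\<psi> s, \<psi> t}\<close> given \<open>z\<^sub>\<emptyset>, z\<^sub>s, z\<^sub>t\<close>, the recipe yields
  \<open>\<mu>\<close> as soon as the following two facts are known: given \<open>z\<^sub>\<emptyset>\<close>, each \<open>z\<^sub>s\<close> is independent of all
  the other \<open>z\<^sub>r\<close> (\<open>vertex_independence\<close>), and given \<open>z\<^sub>\<emptyset>, z\<^sub>s, z\<^sub>t\<close>, the colour of \<open>{\<psi> s, \<psi> t}\<close>
  is independent of all the \<open>z\<^sub>r\<close> and of all the other colours on \<open>\<psi> ` S\<close> (\<open>edge_independence\<close>).

  Both follow from one principle (\<open>cond_law_of_larger_conditioning\<close>): if \<open>(Y', X)\<close> and \<open>(Y, X)\<close> have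
  the same law and \<open>Y\<close> is a function of \<open>Y'\<close>, then conditioning \<open>X\<close> on \<open>Y'\<close> gives nothing more than
  conditioning it on \<open>Y\<close>. Indeed the two conditional probabilities of an event are a bounded
  martingale of length two with equal second moments, so they agree almost surely. The variable
  \<open>Y'\<close> is obtained from \<open>Y\<close> by an injective relabelling of the vertices that fixes those on which
  \<open>X\<close> depends and lets an infinite reserve absorb everything else. For \<open>X = z\<^sub>s\<close> the vertices in
  \<open>N\<^sub>1\<close> have to stay fixed and \<open>N\<^sub>2\<close> is sent onto \<open>N\<^sub>2 \<union> \<psi> ` (S - {s})\<close>; for the colour of
  \<open>{\<psi> s, \<psi> t}\<close> it is \<open>N\<^sub>1\<close> that is sent onto \<open>N\<^sub>1 \<union> \<psi> ` (S - {s, t})\<close>. This is why the reserve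
  consists of two parts.

  On the measure-theoretic side, every nonempty standard Borel space is a measurable retract of the
  Cantor space, and so are its countable powers. Hence the latent variables can be coded by single
  real numbers without loss of information, and conditional laws exist as probability kernels.
\<close>

section \<open>Standard Borel spaces as retracts of the Cantor space\<close>

abbreviation cantor :: "(nat \<Rightarrow> bool) measure" where
  "cantor \<equiv> \<Pi>\<^sub>M n\<in>UNIV. count_space UNIV"

lemma measurable_cantorI:
  assumes "\<And>n. {x \<in> space M. f x n} \<in> sets M"
  shows "f \<in> M \<rightarrow>\<^sub>M cantor"
proof (rule measurable_PiM_single')
  show "(\<lambda>x. f x n) \<in> M \<rightarrow>\<^sub>M count_space UNIV" for n
    using assms[of n] by (simp add: pred_def)
qed auto

lemma measurable_cantor_bit [measurable]: "(\<lambda>b. b n) \<in> cantor \<rightarrow>\<^sub>M count_space UNIV"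
  by (rule measurable_component_singleton) simp

text \<open>
  The decoder is defined on all bit sequences, not only on codes. Nonempty standard Borel spaces have
  such a code, and its existence passes to countable products simply by rearranging bits.
\<close>

definition cantor_retract :: "'a measure \<Rightarrow> bool" where
  "cantor_retract M \<longleftrightarrow>
     (\<exists>f g. f \<in> M \<rightarrow>\<^sub>M cantor \<and> g \<in> cantor \<rightarrow>\<^sub>M M \<and> (\<forall>x\<in>space M. g (f x) = x))"

definition ternary :: "(nat \<Rightarrow> bool) \<Rightarrow> real" where
  "ternary b = (\<Sum>n. of_bool (b n) / 3 ^ Suc n)"

text \<open>
  Binary codes are read as ternary expansions with the digits 0 and 1 only. The tail of such an
  expansion is at most one half of a unit, so that no carry occurs and the floor function recovers the
  digits.
\<close>

definition ternary_digits :: "real \<Rightarrow> nat \<Rightarrow> bool" where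
  "ternary_digits x n \<longleftrightarrow> \<lfloor>3 ^ Suc n * x\<rfloor> mod 3 = 1"

lemma summable_ternary: "summable (\<lambda>n. of_bool (b n) / 3 ^ Suc n :: real)"
proof (rule summable_comparison_test')
  show "summable (\<lambda>n. (1/3) ^ n :: real)" by (rule summable_geometric) simp
  show "norm (of_bool (b n) / 3 ^ Suc n :: real) \<le> (1/3) ^ n" for n
    by (auto simp: field_simps)
qed

lemma ternary_bounds: "0 \<le> ternary b" "ternary b \<le> 1 / 2"
proof -
  show "0 \<le> ternary b"
    unfolding ternary_def by (rule suminf_nonneg[OF summable_ternary]) simp
  have "(\<lambda>n. (1/3) * (1/3) ^ n :: real) sums ((1/3) * (1 / (1 - 1/3)))"
    by (intro sums_mult geometric_sums) simp
  then have *: "(\<lambda>n. 1 / 3 ^ Suc n :: real) sums (1 / 2)"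
    by (simp add: power_divide)
  have "ternary b \<le> (\<Sum>n. 1 / 3 ^ Suc n)"
    unfolding ternary_def
    by (rule suminf_le[OF _ summable_ternary sums_summable[OF *]]) (simp add: divide_right_mono)
  with * show "ternary b \<le> 1 / 2" by (simp add: sums_iff)
qed

lemma ternary_shift: "3 * ternary b = of_bool (b 0) + ternary (\<lambda>n. b (Suc n))"
proof -
  have "ternary b = of_bool (b 0) / 3 + (\<Sum>n. of_bool (b (Suc n)) / 3 ^ Suc (Suc n))"
    unfolding ternary_def using suminf_split_head[OF summable_ternary[of b]] by simp
  also have "(\<Sum>n. of_bool (b (Suc n)) / 3 ^ Suc (Suc n)) = (\<Sum>n. of_bool (b (Suc n)) / 3 ^ Suc n / 3 :: real)"
    by (simp add: field_simps)
  also have "\<dots> = ternary (\<lambda>n. b (Suc n)) / 3"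
    unfolding ternary_def by (rule suminf_divide[OF summable_ternary])
  finally show ?thesis by simp
qed

lemma ternary_digits_ternary: "ternary_digits (ternary b) = b"
proof
  fix n
  have "\<exists>a::int. 3 ^ n * ternary b = of_int a + ternary (\<lambda>k. b (n + k))"
  proof (induction n)
    case (Suc n)
    then obtain a :: int where "3 ^ n * ternary b = of_int a + ternary (\<lambda>k. b (n + k))" by blast
    then have "3 ^ Suc n * ternary b = of_int (3 * a + of_bool (b n)) + ternary (\<lambda>k. b (Suc n + k))"
      using ternary_shift[of "\<lambda>k. b (n + k)"] by (simp add: algebra_simps)
    then show ?case by blast
  qed (auto intro: exI[of _ 0])
  then obtain a :: int where "3 ^ n * ternary b = of_int a + ternary (\<lambda>k. b (n + k))" by blast
  then have eq: "3 ^ Suc n * ternary b = of_int (3 * a + of_bool (b n)) + ternary (\<lambda>k. b (Suc n + k))"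
    using ternary_shift[of "\<lambda>k. b (n + k)"] by (simp add: algebra_simps)
  have "\<lfloor>3 ^ Suc n * ternary b\<rfloor> = 3 * a + of_bool (b n)"
    unfolding eq using ternary_bounds[of "\<lambda>k. b (Suc n + k)"] by (intro floor_unique) simp_all
  then show "ternary_digits (ternary b) n = b n"
    by (simp add: ternary_digits_def)
qed

lemma measurable_ternary [measurable]: "ternary \<in> borel_measurable cantor"
  unfolding ternary_def[abs_def] by measurable

lemma measurable_ternary_digits [measurable]: "ternary_digits \<in> borel \<rightarrow>\<^sub>M cantor"
proof (rule measurable_cantorI)
  fix n
  have "(\<lambda>x::real. \<lfloor>3 ^ Suc n * x\<rfloor> mod 3 = 1) \<in> borel \<rightarrow>\<^sub>M count_space UNIV"
    by measurable
  then show "{x \<in> space borel. ternary_digits x n} \<in> sets borel"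
    by (simp add: ternary_digits_def pred_def)
qed

lemma cantor_retract_real:
  assumes "cantor_retract M"
  obtains f :: "'a \<Rightarrow> real" and g where
    "f \<in> M \<rightarrow>\<^sub>M borel" "g \<in> borel \<rightarrow>\<^sub>M M"
    "\<And>x. x \<in> space M \<Longrightarrow> g (f x) = x" "\<And>x. f x \<in> {0..1}"
proof -
  from assms obtain f g where fg: "f \<in> M \<rightarrow>\<^sub>M cantor" "g \<in> cantor \<rightarrow>\<^sub>M M" "\<forall>x\<in>space M. g (f x) = x"
    unfolding cantor_retract_def by blast
  show thesis
  proof
    show "ternary \<circ> f \<in> M \<rightarrow>\<^sub>M borel" "g \<circ> ternary_digits \<in> borel \<rightarrow>\<^sub>M M"
      using fg(1,2) by (auto intro: measurable_comp)
    show "(g \<circ> ternary_digits) ((ternary \<circ> f) x) = x" if "x \<in> space M" for x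
      using fg(3) that by (simp add: ternary_digits_ternary)
    show "(ternary \<circ> f) x \<in> {0..1}" for x
      using ternary_bounds[of "f x"] by simp
  qed
qed

lemma cantor_retract_PiM:
  assumes "countable J" "J \<noteq> {}" "cantor_retract M"
  shows "cantor_retract (\<Pi>\<^sub>M j\<in>J. M)"
proof -
  from assms(3) obtain f g where f: "f \<in> M \<rightarrow>\<^sub>M cantor" and g: "g \<in> cantor \<rightarrow>\<^sub>M M"
    and gf: "\<forall>x\<in>space M. g (f x) = x"
    unfolding cantor_retract_def by blast
  define F where "F \<omega> m = f (\<omega> (from_nat_into J (fst (prod_decode m)))) (snd (prod_decode m))" for \<omega> m
  define G where "G b = (\<lambda>j\<in>J. g (\<lambda>n. b (prod_encode (to_nat_on J j, n))))" for b
  show ?thesis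
    unfolding cantor_retract_def
  proof (intro exI conjI ballI)
    show "F \<in> (\<Pi>\<^sub>M j\<in>J. M) \<rightarrow>\<^sub>M cantor"
    proof (rule measurable_PiM_single')
      fix m
      have "from_nat_into J (fst (prod_decode m)) \<in> J"
        using assms(2) by (rule from_nat_into)
      then have "(\<lambda>\<omega>. f (\<omega> (from_nat_into J (fst (prod_decode m))))) \<in> (\<Pi>\<^sub>M j\<in>J. M) \<rightarrow>\<^sub>M cantor"
        by (intro measurable_compose[OF _ f] measurable_component_singleton)
      then show "(\<lambda>\<omega>. F \<omega> m) \<in> (\<Pi>\<^sub>M j\<in>J. M) \<rightarrow>\<^sub>M count_space UNIV"
        unfolding F_def by (rule measurable_compose[OF _ measurable_cantor_bit])
    qed auto
    show "G \<in> cantor \<rightarrow>\<^sub>M (\<Pi>\<^sub>M j\<in>J. M)"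
      unfolding G_def
    proof (rule measurable_restrict)
      fix j
      show "(\<lambda>b. g (\<lambda>n. b (prod_encode (to_nat_on J j, n)))) \<in> cantor \<rightarrow>\<^sub>M M"
        by (intro measurable_compose[OF _ g] measurable_PiM_single' measurable_cantor_bit) auto
    qed
    fix \<omega> assume "\<omega> \<in> space (\<Pi>\<^sub>M j\<in>J. M)"
    then have \<omega>: "\<omega> \<in> extensional J" "\<And>j. j \<in> J \<Longrightarrow> \<omega> j \<in> space M"
      by (auto simp: space_PiM PiE_iff)
    show "G (F \<omega>) = \<omega>"
    proof (rule extensionalityI[OF _ \<omega>(1)])
      show "G (F \<omega>) \<in> extensional J" by (simp add: G_def)
      show "G (F \<omega>) j = \<omega> j" if "j \<in> J" for j
        using that \<omega>(2) gf assms(1) by (simp add: G_def F_def)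
    qed
  qed
qed

text \<open>
  For a dense sequence \<open>a\<close>, a point is coded by the truth values of \<open>d x (a n) < 1 / 2 ^ k\<close> for all \<open>k\<close> and
  \<open>n\<close>. From any bit sequence one reads off, for each \<open>k\<close>, the first \<open>n\<close> with this property; the point
  is the limit of these approximations if they form a Cauchy sequence. Completeness makes the decoder
  well defined, and its measurability holds because membership of the limit in an open set is a
  countable condition on the approximations.
\<close>

lemma standard_borel_imp_cantor_retract:
  assumes "standard_borel M" "space M \<noteq> {}"
  shows "cantor_retract M"
proof -
  from assms(1) obtain X where X: "completely_metrizable_space X" "second_countable X"
      "space M = topspace X" "sets M = sigma_sets (topspace X) {U. openin X U}"
    unfolding standard_borel_def by blast
  from X(1) obtain T d where Td: "Metric_space T d" "Metric_space.mcomplete T d" "X = Metric_space.mtopology T d"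
    unfolding completely_metrizable_space_def by blast
  interpret Metric_space T d by fact
  have spM: "space M = T" using X(3) Td(3) by simp
  have openM: "U \<in> sets M" if "openin mtopology U" for U
    using that X(4) Td(3) by auto
  obtain C where C: "countable C" "C \<subseteq> T" "mtopology closure_of C = T"
    using second_countable_imp_separable_space[OF X(2)] Td(3)
    unfolding separable_space_def by auto
  have "C \<noteq> {}" using C(3) assms(2) spM by auto
  define a where "a = from_nat_into C"
  have aT: "a n \<in> T" for n
    using from_nat_into[OF \<open>C \<noteq> {}\<close>, of n] C(2) by (auto simp: a_def)
  have dense: "\<exists>n. d x (a n) < r" if xr: "x \<in> T" "r > 0" for x r
  proof -
    obtain y where "y \<in> C" "y \<in> mball x r"
      using xr C(3) unfolding metric_closure_of by blast
    then show ?thesis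
      using from_nat_into_surj[OF C(1)] by (auto simp: a_def)
  qed
  define h :: "nat \<Rightarrow> real" where "h k = (1/2) ^ k" for k
  have h: "h k > 0" for k by (simp add: h_def)
  have h_small: "\<exists>k. h k < r" if "r > 0" for r
    unfolding h_def using real_arch_pow_inv[OF that, of "1/2"] by simp
  have h_lim: "h \<longlonglongrightarrow> 0" unfolding h_def by (rule LIMSEQ_realpow_zero) auto
  define f where "f x m = (d x (a (snd (prod_decode m))) < h (fst (prod_decode m)))" for x m
  \<comment> \<open>If no index qualifies, \<open>LEAST\<close> is some fixed but arbitrary index, which is harmless.\<close>
  define appr where "appr b k = a (LEAST n. b (prod_encode (k, n)))" for b k
  have apprT: "appr b k \<in> T" for b k by (simp add: appr_def aT)
  define cau where "cau b \<longleftrightarrow> (\<forall>i. \<exists>N. \<forall>k\<ge>N. \<forall>l\<ge>N. d (appr b k) (appr b l) < h i)" for b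
  define g where "g b = (if cau b then (SOME x. limitin mtopology (appr b) x sequentially) else a 0)" for b
  have lim: "limitin mtopology (appr b) (g b) sequentially" if "cau b" for b
  proof -
    have "MCauchy (appr b)"
      unfolding MCauchy_def
    proof (intro conjI allI impI)
      fix e :: real assume "e > 0"
      then obtain i where "h i < e" using h_small by blast
      with that show "\<exists>N. \<forall>n n'. N \<le> n \<longrightarrow> N \<le> n' \<longrightarrow> d (appr b n) (appr b n') < e"
        unfolding cau_def by (meson order.strict_trans)
    qed (use apprT in auto)
    then have "\<exists>x. limitin mtopology (appr b) x sequentially"
      using Td(2) unfolding mcomplete_def by blast
    then show ?thesis
      using that by (auto simp: g_def intro: someI_ex)
  qed
  have gT: "g b \<in> T" for b
    using lim[of b] aT by (cases "cau b") (auto simp: limitin_metric g_def)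
  \<comment> \<open>The ball has twice the radius of the bound on the distances; this leaves room for the
    passage to the limit.\<close>
  have open_iff: "g b \<in> U \<longleftrightarrow> (\<exists>n i. mball (a n) (h i) \<subseteq> U \<and>
       (\<exists>N. \<forall>k\<ge>N. d (a n) (appr b k) < h (Suc i)))"
    if U: "openin mtopology U" and "cau b" for U b
  proof
    assume "g b \<in> U"
    then obtain r where r: "r > 0" "mball (g b) r \<subseteq> U"
      using U unfolding openin_mtopology by blast
    obtain i where i: "h i < r / 2" using h_small[of "r/2"] r by auto
    obtain n where n: "d (g b) (a n) < h (Suc (Suc i))" using dense[OF gT h] by blast
    obtain N where N: "\<forall>k\<ge>N. d (appr b k) (g b) < h (Suc (Suc i))"
      using lim[OF \<open>cau b\<close>] h[of "Suc (Suc i)"] unfolding limitin_metric eventually_sequentially by blast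
    have "mball (a n) (h i) \<subseteq> mball (g b) r"
    proof
      fix y assume y: "y \<in> mball (a n) (h i)"
      have "d (g b) y \<le> d (g b) (a n) + d (a n) y"
        using y gT aT by (intro triangle) auto
      also have "\<dots> < h i + h i"
      proof (rule add_strict_mono)
        have "h (Suc (Suc i)) \<le> h i" unfolding h_def by (rule power_decreasing) auto
        with n show "d (g b) (a n) < h i" by simp
      qed (use y in simp)
      finally show "y \<in> mball (g b) r"
        using y i gT by auto
    qed
    moreover have "d (a n) (appr b k) < h (Suc i)" if "k \<ge> N" for k
    proof -
      have "d (a n) (appr b k) \<le> d (a n) (g b) + d (g b) (appr b k)"
        by (intro triangle gT aT apprT)
      then show ?thesis
        using n N that by (auto simp: h_def commute)
    qed
    ultimately show "\<exists>n i. mball (a n) (h i) \<subseteq> U \<and> (\<exists>N. \<forall>k\<ge>N. d (a n) (appr b k) < h (Suc i))"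
      using r(2) by blast
  next
    assume "\<exists>n i. mball (a n) (h i) \<subseteq> U \<and> (\<exists>N. \<forall>k\<ge>N. d (a n) (appr b k) < h (Suc i))"
    then obtain n i N where *: "mball (a n) (h i) \<subseteq> U" "\<forall>k\<ge>N. d (a n) (appr b k) < h (Suc i)"
      by blast
    obtain N' where N': "\<forall>k\<ge>N'. d (appr b k) (g b) < h (Suc i)"
      using lim[OF \<open>cau b\<close>] h[of "Suc i"] unfolding limitin_metric eventually_sequentially by blast
    have "d (a n) (g b) \<le> d (a n) (appr b (max N N')) + d (appr b (max N N')) (g b)"
      by (intro triangle gT aT apprT)
    also have "\<dots> < h (Suc i) + h (Suc i)"
      using * N' by (intro add_strict_mono) auto
    also have "\<dots> = h i" by (simp add: h_def)
    finally show "g b \<in> U" using *(1) gT aT by auto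
  qed
  have least: "(\<lambda>b. LEAST n. b (prod_encode (k, n))) \<in> cantor \<rightarrow>\<^sub>M count_space UNIV" for k
    by (intro measurable_Least measurable_cantor_bit)
  have appr_pred: "(\<lambda>b. P (appr b k)) \<in> cantor \<rightarrow>\<^sub>M count_space UNIV" for P :: "'a \<Rightarrow> bool" and k
    unfolding appr_def by (rule measurable_compose[OF least]) simp
  have [measurable]: "(\<lambda>b. d (a n) (appr b k) < r) \<in> cantor \<rightarrow>\<^sub>M count_space UNIV" for n k r
    by (rule appr_pred)
  have [measurable]: "(\<lambda>b. d (appr b k) (appr b l) < r) \<in> cantor \<rightarrow>\<^sub>M count_space UNIV" for k l r
    unfolding appr_def[of _ k] by (rule measurable_compose_countable[OF appr_pred least])
  have [measurable]: "Measurable.pred cantor cau"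
    unfolding cau_def by measurable
  have g_meas: "g \<in> cantor \<rightarrow>\<^sub>M M"
  proof (rule measurable_sigma_sets[OF X(4)])
    show "{U. openin X U} \<subseteq> Pow (topspace X)" using openin_subset by blast
    show "g \<in> space cantor \<rightarrow> topspace X" using gT Td(3) by auto
    fix U assume "U \<in> {U. openin X U}"
    then have U: "openin mtopology U" using Td(3) by simp
    have "g b \<in> U \<longleftrightarrow> (cau b \<and> (\<exists>n i. mball (a n) (h i) \<subseteq> U \<and>
       (\<exists>N. \<forall>k\<ge>N. d (a n) (appr b k) < h (Suc i)))) \<or> \<not> cau b \<and> a 0 \<in> U" for b
      using open_iff[OF U, of b] by (cases "cau b") (auto simp: g_def)
    then have "g -` U \<inter> space cantor = {b \<in> space cantor. (cau b \<and> (\<exists>n i. mball (a n) (h i) \<subseteq> U \<and>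
       (\<exists>N. \<forall>k\<ge>N. d (a n) (appr b k) < h (Suc i)))) \<or> \<not> cau b \<and> a 0 \<in> U}"
      by blast
    also have "\<dots> \<in> sets cantor"
      by measurable
    finally show "g -` U \<inter> space cantor \<in> sets cantor" .
  qed
  have f_meas: "f \<in> M \<rightarrow>\<^sub>M cantor"
  proof (rule measurable_cantorI)
    fix m
    have "{x \<in> space M. f x m} = mball (a (snd (prod_decode m))) (h (fst (prod_decode m)))"
      using aT by (auto simp: f_def spM commute)
    then show "{x \<in> space M. f x m} \<in> sets M"
      using openM by simp
  qed
  have "g (f x) = x" if "x \<in> space M" for x
  proof -
    have x: "x \<in> T" using that spM by simp
    have close: "d x (appr (f x) k) < h k" for k
    proof -
      obtain n where "f x (prod_encode (k, n))"
        using dense[OF x h[of k]] by (auto simp: f_def)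
      then have "f x (prod_encode (k, (LEAST n. f x (prod_encode (k, n)))))"
        by (rule LeastI)
      then show ?thesis by (simp add: f_def appr_def)
    qed
    have limx: "limitin mtopology (appr (f x)) x sequentially"
      unfolding limitin_metric
    proof (intro conjI allI impI x)
      fix e :: real assume "e > 0"
      then have "\<forall>\<^sub>F k in sequentially. h k < e"
        using h_lim by (simp add: order_tendsto_iff)
      then show "\<forall>\<^sub>F k in sequentially. appr (f x) k \<in> T \<and> d (appr (f x) k) x < e"
      proof eventually_elim
        case (elim k)
        then show ?case using close[of k] apprT by (simp add: commute)
      qed
    qed
    have "cau (f x)"
      unfolding cau_def
    proof
      fix i
      have "d (appr (f x) k) (appr (f x) l) < h i" if "k \<ge> Suc i" "l \<ge> Suc i" for k l
      proof -
        have "d (appr (f x) k) (appr (f x) l) \<le> d (appr (f x) k) x + d x (appr (f x) l)"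
          by (intro triangle x apprT)
        also have "\<dots> < h k + h l"
          using close[of k] close[of l] by (simp add: commute)
        also have "\<dots> \<le> h (Suc i) + h (Suc i)"
          unfolding h_def using that by (intro add_mono power_decreasing) auto
        finally show ?thesis by (simp add: h_def)
      qed
      then show "\<exists>N. \<forall>k\<ge>N. \<forall>l\<ge>N. d (appr (f x) k) (appr (f x) l) < h i" by blast
    qed
    from lim[OF this] limx show ?thesis
      by (rule limitin_metric_unique) simp
  qed
  with f_meas g_meas show ?thesis
    unfolding cantor_retract_def by blast
qed

lemma standard_borel_real: "standard_borel (borel :: real measure)"
  unfolding standard_borel_def
proof (intro exI conjI)
  show "completely_metrizable_space (euclidean :: real topology)"
    by (rule completely_metrizable_space_euclidean)
  show "second_countable (euclidean :: real topology)"
  proof -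
    obtain B :: "real set set" where B: "countable B" "topological_basis B"
      using ex_countable_basis by blast
    then show ?thesis
      unfolding second_countable_def open_openin[symmetric]
      by (intro exI[of _ B]) (metis topological_basisE topological_basis_open)
  qed
  show "sets borel = sigma_sets (topspace euclidean) {U :: real set. openin euclidean U}"
    by (simp add: borel_def)
qed simp

section \<open>Conditional laws\<close>

text \<open>
  \<open>\<kappa>\<close> is a regular conditional law of \<open>X\<close> given \<open>Y\<close>. All nonnegative weights \<open>w (Y \<omega>)\<close> are allowed
  instead of indicators of sets only, because the weights that occur below are products of
  indicators and of other conditional probabilities.
\<close>

definition cond_law ::
    "'w measure \<Rightarrow> 'y measure \<Rightarrow> ('w \<Rightarrow> 'y) \<Rightarrow> 'x measure \<Rightarrow> ('w \<Rightarrow> 'x) \<Rightarrow> ('y \<Rightarrow> 'x measure) \<Rightarrow> bool" where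
  "cond_law M N Y L X \<kappa> \<longleftrightarrow>
     Y \<in> M \<rightarrow>\<^sub>M N \<and> X \<in> M \<rightarrow>\<^sub>M L \<and> prob_kernel N L \<kappa> \<and>
     (\<forall>A\<in>sets L. \<forall>w\<in>borel_measurable N.
        (\<integral>\<^sup>+\<omega>. w (Y \<omega>) * indicator A (X \<omega>) \<partial>M) = (\<integral>\<^sup>+\<omega>. w (Y \<omega>) * emeasure (\<kappa> (Y \<omega>)) A \<partial>M))"

lemma cond_lawD:
  assumes "cond_law M N Y L X \<kappa>"
  shows "Y \<in> M \<rightarrow>\<^sub>M N" "X \<in> M \<rightarrow>\<^sub>M L" "prob_kernel N L \<kappa>"
    and "A \<in> sets L \<Longrightarrow> w \<in> borel_measurable N \<Longrightarrow>
      (\<integral>\<^sup>+\<omega>. w (Y \<omega>) * indicator A (X \<omega>) \<partial>M) = (\<integral>\<^sup>+\<omega>. w (Y \<omega>) * emeasure (\<kappa> (Y \<omega>)) A \<partial>M)"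
  using assms unfolding cond_law_def by blast+

lemma emeasure_distr_density:
  assumes [measurable]: "f \<in> borel_measurable M" "Y \<in> M \<rightarrow>\<^sub>M N" "C \<in> sets N"
  shows "emeasure (distr (density M f) N Y) C = (\<integral>\<^sup>+\<omega>. f \<omega> * indicator C (Y \<omega>) \<partial>M)"
  by (subst emeasure_distr)
    (auto simp: emeasure_density intro!: nn_integral_cong split: split_indicator)

lemma emeasure_conj_eq_nn_integral:
  assumes [measurable]: "Y \<in> M \<rightarrow>\<^sub>M N" "X \<in> M \<rightarrow>\<^sub>M L" "C \<in> sets N" "A \<in> sets L"
  shows "emeasure M {\<omega> \<in> space M. Y \<omega> \<in> C \<and> X \<omega> \<in> A} = (\<integral>\<^sup>+\<omega>. indicator A (X \<omega>) * indicator C (Y \<omega>) \<partial>M)"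
proof -
  have "emeasure M {\<omega> \<in> space M. Y \<omega> \<in> C \<and> X \<omega> \<in> A}
      = (\<integral>\<^sup>+\<omega>. indicator {\<omega> \<in> space M. Y \<omega> \<in> C \<and> X \<omega> \<in> A} \<omega> \<partial>M)"
    by (rule nn_integral_indicator[symmetric]) measurable
  also have "\<dots> = (\<integral>\<^sup>+\<omega>. indicator A (X \<omega>) * indicator C (Y \<omega>) \<partial>M)"
    by (intro nn_integral_cong) (auto split: split_indicator)
  finally show ?thesis .
qed

lemma cond_lawI_sets:
  assumes [measurable]: "Y \<in> M \<rightarrow>\<^sub>M N" "X \<in> M \<rightarrow>\<^sub>M L" and \<kappa>: "prob_kernel N L \<kappa>"
    and eq: "\<And>A C. A \<in> sets L \<Longrightarrow> C \<in> sets N \<Longrightarrow>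
      emeasure M {\<omega> \<in> space M. Y \<omega> \<in> C \<and> X \<omega> \<in> A} = (\<integral>\<^sup>+\<omega>. indicator C (Y \<omega>) * emeasure (\<kappa> (Y \<omega>)) A \<partial>M)"
  shows "cond_law M N Y L X \<kappa>"
  unfolding cond_law_def
proof (intro conjI ballI assms(1,2) \<kappa>)
  fix A and w :: "'b \<Rightarrow> ennreal" assume A[measurable]: "A \<in> sets L" and w[measurable]: "w \<in> borel_measurable N"
  have [measurable]: "(\<lambda>y. emeasure (\<kappa> y) A) \<in> borel_measurable N"
    using \<kappa> A by (auto simp: prob_kernel_iff)
  have "distr (density M (\<lambda>\<omega>. indicator A (X \<omega>))) N Y = distr (density M (\<lambda>\<omega>. emeasure (\<kappa> (Y \<omega>)) A)) N Y"
  proof (rule measure_eqI)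
    fix C assume "C \<in> sets (distr (density M (\<lambda>\<omega>. indicator A (X \<omega>))) N Y)"
    then have C[measurable]: "C \<in> sets N" by simp
    have "emeasure (distr (density M (\<lambda>\<omega>. indicator A (X \<omega>))) N Y) C
        = emeasure M {\<omega> \<in> space M. Y \<omega> \<in> C \<and> X \<omega> \<in> A}"
      by (subst emeasure_distr_density, (measurable)[3])
        (subst emeasure_conj_eq_nn_integral[where N=N and L=L], (measurable)[4], simp)
    also have "\<dots> = (\<integral>\<^sup>+\<omega>. emeasure (\<kappa> (Y \<omega>)) A * indicator C (Y \<omega>) \<partial>M)"
      using eq[OF A C] by (simp add: mult.commute)
    also have "\<dots> = emeasure (distr (density M (\<lambda>\<omega>. emeasure (\<kappa> (Y \<omega>)) A)) N Y) C"
      by (rule emeasure_distr_density[symmetric]) measurable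
    finally show "emeasure (distr (density M (\<lambda>\<omega>. indicator A (X \<omega>))) N Y) C
        = emeasure (distr (density M (\<lambda>\<omega>. emeasure (\<kappa> (Y \<omega>)) A)) N Y) C" .
  qed simp
  then have "(\<integral>\<^sup>+y. w y \<partial>distr (density M (\<lambda>\<omega>. indicator A (X \<omega>))) N Y)
      = (\<integral>\<^sup>+y. w y \<partial>distr (density M (\<lambda>\<omega>. emeasure (\<kappa> (Y \<omega>)) A)) N Y)" by simp
  then show "(\<integral>\<^sup>+\<omega>. w (Y \<omega>) * indicator A (X \<omega>) \<partial>M) = (\<integral>\<^sup>+\<omega>. w (Y \<omega>) * emeasure (\<kappa> (Y \<omega>)) A \<partial>M)"
    by (simp add: nn_integral_distr nn_integral_density mult.commute)
qed

text \<open>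
  The density is a Radon--Nikodym derivative on the space of values of \<open>Y\<close>, so that it is
  a function of the value of \<open>Y\<close> from the start.
\<close>

lemma conditional_prob_exists:
  assumes "prob_space M" and [measurable]: "Y \<in> M \<rightarrow>\<^sub>M N" "E \<in> sets M"
  shows "\<exists>f\<in>borel_measurable N. \<forall>C\<in>sets N.
    (\<integral>\<^sup>+y. f y * indicator C y \<partial>distr M N Y) = emeasure M {\<omega> \<in> space M. Y \<omega> \<in> C \<and> \<omega> \<in> E}"
proof -
  interpret prob_space M by fact
  interpret \<nu>: prob_space "distr M N Y" by (rule prob_space_distr) simp
  define m where "m = distr (density M (indicator E)) N Y"
  have m: "emeasure m C = emeasure M {\<omega> \<in> space M. Y \<omega> \<in> C \<and> \<omega> \<in> E}" if [measurable]: "C \<in> sets N" for C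
    unfolding m_def
    by (subst emeasure_distr_density, (measurable)[3])
      (subst emeasure_conj_eq_nn_integral[where N=N and L=M], (measurable)[4], simp)
  have "absolutely_continuous (distr M N Y) m"
    unfolding absolutely_continuous_def
  proof
    fix C assume "C \<in> null_sets (distr M N Y)"
    then have C[measurable]: "C \<in> sets N" and 0: "emeasure M (Y -` C \<inter> space M) = 0"
      by (auto simp: null_sets_def emeasure_distr)
    have "emeasure m C \<le> emeasure M (Y -` C \<inter> space M)"
      unfolding m[OF C] by (intro emeasure_mono) auto
    with 0 show "C \<in> null_sets m" by (auto simp: null_sets_def m_def)
  qed
  then have "density (distr M N Y) (RN_deriv (distr M N Y) m) = m"
    by (intro \<nu>.density_RN_deriv) (simp_all add: m_def)
  then have "(\<integral>\<^sup>+y. RN_deriv (distr M N Y) m y * indicator C y \<partial>distr M N Y)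
      = emeasure M {\<omega> \<in> space M. Y \<omega> \<in> C \<and> \<omega> \<in> E}" if "C \<in> sets N" for C
    using emeasure_density[of "RN_deriv (distr M N Y) m" "distr M N Y" C] that by (simp add: m)
  moreover have "RN_deriv (distr M N Y) m \<in> borel_measurable N"
    using borel_measurable_RN_deriv[of "distr M N Y" m] by simp
  ultimately show ?thesis by blast
qed

lemma rational_approx_from_above:
  fixes r :: real
  obtains q :: "nat \<Rightarrow> real" where "\<And>n. q n \<in> \<rat>" "\<And>n. r < q n" "decseq q" "q \<longlonglongrightarrow> r"
proof
  define q where "q n = of_int (\<lfloor>r * 2 ^ n\<rfloor> + 1) / (2 ^ n :: real)" for n
  show "q n \<in> \<rat>" for n by (simp add: q_def)
  show lower: "r < q n" for n
    unfolding q_def by (subst pos_less_divide_eq) (use floor_correct[of "r * 2 ^ n"] in auto)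
  have upper: "q n \<le> r + (1/2) ^ n" for n
    unfolding q_def
    by (subst pos_divide_le_eq) (use floor_correct[of "r * 2 ^ n"] in \<open>auto simp: algebra_simps power_divide\<close>)
  show "decseq q"
  proof (rule decseq_SucI)
    fix n
    have "\<lfloor>r * 2 ^ Suc n\<rfloor> + 1 \<le> 2 * (\<lfloor>r * 2 ^ n\<rfloor> + 1)"
      by (simp add: mult.assoc[symmetric]) linarith
    then have "of_int (\<lfloor>r * 2 ^ Suc n\<rfloor> + 1) \<le> (of_int (2 * (\<lfloor>r * 2 ^ n\<rfloor> + 1)) :: real)"
      by (simp only: of_int_le_iff)
    then have "q (Suc n) \<le> of_int (2 * (\<lfloor>r * 2 ^ n\<rfloor> + 1)) / 2 ^ Suc n"
      unfolding q_def by (rule divide_right_mono) simp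
    also have "\<dots> = q n" by (simp add: q_def field_simps)
    finally show "q (Suc n) \<le> q n" .
  qed
  show "q \<longlonglongrightarrow> r"
  proof (rule tendsto_sandwich)
    show "\<forall>\<^sub>F n in sequentially. r \<le> q n" using lower by (simp add: less_imp_le)
    show "\<forall>\<^sub>F n in sequentially. q n \<le> r + (1/2) ^ n" using upper by simp
    show "(\<lambda>n. r + (1/2) ^ n) \<longlonglongrightarrow> r"
      using tendsto_add[OF tendsto_const LIMSEQ_realpow_zero[of "1/2"]] by simp
  qed simp
qed

text \<open>
  Let \<open>T q y\<close> be a version of the conditional probability of \<open>q < X\<close> given \<open>Y = y\<close>, for rational \<open>q\<close>.
  The kernel is defined as the law of the generalised inverse \<open>G y\<close> of \<open>T\<close> under the uniform
  distribution. In this way it consists of probability measures for every \<open>y\<close>, and only its agreement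
  with the \<open>T q\<close> has to be checked up to null sets.
\<close>

lemma cond_law_exists_unit_interval:
  fixes X :: "'w \<Rightarrow> real"
  assumes "prob_space M" and [measurable]: "Y \<in> M \<rightarrow>\<^sub>M N" "X \<in> borel_measurable M"
    and X01: "\<And>\<omega>. X \<omega> \<in> {0..1}"
  shows "\<exists>\<kappa>. cond_law M N Y borel X \<kappa>"
proof -
  interpret prob_space M by fact
  interpret \<nu>: prob_space "distr M N Y" by (rule prob_space_distr) simp
  have "\<exists>f\<in>borel_measurable N. \<forall>C\<in>sets N.
      (\<integral>\<^sup>+y. f y * indicator C y \<partial>distr M N Y) = emeasure M {\<omega> \<in> space M. Y \<omega> \<in> C \<and> \<omega> \<in> {\<omega> \<in> space M. X \<omega> \<in> B}}"
    if [measurable]: "B \<in> sets borel" for B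
    by (intro conditional_prob_exists \<open>prob_space M\<close>) simp_all
  then have "\<forall>B\<in>sets borel. \<exists>f. f \<in> borel_measurable N \<and> (\<forall>C\<in>sets N.
      (\<integral>\<^sup>+y. f y * indicator C y \<partial>distr M N Y) = emeasure M {\<omega> \<in> space M. Y \<omega> \<in> C \<and> X \<omega> \<in> B})"
    by (simp add: Bex_def conj_ac cong: conj_cong)
  from bchoice[OF this]
  obtain F where F_meas': "B \<in> sets borel \<Longrightarrow> F B \<in> borel_measurable N"
    and F: "B \<in> sets borel \<Longrightarrow> C \<in> sets N \<Longrightarrow> (\<integral>\<^sup>+y. F B y * indicator C y \<partial>distr M N Y)
        = emeasure M {\<omega> \<in> space M. Y \<omega> \<in> C \<and> X \<omega> \<in> B}" for B C
    by blast
  note F_meas[measurable] = F_meas'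
  have unique: "AE y in distr M N Y. f y = F B y"
    if [measurable]: "B \<in> sets borel" "f \<in> borel_measurable N" and
      "\<And>C. C \<in> sets N \<Longrightarrow> (\<integral>\<^sup>+y. f y * indicator C y \<partial>distr M N Y)
        = emeasure M {\<omega> \<in> space M. Y \<omega> \<in> C \<and> X \<omega> \<in> B}" for B f
    by (rule \<nu>.density_unique_finite_measure) (use that in \<open>simp_all add: F\<close>)
  have mono: "AE y in distr M N Y. F A y \<le> F B y"
    if [measurable]: "A \<in> sets borel" "B \<in> sets borel" and "A \<subseteq> B" for A B
  proof -
    have "AE y in distr M N Y. F A y + F (B - A) y = F B y"
    proof (rule unique)
      fix C assume C[measurable]: "C \<in> sets N"
      have "(\<integral>\<^sup>+y. (F A y + F (B - A) y) * indicator C y \<partial>distr M N Y)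
          = emeasure M {\<omega> \<in> space M. Y \<omega> \<in> C \<and> X \<omega> \<in> A} + emeasure M {\<omega> \<in> space M. Y \<omega> \<in> C \<and> X \<omega> \<in> B - A}"
        by (simp add: distrib_right nn_integral_add F)
      also have "\<dots> = emeasure M ({\<omega> \<in> space M. Y \<omega> \<in> C \<and> X \<omega> \<in> A} \<union> {\<omega> \<in> space M. Y \<omega> \<in> C \<and> X \<omega> \<in> B - A})"
        by (rule plus_emeasure) auto
      also have "{\<omega> \<in> space M. Y \<omega> \<in> C \<and> X \<omega> \<in> A} \<union> {\<omega> \<in> space M. Y \<omega> \<in> C \<and> X \<omega> \<in> B - A}
          = {\<omega> \<in> space M. Y \<omega> \<in> C \<and> X \<omega> \<in> B}"
        using \<open>A \<subseteq> B\<close> by auto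
      finally show "(\<integral>\<^sup>+y. (F A y + F (B - A) y) * indicator C y \<partial>distr M N Y)
          = emeasure M {\<omega> \<in> space M. Y \<omega> \<in> C \<and> X \<omega> \<in> B}" .
    qed simp_all
    then show ?thesis
      by eventually_elim (metis add_increasing2 order_refl zero_le)
  qed
  define T where "T q = F {q<..}" for q :: real
  have [measurable]: "T q \<in> borel_measurable N" for q by (simp add: T_def)
  have T_low: "AE y in distr M N Y. 1 = T q y" if "q < 0" for q
    unfolding T_def
  proof (rule unique)
    fix C assume [measurable]: "C \<in> sets N"
    have "{\<omega> \<in> space M. Y \<omega> \<in> C \<and> X \<omega> \<in> {q<..}} = Y -` C \<inter> space M"
      using X01 \<open>q < 0\<close> by (force simp: less_le_trans)
    then show "(\<integral>\<^sup>+y. 1 * indicator C y \<partial>distr M N Y) = emeasure M {\<omega> \<in> space M. Y \<omega> \<in> C \<and> X \<omega> \<in> {q<..}}"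
      by (simp add: emeasure_distr)
  qed simp_all
  have T_high: "AE y in distr M N Y. 0 = T q y" if "q \<ge> 1" for q
    unfolding T_def
  proof (rule unique)
    fix C assume [measurable]: "C \<in> sets N"
    have *: "{\<omega> \<in> space M. Y \<omega> \<in> C \<and> X \<omega> \<in> {q<..}} = {}"
      using X01 \<open>q \<ge> 1\<close> by (auto simp: not_less intro: order_trans)
    show "(\<integral>\<^sup>+y. 0 * indicator C y \<partial>distr M N Y) = emeasure M {\<omega> \<in> space M. Y \<omega> \<in> C \<and> X \<omega> \<in> {q<..}}"
      by (subst *) simp
  qed simp_all
  have T_mono: "AE y in distr M N Y. T q y \<le> T p y" if "p \<le> q" for p q
    unfolding T_def using that by (intro mono) auto
  have AE_T: "AE y in distr M N Y. (\<forall>q\<in>\<rat>. (q < 0 \<longrightarrow> T q y = 1) \<and> (q \<ge> 1 \<longrightarrow> T q y = 0) \<and> T q y \<le> 1)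
      \<and> (\<forall>p\<in>\<rat>. \<forall>q\<in>\<rat>. p \<le> q \<longrightarrow> T q y \<le> T p y)"
  proof (intro AE_conjI)
    have "AE y in distr M N Y. (q < 0 \<longrightarrow> T q y = 1) \<and> (q \<ge> 1 \<longrightarrow> T q y = 0) \<and> T q y \<le> 1" for q
      using T_low[of "min q (-1)"] T_mono[of "min q (-1)" q] T_low[of q] T_high[of q]
      by (cases "q < 0"; cases "q \<ge> 1") auto
    then show "AE y in distr M N Y. \<forall>q\<in>\<rat>. (q < 0 \<longrightarrow> T q y = 1) \<and> (q \<ge> 1 \<longrightarrow> T q y = 0) \<and> T q y \<le> 1"
      by (subst AE_ball_countable) (auto simp: countable_rat)
    show "AE y in distr M N Y. \<forall>p\<in>\<rat>. \<forall>q\<in>\<rat>. p \<le> q \<longrightarrow> T q y \<le> T p y"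
      using T_mono by (subst AE_ball_countable, simp add: countable_rat)+ auto
  qed
  define U :: "real measure" where "U = uniform_measure lborel {0..1}"
  interpret U: prob_space U
    unfolding U_def by (rule prob_space_uniform_measure) auto
  have sets_U[measurable_cong, simp]: "sets U = sets borel" by (simp add: U_def)
  have space_U[simp]: "space U = UNIV" by (simp add: U_def)
  have U_le: "emeasure U {u. ennreal u \<le> t} = t" if "t \<le> 1" for t
  proof -
    from that obtain x where x: "t = ennreal x" "0 \<le> x" "x \<le> 1"
      by (cases t) (auto simp: ennreal_le_1 top_unique)
    have "{0..1} \<inter> {u. ennreal u \<le> t} = {0..x}"
      using x by (auto simp: ennreal_le_iff)
    then show ?thesis
      unfolding U_def using x by (subst emeasure_uniform_measure) (auto simp: divide_ennreal_def)
  qed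
  \<comment> \<open>The cases \<open>q < 0\<close> and \<open>q < 1\<close> keep the supremum inside \<open>{0..1}\<close> also for those \<open>y\<close> at which
    the versions \<open>T q y\<close> behave badly.\<close>
  define S where "S y u = {q\<in>\<rat>. q < 0 \<or> (q < 1 \<and> ennreal u \<le> T q y)}" for y u
  define G where "G y u = Sup (S y u)" for y u
  have G_iff: "r < G y u \<longleftrightarrow> (\<exists>q\<in>\<rat>. r < q \<and> (q < 0 \<or> (q < 1 \<and> ennreal u \<le> T q y)))" for r y u
  proof -
    have "- 1 \<in> S y u" by (simp add: S_def)
    then have "S y u \<noteq> {}" by blast
    moreover have "bdd_above (S y u)" by (rule bdd_aboveI[of _ 1]) (auto simp: S_def)
    ultimately show ?thesis
      unfolding G_def by (simp add: less_cSup_iff) (auto simp: S_def)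
  qed
  have G_meas[measurable]: "(\<lambda>(y, u). G y u) \<in> borel_measurable (N \<Otimes>\<^sub>M U)"
  proof (rule borel_measurableI_greater)
    fix r
    have "{x \<in> space (N \<Otimes>\<^sub>M U). r < (case x of (y, u) \<Rightarrow> G y u)}
        = {x \<in> space (N \<Otimes>\<^sub>M U). \<exists>q\<in>\<rat>. r < q \<and> (q < 0 \<or> (q < 1 \<and> ennreal (snd x) \<le> T q (fst x)))}"
      by (auto simp: G_iff)
    also have "\<dots> \<in> sets (N \<Otimes>\<^sub>M U)"
    proof (rule sets.sets_Collect_countable_Ex')
      show "{x \<in> space (N \<Otimes>\<^sub>M U). r < q \<and> (q < 0 \<or> (q < 1 \<and> ennreal (snd x) \<le> T q (fst x)))} \<in> sets (N \<Otimes>\<^sub>M U)" for q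
        by measurable
    qed (rule countable_rat)
    finally show "{x \<in> space (N \<Otimes>\<^sub>M U). r < (case x of (y, u) \<Rightarrow> G y u)} \<in> sets (N \<Otimes>\<^sub>M U)" .
  qed
  define \<kappa> where "\<kappa> y = distr U borel (G y)" for y
  have "U \<in> space (prob_algebra U)" by (simp add: space_prob_algebra U.prob_space_axioms)
  then have \<kappa>: "prob_kernel N borel \<kappa>"
    unfolding \<kappa>_def[abs_def]
    by (intro measurable_distr_prob_space2[where M=U] measurable_const G_meas)
  have G_y[measurable]: "G y \<in> borel_measurable U" if "y \<in> space N" for y
    using measurable_compose[OF measurable_Pair1'[OF that] G_meas] by simp
  have [measurable]: "A \<in> sets borel \<Longrightarrow> (\<lambda>y. emeasure (\<kappa> y) A) \<in> borel_measurable N" for A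
    using \<kappa> by (auto simp: prob_kernel_iff)
  \<comment> \<open>The hypotheses on \<open>T\<close> hold for almost every \<open>y\<close>; they make the events \<open>D (q n)\<close>
    increase to the event \<open>r < G y u\<close>.\<close>
  have \<kappa>_tail: "emeasure (\<kappa> y) {r<..} = (SUP n. T (q n) y)"
    if y: "y \<in> space N" and q: "\<And>n. q n \<in> \<rat>" "\<And>n. r < q n" "decseq q" "q \<longlonglongrightarrow> r"
      and T: "\<And>q. q \<in> \<rat> \<Longrightarrow> (q < 0 \<longrightarrow> T q y = 1) \<and> (q \<ge> 1 \<longrightarrow> T q y = 0) \<and> T q y \<le> 1"
        "\<And>p q. p \<in> \<rat> \<Longrightarrow> q \<in> \<rat> \<Longrightarrow> p \<le> q \<Longrightarrow> T q y \<le> T p y" for y r q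
  proof -
    define D where "D p = {u. p < 0 \<or> (p < 1 \<and> ennreal u \<le> T p y)}" for p
    have D_meas: "D p \<in> sets U" for p unfolding D_def using y by measurable
    have D_emeasure: "emeasure U (D p) = T p y" if "p \<in> \<rat>" for p
    proof -
      consider "p < 0" | "p \<ge> 1" | "0 \<le> p" "p < 1" by linarith
      then show ?thesis
      proof cases
        case 1
        then have "D p = space U" by (auto simp: D_def)
        then show ?thesis using 1 T(1)[OF that] U.emeasure_space_1 by simp
      next
        case 2
        then have "D p = {}" by (auto simp: D_def)
        then show ?thesis using 2 T(1)[OF that] by simp
      next
        case 3
        then have "D p = {u. ennreal u \<le> T p y}" by (auto simp: D_def)
        then show ?thesis using T(1)[OF that] by (simp add: U_le)
      qed
    qed
    have D_mono: "D q \<subseteq> D p" if "p \<in> \<rat>" "q \<in> \<rat>" "p \<le> q" for p q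
      using T(2)[OF that] that(3) by (auto simp: D_def)
    have "G y -` {r<..} = (\<Union>n. D (q n))"
    proof (intro set_eqI iffI)
      fix u assume "u \<in> G y -` {r<..}"
      then obtain p where p: "p \<in> \<rat>" "r < p" "u \<in> D p" by (auto simp: G_iff D_def)
      then obtain n where "q n < p"
        using order_tendstoD(2)[OF q(4)] by (auto simp: eventually_sequentially)
      with D_mono[OF q(1)[of n] p(1)] p(3) show "u \<in> (\<Union>n. D (q n))" by auto
    next
      fix u assume "u \<in> (\<Union>n. D (q n))"
      then show "u \<in> G y -` {r<..}" using q(1,2) by (auto simp: G_iff D_def)
    qed
    then have "emeasure (\<kappa> y) {r<..} = emeasure U (\<Union>n. D (q n))"
      unfolding \<kappa>_def using y by (subst emeasure_distr) auto
    also have "\<dots> = (SUP n. emeasure U (D (q n)))"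
    proof (rule SUP_emeasure_incseq[symmetric])
      show "range (\<lambda>n. D (q n)) \<subseteq> sets U" using D_meas by blast
      show "incseq (\<lambda>n. D (q n))"
        by (intro incseq_SucI D_mono q(1) decseq_SucD[OF q(3)])
    qed
    finally show ?thesis by (simp add: D_emeasure q(1))
  qed
  have eq_tail: "emeasure M {\<omega> \<in> space M. Y \<omega> \<in> C \<and> r < X \<omega>} = (\<integral>\<^sup>+y. emeasure (\<kappa> y) {r<..} * indicator C y \<partial>distr M N Y)"
    if C[measurable]: "C \<in> sets N" for C r
  proof -
    obtain q :: "nat \<Rightarrow> real" where q: "\<And>n. q n \<in> \<rat>" "\<And>n. r < q n" "decseq q" "q \<longlonglongrightarrow> r"
      using rational_approx_from_above[of r] by metis
    have "(\<integral>\<^sup>+y. emeasure (\<kappa> y) {r<..} * indicator C y \<partial>distr M N Y)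
        = (\<integral>\<^sup>+y. (SUP n. T (q n) y * indicator C y) \<partial>distr M N Y)"
    proof (rule nn_integral_cong_AE)
      show "AE y in distr M N Y. emeasure (\<kappa> y) {r<..} * indicator C y = (SUP n. T (q n) y * indicator C y)"
        using AE_T AE_space
        by eventually_elim (subst \<kappa>_tail[OF _ q], auto simp: SUP_mult_right_ennreal)
    qed
    also have "\<dots> = (SUP n. \<integral>\<^sup>+y. T (q n) y * indicator C y \<partial>distr M N Y)"
    proof (rule nn_integral_monotone_convergence_SUP_AE)
      show "AE y in distr M N Y. T (q i) y * indicator C y \<le> T (q (Suc i)) y * indicator C y" for i
        using AE_T by eventually_elim (auto intro!: mult_right_mono simp: q(1) decseq_SucD[OF q(3)])
    qed simp
    also have "\<dots> = (SUP n. emeasure M {\<omega> \<in> space M. Y \<omega> \<in> C \<and> q n < X \<omega>})"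
      by (simp add: T_def F)
    also have "\<dots> = emeasure M (\<Union>n. {\<omega> \<in> space M. Y \<omega> \<in> C \<and> q n < X \<omega>})"
      by (rule SUP_emeasure_incseq) (auto simp: incseq_Suc_iff intro: le_less_trans[OF decseq_SucD[OF q(3)]])
    also have "(\<Union>n. {\<omega> \<in> space M. Y \<omega> \<in> C \<and> q n < X \<omega>}) = {\<omega> \<in> space M. Y \<omega> \<in> C \<and> r < X \<omega>}"
    proof -
      have "\<exists>n. q n < x" if "r < x" for x
        using order_tendstoD(2)[OF q(4) that] by (auto simp: eventually_sequentially)
      then show ?thesis using q(2) by (auto intro: less_trans)
    qed
    finally show ?thesis by simp
  qed
  have "cond_law M N Y borel X \<kappa>"
  proof (rule cond_lawI_sets[OF _ _ \<kappa>])
    fix A :: "real set" and C assume A[measurable]: "A \<in> sets borel" and C[measurable]: "C \<in> sets N"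
    have sp: "space (density (distr M N Y) (indicator C)) \<noteq> {}" using \<nu>.not_empty by simp
    have \<kappa>': "\<kappa> \<in> density (distr M N Y) (indicator C) \<rightarrow>\<^sub>M subprob_algebra borel"
      using measurable_prob_algebraD[OF \<kappa>] by simp
    have 1: "emeasure (distr (density M (\<lambda>\<omega>. indicator C (Y \<omega>))) borel X) B
        = emeasure M {\<omega> \<in> space M. Y \<omega> \<in> C \<and> X \<omega> \<in> B}" if [measurable]: "B \<in> sets borel" for B
      by (subst emeasure_distr_density, (measurable)[3])
        (subst emeasure_conj_eq_nn_integral[where N=N and L=borel], (measurable)[4], simp add: mult.commute)
    have 2: "emeasure (density (distr M N Y) (indicator C) \<bind> \<kappa>) B
        = (\<integral>\<^sup>+y. emeasure (\<kappa> y) B * indicator C y \<partial>distr M N Y)" if [measurable]: "B \<in> sets borel" for B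
      by (simp add: emeasure_bind[OF sp \<kappa>'] nn_integral_density mult.commute)
    have "distr (density M (\<lambda>\<omega>. indicator C (Y \<omega>))) borel X = density (distr M N Y) (indicator C) \<bind> \<kappa>"
    proof (rule measure_eqI_lessThan)
      fix r :: real
      show "emeasure (distr (density M (\<lambda>\<omega>. indicator C (Y \<omega>))) borel X) {r<..} < \<infinity>"
        by (simp add: 1 less_top[symmetric])
      show "emeasure (distr (density M (\<lambda>\<omega>. indicator C (Y \<omega>))) borel X) {r<..}
          = emeasure (density (distr M N Y) (indicator C) \<bind> \<kappa>) {r<..}"
        using eq_tail[OF C, of r] by (simp add: 1 2)
    qed (use sets_bind[OF sets_kernel[OF \<kappa>'] sp] in auto)
    then have "emeasure M {\<omega> \<in> space M. Y \<omega> \<in> C \<and> X \<omega> \<in> A} = (\<integral>\<^sup>+y. emeasure (\<kappa> y) A * indicator C y \<partial>distr M N Y)"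
      using 1[OF A] 2[OF A] by simp
    then show "emeasure M {\<omega> \<in> space M. Y \<omega> \<in> C \<and> X \<omega> \<in> A} = (\<integral>\<^sup>+\<omega>. indicator C (Y \<omega>) * emeasure (\<kappa> (Y \<omega>)) A \<partial>M)"
      by (simp add: nn_integral_distr mult.commute)
  qed simp_all
  then show ?thesis by blast
qed

lemma cond_law_exists:
  assumes M: "prob_space M" and Y: "Y \<in> M \<rightarrow>\<^sub>M N" and X: "X \<in> M \<rightarrow>\<^sub>M L" and L: "cantor_retract L"
  shows "\<exists>\<kappa>. cond_law M N Y L X \<kappa>"
proof -
  from L obtain f :: "_ \<Rightarrow> real" and g where f: "f \<in> L \<rightarrow>\<^sub>M borel" and g: "g \<in> borel \<rightarrow>\<^sub>M L"
    and gf: "\<And>x. x \<in> space L \<Longrightarrow> g (f x) = x" "\<And>x. f x \<in> {0..1}"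
    using cantor_retract_real[OF L] by metis
  obtain \<kappa> where \<kappa>: "cond_law M N Y borel (\<lambda>\<omega>. f (X \<omega>)) \<kappa>"
    using cond_law_exists_unit_interval[OF M Y measurable_compose[OF X f] gf(2)] by blast
  have "cond_law M N Y L X (\<lambda>y. distr (\<kappa> y) L g)"
    unfolding cond_law_def
  proof (intro conjI ballI Y X)
    show "prob_kernel N L (\<lambda>y. distr (\<kappa> y) L g)"
      using cond_lawD(3)[OF \<kappa>] measurable_distr_prob_space[OF g] by (rule measurable_compose)
    fix A and w :: "_ \<Rightarrow> ennreal" assume A: "A \<in> sets L" and w: "w \<in> borel_measurable N"
    have B: "g -` A \<in> sets borel" using measurable_sets[OF g A] by simp
    have "(\<integral>\<^sup>+\<omega>. w (Y \<omega>) * indicator A (X \<omega>) \<partial>M) = (\<integral>\<^sup>+\<omega>. w (Y \<omega>) * indicator (g -` A) (f (X \<omega>)) \<partial>M)"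
      using measurable_space[OF X] by (intro nn_integral_cong) (simp add: gf(1) indicator_def)
    also have "\<dots> = (\<integral>\<^sup>+\<omega>. w (Y \<omega>) * emeasure (\<kappa> (Y \<omega>)) (g -` A) \<partial>M)"
      by (rule cond_lawD(4)[OF \<kappa> B w])
    also have "\<dots> = (\<integral>\<^sup>+\<omega>. w (Y \<omega>) * emeasure (distr (\<kappa> (Y \<omega>)) L g) A \<partial>M)"
    proof (intro nn_integral_cong)
      fix \<omega> assume "\<omega> \<in> space M"
      then have *: "sets (\<kappa> (Y \<omega>)) = sets borel"
        using cond_lawD(3)[OF \<kappa>] measurable_space[OF Y] by (auto simp: prob_kernel_iff)
      then have "g \<in> \<kappa> (Y \<omega>) \<rightarrow>\<^sub>M L" using g by (simp cong: measurable_cong_sets)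
      with A show "w (Y \<omega>) * emeasure (\<kappa> (Y \<omega>)) (g -` A) = w (Y \<omega>) * emeasure (distr (\<kappa> (Y \<omega>)) L g) A"
        by (simp add: emeasure_distr sets_eq_imp_space_eq[OF *])
    qed
    finally show "(\<integral>\<^sup>+\<omega>. w (Y \<omega>) * indicator A (X \<omega>) \<partial>M)
        = (\<integral>\<^sup>+\<omega>. w (Y \<omega>) * emeasure (distr (\<kappa> (Y \<omega>)) L g) A \<partial>M)" .
  qed
  then show ?thesis by blast
qed

text \<open>
  The disintegration formula: it extends the defining property of a conditional law from products
  \<open>w (Y \<omega>) * indicator A (X \<omega>)\<close> to all nonnegative functions of the pair \<open>(Y, X)\<close>.
\<close>

lemma cond_law_nn_integral:
  assumes M: "prob_space M" and c: "cond_law M N Y L X \<kappa>"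
    and g[measurable]: "g \<in> borel_measurable (N \<Otimes>\<^sub>M L)"
  shows "(\<integral>\<^sup>+\<omega>. g (Y \<omega>, X \<omega>) \<partial>M) = (\<integral>\<^sup>+\<omega>. (\<integral>\<^sup>+x. g (Y \<omega>, x) \<partial>\<kappa> (Y \<omega>)) \<partial>M)"
proof -
  interpret prob_space M by fact
  note [measurable] = cond_lawD(1,2)[OF c]
  note \<kappa> = cond_lawD(3)[OF c]
  note \<kappa>_sub = measurable_prob_algebraD[OF \<kappa>]
  interpret \<nu>: prob_space "distr M N Y" by (rule prob_space_distr) simp
  have \<kappa>_sets: "sets (\<kappa> y) = sets L" if "y \<in> space N" for y
    using \<kappa> that by (auto simp: prob_kernel_iff)
  define H where "H y = distr (\<kappa> y) (N \<Otimes>\<^sub>M L) (Pair y)" for y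
  have H[measurable]: "H \<in> N \<rightarrow>\<^sub>M subprob_algebra (N \<Otimes>\<^sub>M L)"
    unfolding H_def[abs_def] by (rule measurable_distr2[OF _ \<kappa>_sub]) simp
  have H': "H \<in> distr M N Y \<rightarrow>\<^sub>M subprob_algebra (N \<Otimes>\<^sub>M L)" using H by simp
  have Pair_meas: "Pair y \<in> \<kappa> y \<rightarrow>\<^sub>M N \<Otimes>\<^sub>M L" if "y \<in> space N" for y
    using that by (simp cong: measurable_cong_sets add: \<kappa>_sets)
  let ?E = "{a \<times> b | a b. a \<in> sets N \<and> b \<in> sets L}"
  have "distr M (N \<Otimes>\<^sub>M L) (\<lambda>\<omega>. (Y \<omega>, X \<omega>)) = distr M N Y \<bind> H"
  proof (rule measure_eqI_generator_eq[where E = ?E and A = "\<lambda>_. space N \<times> space L" and \<Omega> = "space N \<times> space L"])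
    show "Int_stable ?E" by (rule Int_stable_pair_measure_generator)
    show "?E \<subseteq> Pow (space N \<times> space L)" by (auto dest: sets.sets_into_space)
    show "sets (distr M (N \<Otimes>\<^sub>M L) (\<lambda>\<omega>. (Y \<omega>, X \<omega>))) = sigma_sets (space N \<times> space L) ?E"
      by (simp add: sets_pair_measure)
    show "sets (distr M N Y \<bind> H) = sigma_sets (space N \<times> space L) ?E"
      using sets_bind[OF sets_kernel[OF H'] \<nu>.not_empty] by (simp add: sets_pair_measure)
    show "range (\<lambda>_::nat. space N \<times> space L) \<subseteq> ?E" by blast
    show "emeasure (distr M (N \<Otimes>\<^sub>M L) (\<lambda>\<omega>. (Y \<omega>, X \<omega>))) (space N \<times> space L) \<noteq> \<infinity>"
      by (simp add: emeasure_distr)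
    fix D assume "D \<in> ?E"
    then obtain C A where D: "D = C \<times> A" and C[measurable]: "C \<in> sets N" and A[measurable]: "A \<in> sets L" by blast
    have DNL: "D \<in> sets (N \<Otimes>\<^sub>M L)" unfolding D by simp
    have "emeasure (distr M (N \<Otimes>\<^sub>M L) (\<lambda>\<omega>. (Y \<omega>, X \<omega>))) D
        = (\<integral>\<^sup>+z. indicator D z \<partial>distr M (N \<Otimes>\<^sub>M L) (\<lambda>\<omega>. (Y \<omega>, X \<omega>)))"
      using DNL by simp
    also have "\<dots> = (\<integral>\<^sup>+\<omega>. indicator C (Y \<omega>) * indicator A (X \<omega>) \<partial>M)"
      by (subst nn_integral_distr) (auto simp: D indicator_times)
    also have "\<dots> = (\<integral>\<^sup>+\<omega>. indicator C (Y \<omega>) * emeasure (\<kappa> (Y \<omega>)) A \<partial>M)"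
      by (rule cond_lawD(4)[OF c A]) simp
    also have "\<dots> = (\<integral>\<^sup>+\<omega>. emeasure (H (Y \<omega>)) D \<partial>M)"
    proof (rule nn_integral_cong)
      fix \<omega> assume "\<omega> \<in> space M"
      then have y: "Y \<omega> \<in> space N" by (rule measurable_space[OF cond_lawD(1)[OF c]])
      have "Pair (Y \<omega>) -` D \<inter> space (\<kappa> (Y \<omega>)) = (if Y \<omega> \<in> C then A else {})"
        using sets.sets_into_space[OF A] sets_eq_imp_space_eq[OF \<kappa>_sets[OF y]] by (auto simp: D)
      then show "indicator C (Y \<omega>) * emeasure (\<kappa> (Y \<omega>)) A = emeasure (H (Y \<omega>)) D"
        unfolding H_def by (subst emeasure_distr[OF Pair_meas[OF y] DNL]) simp
    qed
    also have "\<dots> = emeasure (distr M N Y \<bind> H) D"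
      using DNL by (subst emeasure_bind[OF \<nu>.not_empty H']) (simp_all add: nn_integral_distr)
    finally show "emeasure (distr M (N \<Otimes>\<^sub>M L) (\<lambda>\<omega>. (Y \<omega>, X \<omega>))) D = emeasure (distr M N Y \<bind> H) D" .
  qed simp
  then have "(\<integral>\<^sup>+z. g z \<partial>distr M (N \<Otimes>\<^sub>M L) (\<lambda>\<omega>. (Y \<omega>, X \<omega>))) = (\<integral>\<^sup>+z. g z \<partial>(distr M N Y \<bind> H))"
    by simp
  then have "(\<integral>\<^sup>+\<omega>. g (Y \<omega>, X \<omega>) \<partial>M) = (\<integral>\<^sup>+\<omega>. (\<integral>\<^sup>+z. g z \<partial>H (Y \<omega>)) \<partial>M)"
    by (subst (asm) nn_integral_bind[OF g H'])
      (simp add: nn_integral_distr nn_integral_measurable_subprob_algebra2[OF _ H])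
  also have "\<dots> = (\<integral>\<^sup>+\<omega>. (\<integral>\<^sup>+x. g (Y \<omega>, x) \<partial>\<kappa> (Y \<omega>)) \<partial>M)"
  proof (rule nn_integral_cong)
    fix \<omega> assume "\<omega> \<in> space M"
    then have y: "Y \<omega> \<in> space N" by (rule measurable_space[OF cond_lawD(1)[OF c]])
    show "(\<integral>\<^sup>+z. g z \<partial>H (Y \<omega>)) = (\<integral>\<^sup>+x. g (Y \<omega>, x) \<partial>\<kappa> (Y \<omega>))"
      unfolding H_def by (rule nn_integral_distr[OF Pair_meas[OF y]]) simp
  qed
  finally show ?thesis .
qed

text \<open>
  Symmetry is built in by conditioning on the unordered pair of \<open>x\<close> and \<open>y\<close>, that is, on their minimum
  and maximum. If the joint law is invariant under exchanging \<open>x\<close> and \<open>y\<close>, then the order of the pair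
  carries no information about \<open>X\<close>: a weight may be replaced by its symmetrisation \<open>h\<close>, which is a
  function of the unordered pair.
\<close>

lemma symmetric_cond_law_exists:
  fixes x y :: "'w \<Rightarrow> real"
  assumes M: "prob_space M" and L: "cantor_retract L"
    and [measurable]: "Z \<in> M \<rightarrow>\<^sub>M N" "x \<in> borel_measurable M" "y \<in> borel_measurable M" "X \<in> M \<rightarrow>\<^sub>M L"
    and swap: "distr M ((N \<Otimes>\<^sub>M borel \<Otimes>\<^sub>M borel) \<Otimes>\<^sub>M L) (\<lambda>\<omega>. ((Z \<omega>, y \<omega>, x \<omega>), X \<omega>))
      = distr M ((N \<Otimes>\<^sub>M borel \<Otimes>\<^sub>M borel) \<Otimes>\<^sub>M L) (\<lambda>\<omega>. ((Z \<omega>, x \<omega>, y \<omega>), X \<omega>))"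
  obtains \<kappa> where "cond_law M (N \<Otimes>\<^sub>M borel \<Otimes>\<^sub>M borel) (\<lambda>\<omega>. (Z \<omega>, x \<omega>, y \<omega>)) L X \<kappa>"
    and "\<And>z a b. \<kappa> (z, a, b) = \<kappa> (z, b, a)"
proof -
  let ?N = "N \<Otimes>\<^sub>M borel \<Otimes>\<^sub>M borel :: ('b \<times> real \<times> real) measure"
  have "(\<lambda>\<omega>. (Z \<omega>, min (x \<omega>) (y \<omega>), max (x \<omega>) (y \<omega>))) \<in> M \<rightarrow>\<^sub>M ?N" by measurable
  from cond_law_exists[OF M this assms(6) L]
  obtain \<kappa>' where c: "cond_law M ?N (\<lambda>\<omega>. (Z \<omega>, min (x \<omega>) (y \<omega>), max (x \<omega>) (y \<omega>))) L X \<kappa>'" by blast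
  define sorted where "sorted = (\<lambda>(z::'b, a::real, b). (z, min a b, max a b))"
  have [measurable]: "sorted \<in> ?N \<rightarrow>\<^sub>M ?N" unfolding sorted_def by measurable
  define \<kappa> where "\<kappa> q = \<kappa>' (sorted q)" for q
  have sym: "\<kappa> (z, a, b) = \<kappa> (z, b, a)" for z a b
    by (simp add: \<kappa>_def sorted_def min.commute max.commute)
  have \<kappa>: "prob_kernel ?N L \<kappa>"
    unfolding \<kappa>_def[abs_def] by (rule measurable_compose[OF _ cond_lawD(3)[OF c]]) measurable
  have "cond_law M ?N (\<lambda>\<omega>. (Z \<omega>, x \<omega>, y \<omega>)) L X \<kappa>"
    unfolding cond_law_def
  proof (intro conjI ballI \<kappa>)
    fix A and w :: "'b \<times> real \<times> real \<Rightarrow> ennreal"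
    assume A[measurable]: "A \<in> sets L" and w[measurable]: "w \<in> borel_measurable ?N"
    have u[measurable]: "(\<lambda>q. emeasure (\<kappa> q) A) \<in> borel_measurable ?N"
      using \<kappa> A by (auto simp: prob_kernel_iff)
    have int: "(\<integral>\<^sup>+\<omega>. f ((Z \<omega>, y \<omega>, x \<omega>), X \<omega>) \<partial>M) = (\<integral>\<^sup>+\<omega>. f ((Z \<omega>, x \<omega>, y \<omega>), X \<omega>) \<partial>M)"
      if [measurable]: "f \<in> borel_measurable (?N \<Otimes>\<^sub>M L)" for f :: "_ \<Rightarrow> ennreal"
      using arg_cong[OF swap, of "\<lambda>D. integral\<^sup>N D f"] by (simp add: nn_integral_distr)
    define h where "h = (\<lambda>(z, a, b). w (z, a, b) + w (z, b, a))"
    have h[measurable]: "h \<in> borel_measurable ?N" unfolding h_def by measurable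
    have h_sorted: "h (sorted (z, a, b)) = h (z, a, b)" for z a b
      by (cases "a \<le> b") (auto simp: h_def sorted_def min_def max_def add.commute)
    have double: "(\<integral>\<^sup>+\<omega>. h (Z \<omega>, x \<omega>, y \<omega>) * f ((Z \<omega>, x \<omega>, y \<omega>), X \<omega>) \<partial>M)
        = 2 * (\<integral>\<^sup>+\<omega>. w (Z \<omega>, x \<omega>, y \<omega>) * f ((Z \<omega>, x \<omega>, y \<omega>), X \<omega>) \<partial>M)"
      if [measurable]: "f \<in> borel_measurable (?N \<Otimes>\<^sub>M L)" and f_sym: "\<And>z a b q. f ((z, a, b), q) = f ((z, b, a), q)"
      for f :: "_ \<Rightarrow> ennreal"
    proof -
      have "(\<integral>\<^sup>+\<omega>. h (Z \<omega>, x \<omega>, y \<omega>) * f ((Z \<omega>, x \<omega>, y \<omega>), X \<omega>) \<partial>M)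
          = (\<integral>\<^sup>+\<omega>. w (Z \<omega>, x \<omega>, y \<omega>) * f ((Z \<omega>, x \<omega>, y \<omega>), X \<omega>)
              + w (Z \<omega>, y \<omega>, x \<omega>) * f ((Z \<omega>, y \<omega>, x \<omega>), X \<omega>) \<partial>M)"
      proof (intro nn_integral_cong)
        fix \<omega>
        show "h (Z \<omega>, x \<omega>, y \<omega>) * f ((Z \<omega>, x \<omega>, y \<omega>), X \<omega>)
            = w (Z \<omega>, x \<omega>, y \<omega>) * f ((Z \<omega>, x \<omega>, y \<omega>), X \<omega>) + w (Z \<omega>, y \<omega>, x \<omega>) * f ((Z \<omega>, y \<omega>, x \<omega>), X \<omega>)"
          using f_sym[of "Z \<omega>" "x \<omega>" "y \<omega>" "X \<omega>"] by (simp add: h_def distrib_right)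
      qed
      also have "\<dots> = (\<integral>\<^sup>+\<omega>. w (Z \<omega>, x \<omega>, y \<omega>) * f ((Z \<omega>, x \<omega>, y \<omega>), X \<omega>) \<partial>M)
          + (\<integral>\<^sup>+\<omega>. w (Z \<omega>, y \<omega>, x \<omega>) * f ((Z \<omega>, y \<omega>, x \<omega>), X \<omega>) \<partial>M)"
        by (rule nn_integral_add) measurable
      also have "(\<integral>\<^sup>+\<omega>. w (Z \<omega>, y \<omega>, x \<omega>) * f ((Z \<omega>, y \<omega>, x \<omega>), X \<omega>) \<partial>M)
          = (\<integral>\<^sup>+\<omega>. w (Z \<omega>, x \<omega>, y \<omega>) * f ((Z \<omega>, x \<omega>, y \<omega>), X \<omega>) \<partial>M)"
        using int[of "\<lambda>q. w (fst q) * f q"] by simp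
      finally show ?thesis by (simp add: mult_2)
    qed
    have "2 * (\<integral>\<^sup>+\<omega>. w (Z \<omega>, x \<omega>, y \<omega>) * indicator A (X \<omega>) \<partial>M)
        = (\<integral>\<^sup>+\<omega>. h (Z \<omega>, x \<omega>, y \<omega>) * indicator A (X \<omega>) \<partial>M)"
      using double[of "\<lambda>q. indicator A (snd q)"] by simp
    also have "\<dots> = (\<integral>\<^sup>+\<omega>. h (sorted (Z \<omega>, x \<omega>, y \<omega>)) * indicator A (X \<omega>) \<partial>M)"
      by (simp add: h_sorted)
    also have "\<dots> = (\<integral>\<^sup>+\<omega>. h (sorted (Z \<omega>, x \<omega>, y \<omega>)) * emeasure (\<kappa> (Z \<omega>, x \<omega>, y \<omega>)) A \<partial>M)"
      using cond_lawD(4)[OF c A h] by (simp add: sorted_def \<kappa>_def)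
    also have "\<dots> = (\<integral>\<^sup>+\<omega>. h (Z \<omega>, x \<omega>, y \<omega>) * emeasure (\<kappa> (Z \<omega>, x \<omega>, y \<omega>)) A \<partial>M)"
      by (simp add: h_sorted)
    also have "\<dots> = 2 * (\<integral>\<^sup>+\<omega>. w (Z \<omega>, x \<omega>, y \<omega>) * emeasure (\<kappa> (Z \<omega>, x \<omega>, y \<omega>)) A \<partial>M)"
      using double[of "\<lambda>q. emeasure (\<kappa> (fst q)) A"] by (simp add: sym)
    finally show "(\<integral>\<^sup>+\<omega>. w (Z \<omega>, x \<omega>, y \<omega>) * indicator A (X \<omega>) \<partial>M)
        = (\<integral>\<^sup>+\<omega>. w (Z \<omega>, x \<omega>, y \<omega>) * emeasure (\<kappa> (Z \<omega>, x \<omega>, y \<omega>)) A \<partial>M)"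
      by (simp add: ennreal_mult_cancel_left)
  qed measurable
  from this sym show thesis by (rule that)
qed

section \<open>Conditional independence from equality in law\<close>

definition factors_through ::
    "'w measure \<Rightarrow> 'y measure \<Rightarrow> ('w \<Rightarrow> 'y) \<Rightarrow> 'q measure \<Rightarrow> ('w \<Rightarrow> 'q) \<Rightarrow> bool" where
  "factors_through M N Y Q W \<longleftrightarrow> (\<exists>\<rho>\<in>N \<rightarrow>\<^sub>M Q. \<forall>\<omega>\<in>space M. W \<omega> = \<rho> (Y \<omega>))"

lemma factors_through_self: "h \<in> N \<rightarrow>\<^sub>M Q \<Longrightarrow> factors_through M N Y Q (\<lambda>\<omega>. h (Y \<omega>))"
  unfolding factors_through_def by blast

lemma factors_through_compose:
  assumes "factors_through M N Y Q W" and "h \<in> Q \<rightarrow>\<^sub>M Q'"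
  shows "factors_through M N Y Q' (\<lambda>\<omega>. h (W \<omega>))"
  using assms unfolding factors_through_def by (metis measurable_compose)

lemma factors_through_Pair:
  assumes "factors_through M N Y Q W" and "factors_through M N Y Q' W'"
  shows "factors_through M N Y (Q \<Otimes>\<^sub>M Q') (\<lambda>\<omega>. (W \<omega>, W' \<omega>))"
proof -
  from assms obtain \<rho> \<rho>' where "\<rho> \<in> N \<rightarrow>\<^sub>M Q" "\<rho>' \<in> N \<rightarrow>\<^sub>M Q'"
    "\<forall>\<omega>\<in>space M. W \<omega> = \<rho> (Y \<omega>)" "\<forall>\<omega>\<in>space M. W' \<omega> = \<rho>' (Y \<omega>)"
    unfolding factors_through_def by blast
  then show ?thesis
    unfolding factors_through_def by (intro bexI[of _ "\<lambda>y. (\<rho> y, \<rho>' y)"]) auto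
qed

lemma factors_through_PiM:
  assumes "\<And>i. i \<in> I \<Longrightarrow> factors_through M N Y (Q i) (\<lambda>\<omega>. W \<omega> i)"
  shows "factors_through M N Y (\<Pi>\<^sub>M i\<in>I. Q i) (\<lambda>\<omega>. \<lambda>i\<in>I. W \<omega> i)"
proof -
  have "\<forall>i\<in>I. \<exists>\<rho>. \<rho> \<in> N \<rightarrow>\<^sub>M Q i \<and> (\<forall>\<omega>\<in>space M. W \<omega> i = \<rho> (Y \<omega>))"
    using assms unfolding factors_through_def by blast
  from bchoice[OF this] obtain \<rho> where
    \<rho>: "\<forall>i\<in>I. \<rho> i \<in> N \<rightarrow>\<^sub>M Q i \<and> (\<forall>\<omega>\<in>space M. W \<omega> i = \<rho> i (Y \<omega>))" by blast
  then have "(\<lambda>y. \<lambda>i\<in>I. \<rho> i y) \<in> N \<rightarrow>\<^sub>M (\<Pi>\<^sub>M i\<in>I. Q i)"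
    by (intro measurable_restrict) blast
  with \<rho> show ?thesis
    unfolding factors_through_def by (intro bexI[of _ "\<lambda>y. \<lambda>i\<in>I. \<rho> i y"]) (auto simp: restrict_def)
qed

lemma factors_through_trans:
  assumes "factors_through M N Y Q W" and "factors_through M Q W R V"
  shows "factors_through M N Y R V"
proof -
  from assms obtain \<rho> \<rho>' where "\<rho> \<in> N \<rightarrow>\<^sub>M Q" "\<forall>\<omega>\<in>space M. W \<omega> = \<rho> (Y \<omega>)"
    "\<rho>' \<in> Q \<rightarrow>\<^sub>M R" "\<forall>\<omega>\<in>space M. V \<omega> = \<rho>' (W \<omega>)"
    unfolding factors_through_def by blast
  then show ?thesis
    unfolding factors_through_def by (intro bexI[of _ "\<lambda>y. \<rho>' (\<rho> y)"]) auto
qed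

lemma cond_law_transfer:
  assumes c: "cond_law M N Y L X \<kappa>"
    and [measurable]: "Y' \<in> M' \<rightarrow>\<^sub>M N" "X' \<in> M' \<rightarrow>\<^sub>M L"
    and eq: "distr M' (N \<Otimes>\<^sub>M L) (\<lambda>\<omega>. (Y' \<omega>, X' \<omega>)) = distr M (N \<Otimes>\<^sub>M L) (\<lambda>\<omega>. (Y \<omega>, X \<omega>))"
  shows "cond_law M' N Y' L X' \<kappa>"
proof -
  note [measurable] = cond_lawD(1,2)[OF c]
  have int: "(\<integral>\<^sup>+\<omega>. f (Y' \<omega>, X' \<omega>) \<partial>M') = (\<integral>\<^sup>+\<omega>. f (Y \<omega>, X \<omega>) \<partial>M)"
    if [measurable]: "f \<in> borel_measurable (N \<Otimes>\<^sub>M L)" for f :: "_ \<Rightarrow> ennreal"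
    using arg_cong[OF eq, of "\<lambda>D. integral\<^sup>N D f"] by (simp add: nn_integral_distr)
  show ?thesis
    unfolding cond_law_def
  proof (intro conjI ballI cond_lawD(3)[OF c])
    fix A and w :: "_ \<Rightarrow> ennreal"
    assume A[measurable]: "A \<in> sets L" and w[measurable]: "w \<in> borel_measurable N"
    have [measurable]: "(\<lambda>y. emeasure (\<kappa> y) A) \<in> borel_measurable N"
      using cond_lawD(3)[OF c] A by (auto simp: prob_kernel_iff)
    have "(\<integral>\<^sup>+\<omega>. w (Y' \<omega>) * indicator A (X' \<omega>) \<partial>M') = (\<integral>\<^sup>+\<omega>. w (Y \<omega>) * indicator A (X \<omega>) \<partial>M)"
      using int[of "\<lambda>(y, x). w y * indicator A x"] by simp
    also have "\<dots> = (\<integral>\<^sup>+\<omega>. w (Y \<omega>) * emeasure (\<kappa> (Y \<omega>)) A \<partial>M)"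
      by (rule cond_lawD(4)[OF c A w])
    also have "\<dots> = (\<integral>\<^sup>+\<omega>. w (Y' \<omega>) * emeasure (\<kappa> (Y' \<omega>)) A \<partial>M')"
      using int[of "\<lambda>(y, x). w y * emeasure (\<kappa> y) A"] by simp
    finally show "(\<integral>\<^sup>+\<omega>. w (Y' \<omega>) * indicator A (X' \<omega>) \<partial>M')
        = (\<integral>\<^sup>+\<omega>. w (Y' \<omega>) * emeasure (\<kappa> (Y' \<omega>)) A \<partial>M')" .
  qed measurable
qed

text \<open>
  The hypotheses say that \<open>(f - g)\<^sup>2\<close> has integral zero.
\<close>

lemma AE_eq_if_nn_integral_products_eq:
  fixes f g :: "'w \<Rightarrow> ennreal"
  assumes "prob_space M" and [measurable]: "f \<in> borel_measurable M" "g \<in> borel_measurable M"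
    and le: "\<And>x. x \<in> space M \<Longrightarrow> f x \<le> 1" "\<And>x. x \<in> space M \<Longrightarrow> g x \<le> 1"
    and eq: "(\<integral>\<^sup>+x. f x * f x \<partial>M) = (\<integral>\<^sup>+x. f x * g x \<partial>M)" "(\<integral>\<^sup>+x. g x * g x \<partial>M) = (\<integral>\<^sup>+x. f x * g x \<partial>M)"
  shows "AE x in M. f x = g x"
proof -
  interpret prob_space M by fact
  \<comment> \<open>Subtraction of extended nonnegative reals is truncated at zero, so one of the two summands
    vanishes and the other one is the square of the difference.\<close>
  define d where "d x = (f x - g x) * (f x - g x) + (g x - f x) * (g x - f x)" for x
  have [measurable]: "d \<in> borel_measurable M" unfolding d_def[abs_def] by measurable
  have "d x + 2 * (f x * g x) = f x * f x + g x * g x" if x: "x \<in> space M" for x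
  proof -
    obtain a where a: "f x = ennreal a" "0 \<le> a"
      using le(1)[OF x] by (cases "f x") (auto simp: top_unique)
    obtain b where b: "g x = ennreal b" "0 \<le> b"
      using le(2)[OF x] by (cases "g x") (auto simp: top_unique)
    consider "a \<le> b" | "b \<le> a" by linarith
    then show ?thesis
    proof cases
      case 1
      have "(b - a) * (b - a) + (a * b + a * b) = a * a + b * b" by algebra
      then show ?thesis
        using a b 1 unfolding d_def mult_2
        by (simp add: ennreal_minus ennreal_neg ennreal_mult[symmetric] ennreal_plus[symmetric] del: ennreal_plus)
    next
      case 2
      have "(a - b) * (a - b) + (a * b + a * b) = a * a + b * b" by algebra
      then show ?thesis
        using a b 2 unfolding d_def mult_2
        by (simp add: ennreal_minus ennreal_neg ennreal_mult[symmetric] ennreal_plus[symmetric] del: ennreal_plus)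
    qed
  qed
  then have "(\<integral>\<^sup>+x. d x + 2 * (f x * g x) \<partial>M) = (\<integral>\<^sup>+x. f x * f x + g x * g x \<partial>M)"
    by (intro nn_integral_cong)
  then have "(\<integral>\<^sup>+x. d x \<partial>M) + 2 * (\<integral>\<^sup>+x. f x * g x \<partial>M) = 2 * (\<integral>\<^sup>+x. f x * g x \<partial>M)"
    by (simp add: nn_integral_add nn_integral_cmult eq mult_2)
  moreover have "(\<integral>\<^sup>+x. f x * g x \<partial>M) \<le> (\<integral>\<^sup>+x. 1 \<partial>M)"
    using le by (intro nn_integral_mono) (metis mult_mono mult_1 zero_le)
  then have "2 * (\<integral>\<^sup>+x. f x * g x \<partial>M) \<noteq> \<top>"
    using emeasure_space_1 by (auto simp: ennreal_mult_eq_top_iff top_unique)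
  ultimately have "(\<integral>\<^sup>+x. d x \<partial>M) = 0"
    by (metis add.commute add.right_neutral ennreal_add_left_cancel infinity_ennreal_def)
  then have "AE x in M. d x = 0" by (simp add: nn_integral_0_iff_AE)
  then show ?thesis
    using AE_space
  proof eventually_elim
    case (elim x)
    then have "f x - g x = 0" "g x - f x = 0" by (auto simp: d_def)
    then show ?case
      using le[of x] elim(2) by (auto simp: diff_eq_0_iff_ennreal intro: antisym)
  qed
qed

text \<open>
  Write \<open>u\<close> for the conditional probability of \<open>X \<in> A\<close> as a function of the condition. By equality in
  law it is the same function for \<open>Y\<close> and for \<open>Y'\<close>, and \<open>u (Y \<omega>)\<close> and \<open>u (Y' \<omega>)\<close> have the same second
  moment. Since \<open>Y\<close> is a function of \<open>Y'\<close>, the mixed moment has this value as well, so \<open>u (Y \<omega>)\<close> and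
  \<open>u (Y' \<omega>)\<close> agree almost surely. Consequently \<open>X\<close> is conditionally independent of \<open>Y'\<close>, and of
  everything that \<open>Y'\<close> determines, given \<open>Y\<close>.
\<close>

lemma cond_law_of_larger_conditioning:
  assumes M: "prob_space M" and c: "cond_law M N Y L X \<kappa>"
    and Y'[measurable]: "Y' \<in> M \<rightarrow>\<^sub>M N"
    and eq: "distr M (N \<Otimes>\<^sub>M L) (\<lambda>\<omega>. (Y' \<omega>, X \<omega>)) = distr M (N \<Otimes>\<^sub>M L) (\<lambda>\<omega>. (Y \<omega>, X \<omega>))"
    and Y: "factors_through M N Y' N Y" and W: "factors_through M N Y' Q W"
    and w[measurable]: "w \<in> borel_measurable Q" and A[measurable]: "A \<in> sets L"
  shows "(\<integral>\<^sup>+\<omega>. w (W \<omega>) * indicator A (X \<omega>) \<partial>M) = (\<integral>\<^sup>+\<omega>. w (W \<omega>) * emeasure (\<kappa> (Y \<omega>)) A \<partial>M)"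
proof -
  note [measurable] = cond_lawD(1,2)[OF c]
  have c': "cond_law M N Y' L X \<kappa>"
    by (rule cond_law_transfer[OF c _ _ eq]) measurable
  define u where "u y = emeasure (\<kappa> y) A" for y
  have u[measurable]: "u \<in> borel_measurable N"
    using cond_lawD(3)[OF c] A by (auto simp: prob_kernel_iff u_def[abs_def])
  have u_le: "u y \<le> 1" if "y \<in> space N" for y
    using cond_lawD(3)[OF c] that unfolding u_def
    by (auto simp: prob_kernel_iff prob_space_imp_subprob_space intro!: subprob_space.subprob_emeasure_le_1)
  from Y obtain R where R[measurable]: "R \<in> N \<rightarrow>\<^sub>M N" and Y_R: "\<And>\<omega>. \<omega> \<in> space M \<Longrightarrow> Y \<omega> = R (Y' \<omega>)"
    unfolding factors_through_def by blast
  from W obtain \<rho> where \<rho>[measurable]: "\<rho> \<in> N \<rightarrow>\<^sub>M Q" and W_\<rho>: "\<And>\<omega>. \<omega> \<in> space M \<Longrightarrow> W \<omega> = \<rho> (Y' \<omega>)"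
    unfolding factors_through_def by blast
  have "AE \<omega> in M. u (Y' \<omega>) = u (Y \<omega>)"
  proof (rule AE_eq_if_nn_integral_products_eq[OF M])
    have uu[measurable]: "(\<lambda>y. u (R y)) \<in> borel_measurable N" by measurable
    have mixed: "(\<integral>\<^sup>+\<omega>. u (Y' \<omega>) * u (Y \<omega>) \<partial>M) = (\<integral>\<^sup>+\<omega>. u (Y \<omega>) * u (Y \<omega>) \<partial>M)"
    proof -
      have "(\<integral>\<^sup>+\<omega>. u (Y' \<omega>) * u (Y \<omega>) \<partial>M) = (\<integral>\<^sup>+\<omega>. u (R (Y' \<omega>)) * u (Y' \<omega>) \<partial>M)"
        by (intro nn_integral_cong) (simp add: Y_R mult.commute)
      also have "\<dots> = (\<integral>\<^sup>+\<omega>. u (R (Y' \<omega>)) * indicator A (X \<omega>) \<partial>M)"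
        using cond_lawD(4)[OF c' A uu] by (simp add: u_def)
      also have "\<dots> = (\<integral>\<^sup>+\<omega>. u (Y \<omega>) * indicator A (X \<omega>) \<partial>M)"
        by (intro nn_integral_cong) (simp add: Y_R)
      also have "\<dots> = (\<integral>\<^sup>+\<omega>. u (Y \<omega>) * u (Y \<omega>) \<partial>M)"
        using cond_lawD(4)[OF c A u] by (simp add: u_def)
      finally show ?thesis .
    qed
    have "(\<integral>\<^sup>+\<omega>. u (Y' \<omega>) * u (Y' \<omega>) \<partial>M) = (\<integral>\<^sup>+\<omega>. u (Y \<omega>) * u (Y \<omega>) \<partial>M)"
      using arg_cong[OF eq, of "\<lambda>D. integral\<^sup>N D (\<lambda>(y, x). u y * u y)"] by (simp add: nn_integral_distr)
    with mixed show "(\<integral>\<^sup>+\<omega>. u (Y' \<omega>) * u (Y' \<omega>) \<partial>M) = (\<integral>\<^sup>+\<omega>. u (Y' \<omega>) * u (Y \<omega>) \<partial>M)"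
      "(\<integral>\<^sup>+\<omega>. u (Y \<omega>) * u (Y \<omega>) \<partial>M) = (\<integral>\<^sup>+\<omega>. u (Y' \<omega>) * u (Y \<omega>) \<partial>M)"
      by simp_all
  qed (use u_le measurable_space[OF Y'] measurable_space[OF cond_lawD(1)[OF c]] in auto)
  then have "(\<integral>\<^sup>+\<omega>. w (\<rho> (Y' \<omega>)) * u (Y' \<omega>) \<partial>M) = (\<integral>\<^sup>+\<omega>. w (\<rho> (Y' \<omega>)) * u (Y \<omega>) \<partial>M)"
    by (intro nn_integral_cong_AE) auto
  moreover have "(\<integral>\<^sup>+\<omega>. w (\<rho> (Y' \<omega>)) * indicator A (X \<omega>) \<partial>M) = (\<integral>\<^sup>+\<omega>. w (\<rho> (Y' \<omega>)) * u (Y' \<omega>) \<partial>M)"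
    using cond_lawD(4)[OF c' A, of "\<lambda>y. w (\<rho> y)"] by (simp add: u_def)
  moreover have "(\<integral>\<^sup>+\<omega>. w (W \<omega>) * f \<omega> \<partial>M) = (\<integral>\<^sup>+\<omega>. w (\<rho> (Y' \<omega>)) * f \<omega> \<partial>M)" for f
    by (intro nn_integral_cong) (simp add: W_\<rho>)
  ultimately show ?thesis by (simp add: u_def)
qed

section \<open>Invariance under injective relabelling\<close>

lemma doubleton_in_nsets: "{a, b} \<in> [V]\<^bsup>2\<^esup> \<longleftrightarrow> a \<noteq> b \<and> a \<in> V \<and> b \<in> V"
  by (cases "a = b") (auto simp: nsets_def)

lemma nsets_2E:
  assumes "e \<in> [V]\<^bsup>2\<^esup>"
  obtains a b where "e = {a, b}" "a \<noteq> b" "a \<in> V" "b \<in> V"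
  using assms by (auto simp: nsets_def card_2_iff)

lemma image_in_nsets:
  assumes "e \<in> [V]\<^bsup>n\<^esup>" "inj_on f V" "f ` V \<subseteq> S"
  shows "f ` e \<in> [S]\<^bsup>n\<^esup>"
proof -
  have "e \<subseteq> V" using assms(1) by (simp add: nsets_def)
  then have "inj_on f e" "f ` e \<subseteq> S" using assms(2,3) by (auto intro: inj_on_subset)
  then show ?thesis using assms(1) by (simp add: nsets_def card_image)
qed

lemma finite_injection_extends_to_Sym0:
  assumes "finite V" "inj_on f V" "V \<subseteq> S" "f ` V \<subseteq> S"
  obtains g where "g \<in> Sym0 S" "\<And>v. v \<in> V \<Longrightarrow> g v = f v"
proof -
  define W where "W = V \<union> f ` V"
  have "finite W" using assms by (simp add: W_def)
  have "card (W - V) = card (W - f ` V)"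
    using assms \<open>finite W\<close> by (simp add: card_Diff_subset card_image W_def)
  then obtain h where h: "bij_betw h (W - V) (W - f ` V)"
    using finite_same_card_bij[of "W - V" "W - f ` V"] \<open>finite W\<close> by auto
  define g where "g x = (if x \<in> V then f x else if x \<in> W then h x else x)" for x
  have "bij_betw g V (f ` V)"
    using assms(2) by (subst bij_betw_cong[of _ _ f]) (auto simp: g_def bij_betw_def)
  moreover have "bij_betw g (W - V) (W - f ` V)"
    using h by (subst bij_betw_cong[of _ _ h]) (auto simp: g_def)
  ultimately have "bij_betw g (V \<union> (W - V)) (f ` V \<union> (W - f ` V))"
    by (rule bij_betw_combine) auto
  then have "bij_betw g W W"
    by (simp add: W_def Un_absorb1 Un_Diff_cancel)
  then have "g permutes W"
    by (rule bij_imp_permutes) (auto simp: g_def W_def)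
  then have "g permutes S"
    using assms(3,4) by (auto simp: W_def intro: permutes_subset)
  moreover have "{s \<in> S. g s \<noteq> s} \<subseteq> W" by (auto simp: g_def W_def)
  then have "finite {s \<in> S. g s \<noteq> s}" using \<open>finite W\<close> by (rule finite_subset)
  ultimately show thesis by (intro that[of g]) (auto simp: Sym0_def g_def)
qed

text \<open>
  A finite family of edges sees only finitely many vertices, and there the injection agrees with a
  finitely supported permutation. So invariance under \<open>Sym0 S\<close> gives equality on cylinder sets, hence
  everywhere.
\<close>

lemma distr_relabel:
  fixes S :: "'s set" and K :: "'k measure"
  assumes ex: "exchangeable_random_coloured_graph S K \<mu>"
    and V: "V \<subseteq> S" and \<phi>: "inj_on \<phi> V" "\<phi> ` V \<subseteq> S"
  shows "distr \<mu> (\<Pi>\<^sub>M e\<in>[V]\<^bsup>2\<^esup>. K) (\<lambda>\<omega>. \<lambda>e\<in>[V]\<^bsup>2\<^esup>. \<omega> (\<phi> ` e)) = distr \<mu> (\<Pi>\<^sub>M e\<in>[V]\<^bsup>2\<^esup>. K) (\<lambda>\<omega>. \<lambda>e\<in>[V]\<^bsup>2\<^esup>. \<omega> e)"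
proof -
  interpret prob_space \<mu> using ex by (simp add: exchangeable_random_coloured_graph_def)
  have sets_\<mu>: "sets \<mu> = sets (\<Pi>\<^sub>M e\<in>[S]\<^bsup>2\<^esup>. K)"
    using ex by (simp add: exchangeable_random_coloured_graph_def coloured_graphs_def)
  note [measurable_cong] = sets_\<mu>
  have space_\<mu>: "space \<mu> = ([S]\<^bsup>2\<^esup> \<rightarrow>\<^sub>E space K)"
    using sets_eq_imp_space_eq[OF sets_\<mu>] by (simp add: space_PiM)
  have coord: "(\<lambda>\<omega>. \<omega> e) \<in> \<mu> \<rightarrow>\<^sub>M K" if "e \<in> [S]\<^bsup>2\<^esup>" for e
    using measurable_component_singleton[OF that, of "\<lambda>_. K"] by (simp cong: measurable_cong_sets add: sets_\<mu>)
  have img: "\<psi> ` e \<in> [S]\<^bsup>2\<^esup>" if "e \<in> [V]\<^bsup>2\<^esup>" "inj_on \<psi> V" "\<psi> ` V \<subseteq> S" for \<psi> e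
    using that by (rule image_in_nsets)
  have meas: "(\<lambda>\<omega>. \<lambda>e\<in>[V]\<^bsup>2\<^esup>. \<omega> (\<psi> ` e)) \<in> \<mu> \<rightarrow>\<^sub>M (\<Pi>\<^sub>M e\<in>[V]\<^bsup>2\<^esup>. K)"
    if "inj_on \<psi> V" "\<psi> ` V \<subseteq> S" for \<psi>
    by (intro measurable_restrict coord img that)
  note m1 = meas[OF \<phi>] and m2 = meas[OF inj_on_id, simplified, OF V]
  interpret D1: prob_space "distr \<mu> (\<Pi>\<^sub>M e\<in>[V]\<^bsup>2\<^esup>. K) (\<lambda>\<omega>. \<lambda>e\<in>[V]\<^bsup>2\<^esup>. \<omega> (\<phi> ` e))"
    by (rule prob_space_distr[OF m1])
  show ?thesis
  proof (rule measure_eqI_PiM_infinite)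
    fix A J assume J: "finite J" "J \<subseteq> [V]\<^bsup>2\<^esup>" and A: "\<And>i. i \<in> J \<Longrightarrow> A i \<in> sets K"
    define U where "U = \<Union>J"
    have U: "finite U" "U \<subseteq> V"
      using J by (auto simp: U_def nsets_def)
    have JU: "e \<subseteq> U" if "e \<in> J" for e using that by (auto simp: U_def)
    have "inj_on \<phi> U" "U \<subseteq> S" "\<phi> ` U \<subseteq> S"
      using U(2) V \<phi> by (auto intro: inj_on_subset)
    with U(1) obtain g where g: "g \<in> Sym0 S" "\<And>v. v \<in> U \<Longrightarrow> g v = \<phi> v"
      using finite_injection_extends_to_Sym0[of U \<phi> S] by metis
    have gJ: "g ` e = \<phi> ` e" if "e \<in> J" for e
      using JU[OF that] g(2) by (auto intro!: image_cong)
    define B where "B = prod_emb ([V]\<^bsup>2\<^esup>) (\<lambda>_. K) J (Pi\<^sub>E J A)"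
    have B[measurable]: "B \<in> sets (\<Pi>\<^sub>M e\<in>[V]\<^bsup>2\<^esup>. K)"
      unfolding B_def using J A by (intro sets_PiM_I) auto
    have B_iff: "(\<lambda>e\<in>[V]\<^bsup>2\<^esup>. x e) \<in> B \<longleftrightarrow> (\<forall>e\<in>J. x e \<in> A e)"
      if "\<And>e. e \<in> [V]\<^bsup>2\<^esup> \<Longrightarrow> x e \<in> space K" for x
      using J(2) that by (auto simp: B_def prod_emb_def PiE_iff)
    have VS: "e \<in> [S]\<^bsup>2\<^esup>" if "e \<in> [V]\<^bsup>2\<^esup>" for e
      using that V by (auto simp: nsets_def)
    have va: "vertex_action S g \<in> \<mu> \<rightarrow>\<^sub>M coloured_graphs S K"
      unfolding vertex_action_def coloured_graphs_def
    proof (intro measurable_restrict coord)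
      fix e assume "e \<in> [S]\<^bsup>2\<^esup>"
      moreover have "g permutes S" using g(1) by (simp add: Sym0_def)
      ultimately show "g ` e \<in> [S]\<^bsup>2\<^esup>"
        by (auto simp: nsets_def card_image permutes_inj_on permutes_in_image)
    qed
    have inv: "distr \<mu> (coloured_graphs S K) (vertex_action S g) = \<mu>"
      using ex g(1) by (simp add: exchangeable_random_coloured_graph_def)
    define E where "E = {\<omega> \<in> space \<mu>. \<forall>e\<in>J. \<omega> e \<in> A e}"
    have E: "E \<in> sets \<mu>"
    proof -
      have "{\<omega> \<in> space \<mu>. \<omega> e \<in> A e} \<in> sets \<mu>" if "e \<in> J" for e
        using measurable_sets[OF coord A[OF that]] J(2) VS that
        by (simp add: vimage_def Int_def conj_commute subset_eq)
      then show ?thesis unfolding E_def using J(1) by (rule sets.sets_Collect_finite_All)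
    qed
    have "emeasure (distr \<mu> (\<Pi>\<^sub>M e\<in>[V]\<^bsup>2\<^esup>. K) (\<lambda>\<omega>. \<lambda>e\<in>[V]\<^bsup>2\<^esup>. \<omega> (\<phi> ` e))) B
        = emeasure \<mu> {\<omega> \<in> space \<mu>. \<forall>e\<in>J. \<omega> (\<phi> ` e) \<in> A e}"
    proof (subst emeasure_distr[OF m1 B], rule arg_cong[where f = "emeasure \<mu>"])
      have "(\<lambda>e\<in>[V]\<^bsup>2\<^esup>. \<omega> (\<phi> ` e)) \<in> B \<longleftrightarrow> (\<forall>e\<in>J. \<omega> (\<phi> ` e) \<in> A e)" if "\<omega> \<in> space \<mu>" for \<omega>
        using img[OF _ \<phi>] that by (intro B_iff) (auto simp: space_\<mu>)
      then show "(\<lambda>\<omega>. \<lambda>e\<in>[V]\<^bsup>2\<^esup>. \<omega> (\<phi> ` e)) -` B \<inter> space \<mu> = {\<omega> \<in> space \<mu>. \<forall>e\<in>J. \<omega> (\<phi> ` e) \<in> A e}"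
        by auto
    qed
    also have "{\<omega> \<in> space \<mu>. \<forall>e\<in>J. \<omega> (\<phi> ` e) \<in> A e} = vertex_action S g -` E \<inter> space \<mu>"
    proof -
      have "vertex_action S g \<omega> \<in> space \<mu>" if "\<omega> \<in> space \<mu>" for \<omega>
        using measurable_space[OF va that] by (simp add: space_\<mu> coloured_graphs_def space_PiM)
      moreover have "vertex_action S g \<omega> e = \<omega> (\<phi> ` e)" if "e \<in> J" for e and \<omega> :: "'s set \<Rightarrow> 'k"
        using that gJ J(2) VS by (auto simp: vertex_action_def)
      ultimately show ?thesis by (auto simp: E_def)
    qed
    also have "emeasure \<mu> \<dots> = emeasure (distr \<mu> (coloured_graphs S K) (vertex_action S g)) E"
      using E by (subst emeasure_distr[OF va]) (simp_all add: coloured_graphs_def sets_\<mu>)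
    also have "\<dots> = emeasure \<mu> E" by (simp add: inv)
    also have "\<dots> = emeasure (distr \<mu> (\<Pi>\<^sub>M e\<in>[V]\<^bsup>2\<^esup>. K) (\<lambda>\<omega>. \<lambda>e\<in>[V]\<^bsup>2\<^esup>. \<omega> e)) B"
    proof (subst emeasure_distr[OF m2 B], rule arg_cong[where f = "emeasure \<mu>"])
      have "(\<lambda>e\<in>[V]\<^bsup>2\<^esup>. \<omega> e) \<in> B \<longleftrightarrow> (\<forall>e\<in>J. \<omega> e \<in> A e)" if "\<omega> \<in> space \<mu>" for \<omega>
        using VS that by (intro B_iff) (auto simp: space_\<mu>)
      then show "E = (\<lambda>\<omega>. \<lambda>e\<in>[V]\<^bsup>2\<^esup>. \<omega> e) -` B \<inter> space \<mu>"
        by (auto simp: E_def)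
    qed
    finally show "emeasure (distr \<mu> (\<Pi>\<^sub>M e\<in>[V]\<^bsup>2\<^esup>. K) (\<lambda>\<omega>. \<lambda>e\<in>[V]\<^bsup>2\<^esup>. \<omega> (\<phi> ` e))) (prod_emb ([V]\<^bsup>2\<^esup>) (\<lambda>_. K) J (Pi\<^sub>E J A))
      = emeasure (distr \<mu> (\<Pi>\<^sub>M e\<in>[V]\<^bsup>2\<^esup>. K) (\<lambda>\<omega>. \<lambda>e\<in>[V]\<^bsup>2\<^esup>. \<omega> e)) (prod_emb ([V]\<^bsup>2\<^esup>) (\<lambda>_. K) J (Pi\<^sub>E J A))"
      unfolding B_def .
  qed (auto intro: D1.finite_measure_axioms)
qed

section \<open>Latent variables read off from a reserve of vertices\<close>

lemma absorbing_bijection_exists: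
  assumes "countable (C \<union> B)" "infinite C"
  obtains \<phi> where "bij_betw \<phi> C (C \<union> B)" "\<And>v. v \<notin> C \<Longrightarrow> \<phi> v = v"
proof -
  have "countable C" "infinite (C \<union> B)"
    using assms by (auto intro: countable_subset[of C "C \<union> B"])
  then have "bij_betw (from_nat_into (C \<union> B) \<circ> to_nat_on C) C (C \<union> B)"
    using assms by (intro bij_betw_trans[OF to_nat_on_infinite bij_betw_from_nat_into])
  then have "bij_betw (\<lambda>v. from_nat_into (C \<union> B) (to_nat_on C v)) C (C \<union> B)"
    by (simp add: comp_def)
  then have "bij_betw (\<lambda>v. if v \<in> C then from_nat_into (C \<union> B) (to_nat_on C v) else v) C (C \<union> B)"
    by (subst bij_betw_cong[of _ _ "\<lambda>v. from_nat_into (C \<union> B) (to_nat_on C v)"]) auto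
  then show thesis by (rule that) simp
qed

text \<open>
  The reserve is \<open>N1 \<union> N2\<close>. The pairs \<open>(c0, d0)\<close> and \<open>(c1, d1)\<close> are codes and decoders that compress
  a coloured graph on the reserve, respectively a family of colours indexed by \<open>N1\<close>, into one real
  number.
\<close>

locale graph_with_reserve =
  fixes S :: "'s set" and K :: "'k measure" and \<mu> :: "('s set \<Rightarrow> 'k) measure"
    and N1 N2 :: "'s set" and \<psi> :: "'s \<Rightarrow> 's"
    and c0 :: "('s set \<Rightarrow> 'k) \<Rightarrow> real" and d0 :: "real \<Rightarrow> 's set \<Rightarrow> 'k"
    and c1 :: "('s \<Rightarrow> 'k) \<Rightarrow> real" and d1 :: "real \<Rightarrow> 's \<Rightarrow> 'k"
  assumes S: "countable S" "infinite S"
    and K: "cantor_retract K"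
    and exchangeable: "exchangeable_random_coloured_graph S K \<mu>"
    and N1: "infinite N1" "N1 \<subseteq> S" and N2: "infinite N2" "N2 \<subseteq> S" "N1 \<inter> N2 = {}"
    and \<psi>: "inj_on \<psi> S" "\<psi> ` S \<subseteq> S - (N1 \<union> N2)"
    and c0: "c0 \<in> borel_measurable (\<Pi>\<^sub>M e\<in>[N1 \<union> N2]\<^bsup>2\<^esup>. K)"
    and d0: "d0 \<in> borel \<rightarrow>\<^sub>M (\<Pi>\<^sub>M e\<in>[N1 \<union> N2]\<^bsup>2\<^esup>. K)"
    and d0_c0: "\<And>x. x \<in> space (\<Pi>\<^sub>M e\<in>[N1 \<union> N2]\<^bsup>2\<^esup>. K) \<Longrightarrow> d0 (c0 x) = x"
    and c1: "c1 \<in> borel_measurable (\<Pi>\<^sub>M n\<in>N1. K)"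
    and d1: "d1 \<in> borel \<rightarrow>\<^sub>M (\<Pi>\<^sub>M n\<in>N1. K)"
    and d1_c1: "\<And>x. x \<in> space (\<Pi>\<^sub>M n\<in>N1. K) \<Longrightarrow> d1 (c1 x) = x"
begin

text \<open>
  The point \<open>z\<^sub>\<emptyset>\<close> of the recipe: everything that happens inside the reserve.
\<close>

definition z0 :: "('s set \<Rightarrow> 'k) \<Rightarrow> real" where
  "z0 \<omega> = c0 (\<lambda>e\<in>[N1 \<union> N2]\<^bsup>2\<^esup>. \<omega> e)"

text \<open>
  The point \<open>z\<^sub>s\<close> of the recipe. Only the colours towards \<open>N1\<close> are recorded: in this way \<open>N2\<close> can be
  moved without changing \<open>z\<^sub>s\<close>, which \<open>vertex_independence\<close> depends on.
\<close>

definition z1 :: "'s \<Rightarrow> ('s set \<Rightarrow> 'k) \<Rightarrow> real" where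
  "z1 s \<omega> = c1 (\<lambda>n\<in>N1. \<omega> {\<psi> s, n})"

definition relabel :: "('s \<Rightarrow> 's) \<Rightarrow> ('s set \<Rightarrow> 'k) \<Rightarrow> 's set \<Rightarrow> 'k" where
  "relabel \<phi> \<omega> = (\<lambda>e. \<omega> (\<phi> ` e))"

lemma prob_\<mu>: "prob_space \<mu>"
  using exchangeable by (simp add: exchangeable_random_coloured_graph_def)

lemma sets_\<mu>: "sets \<mu> = sets (\<Pi>\<^sub>M e\<in>[S]\<^bsup>2\<^esup>. K)"
  using exchangeable by (simp add: exchangeable_random_coloured_graph_def coloured_graphs_def)

lemma space_\<mu>: "space \<mu> = ([S]\<^bsup>2\<^esup> \<rightarrow>\<^sub>E space K)"
  using sets_eq_imp_space_eq[OF sets_\<mu>] by (simp add: space_PiM)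

lemma coord: "e \<in> [S]\<^bsup>2\<^esup> \<Longrightarrow> (\<lambda>\<omega>. \<omega> e) \<in> \<mu> \<rightarrow>\<^sub>M K"
  using measurable_component_singleton[of e "[S]\<^bsup>2\<^esup>" "\<lambda>_. K"] by (simp cong: measurable_cong_sets add: sets_\<mu>)

lemma \<psi>_in: "s \<in> S \<Longrightarrow> \<psi> s \<in> S" and \<psi>_notin: "s \<in> S \<Longrightarrow> \<psi> s \<notin> N1" "s \<in> S \<Longrightarrow> \<psi> s \<notin> N2"
  using \<psi>(2) by auto

lemma \<psi>_eq_iff: "s \<in> S \<Longrightarrow> t \<in> S \<Longrightarrow> \<psi> s = \<psi> t \<longleftrightarrow> s = t"
  using \<psi>(1) by (auto dest: inj_onD)

lemma N_subset: "N1 \<union> N2 \<subseteq> S"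
  using N1 N2 by auto

lemma z0_cong: "(\<And>e. e \<in> [N1 \<union> N2]\<^bsup>2\<^esup> \<Longrightarrow> \<omega> e = \<eta> e) \<Longrightarrow> z0 \<omega> = z0 \<eta>"
  unfolding z0_def by (intro arg_cong[where f = c0] restrict_ext)

lemma z1_cong: "(\<And>n. n \<in> N1 \<Longrightarrow> \<omega> {\<psi> s, n} = \<eta> {\<psi> t, n}) \<Longrightarrow> z1 s \<omega> = z1 t \<eta>"
  unfolding z1_def by (intro arg_cong[where f = c1] restrict_ext)

lemma measurable_z0:
  assumes "\<And>e. e \<in> [N1 \<union> N2]\<^bsup>2\<^esup> \<Longrightarrow> (\<lambda>q. f q e) \<in> Q \<rightarrow>\<^sub>M K"
  shows "(\<lambda>q. z0 (f q)) \<in> borel_measurable Q"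
  unfolding z0_def by (intro measurable_compose[OF _ c0] measurable_restrict assms)

lemma measurable_z1:
  assumes "\<And>n. n \<in> N1 \<Longrightarrow> (\<lambda>q. f q {\<psi> s, n}) \<in> Q \<rightarrow>\<^sub>M K"
  shows "(\<lambda>q. z1 s (f q)) \<in> borel_measurable Q"
  unfolding z1_def by (intro measurable_compose[OF _ c1] measurable_restrict assms)

lemma measurable_z0_relabel:
  assumes "inj_on \<phi> (N1 \<union> N2)" "\<phi> ` (N1 \<union> N2) \<subseteq> S"
  shows "(\<lambda>\<omega>. z0 (relabel \<phi> \<omega>)) \<in> borel_measurable \<mu>"
  unfolding relabel_def by (intro measurable_z0 coord image_in_nsets[OF _ assms])

lemma measurable_z1_relabel:
  assumes "inj_on \<phi> (insert (\<psi> s) N1)" "\<phi> ` insert (\<psi> s) N1 \<subseteq> S" "s \<in> S"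
  shows "(\<lambda>\<omega>. z1 s (relabel \<phi> \<omega>)) \<in> borel_measurable \<mu>"
  unfolding relabel_def
  by (intro measurable_z1 coord image_in_nsets[OF _ assms(1,2)])
    (use \<psi>_notin(1)[OF assms(3)] in \<open>auto simp: doubleton_in_nsets\<close>)

lemma measurable_z0_\<mu> [measurable]: "z0 \<in> borel_measurable \<mu>"
  using measurable_z0_relabel[of "\<lambda>v. v"] N_subset by (simp add: relabel_def)

lemma measurable_z1_\<mu> [measurable]: "s \<in> S \<Longrightarrow> z1 s \<in> borel_measurable \<mu>"
  using measurable_z1_relabel[of "\<lambda>v. v" s] N1 \<psi>_in by (simp add: relabel_def)

text \<open>
  A map that absorbs further vertices into the reserve and fixes the rest cannot be injective on the
  whole of \<open>S\<close>. Only its values on \<open>V\<close> may therefore matter, which is why \<open>T\<close> has to be local.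
\<close>

lemma distr_local_relabel:
  assumes V: "V \<subseteq> S" "inj_on \<phi> V" "\<phi> ` V \<subseteq> S"
    and T: "T \<in> (\<Pi>\<^sub>M e\<in>[V]\<^bsup>2\<^esup>. K) \<rightarrow>\<^sub>M L" and local: "\<And>\<omega>. T (\<lambda>e\<in>[V]\<^bsup>2\<^esup>. \<omega> e) = T \<omega>"
  shows "distr \<mu> L (\<lambda>\<omega>. T (relabel \<phi> \<omega>)) = distr \<mu> L T"
proof -
  let ?P = "\<Pi>\<^sub>M e\<in>[V]\<^bsup>2\<^esup>. K"
  have m: "(\<lambda>\<omega>. \<lambda>e\<in>[V]\<^bsup>2\<^esup>. relabel \<phi> \<omega> e) \<in> \<mu> \<rightarrow>\<^sub>M ?P" if "inj_on \<phi> V" "\<phi> ` V \<subseteq> S" for \<phi>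
    unfolding relabel_def by (intro measurable_restrict coord image_in_nsets[OF _ that])
  have id: "(\<lambda>\<omega>. \<lambda>e\<in>[V]\<^bsup>2\<^esup>. \<omega> e) \<in> \<mu> \<rightarrow>\<^sub>M ?P"
    using m[of "\<lambda>v. v"] V(1) by (simp add: relabel_def)
  have "distr (distr \<mu> ?P (\<lambda>\<omega>. \<lambda>e\<in>[V]\<^bsup>2\<^esup>. relabel \<phi> \<omega> e)) L T = distr (distr \<mu> ?P (\<lambda>\<omega>. \<lambda>e\<in>[V]\<^bsup>2\<^esup>. \<omega> e)) L T"
    using distr_relabel[OF exchangeable V] by (simp add: relabel_def)
  then show ?thesis
    unfolding distr_distr[OF T m[OF V(2,3)]] distr_distr[OF T id] by (simp only: comp_def local)
qed

lemma z0_relabel_fixed: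
  assumes "\<And>v. v \<in> N1 \<union> N2 \<Longrightarrow> \<phi> v = v"
  shows "z0 (relabel \<phi> \<omega>) = z0 \<omega>"
proof (rule z0_cong)
  fix e assume "e \<in> [N1 \<union> N2]\<^bsup>2\<^esup>"
  then obtain a b where "e = {a, b}" "a \<in> N1 \<union> N2" "b \<in> N1 \<union> N2" by (rule nsets_2E)
  then have "\<phi> ` e = e" using assms by simp
  then show "relabel \<phi> \<omega> e = \<omega> e" by (simp add: relabel_def)
qed

lemma z1_relabel_fixed:
  assumes "\<And>v. v \<in> N1 \<Longrightarrow> \<phi> v = v" "\<phi> (\<psi> s) = \<psi> t"
  shows "z1 s (relabel \<phi> \<omega>) = z1 t \<omega>"
  by (rule z1_cong) (simp add: relabel_def assms)

text \<open>
  After relabelling, \<open>z\<^sub>\<emptyset>\<close> records the colours inside the image of the reserve, and the decoder gives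
  them back.
\<close>

lemma determined_by_z0_relabel:
  assumes \<phi>: "inj_on \<phi> (N1 \<union> N2)" "\<phi> ` (N1 \<union> N2) \<subseteq> S" and e: "e \<in> [\<phi> ` (N1 \<union> N2)]\<^bsup>2\<^esup>"
  shows "factors_through \<mu> borel (\<lambda>\<omega>. z0 (relabel \<phi> \<omega>)) K (\<lambda>\<omega>. \<omega> e)"
proof -
  from e obtain a b where ab: "e = {\<phi> a, \<phi> b}" "\<phi> a \<noteq> \<phi> b" "a \<in> N1 \<union> N2" "b \<in> N1 \<union> N2"
    by (auto elim!: nsets_2E)
  then have e': "{a, b} \<in> [N1 \<union> N2]\<^bsup>2\<^esup>" by (auto simp: doubleton_in_nsets)
  show ?thesis
    unfolding factors_through_def
  proof (intro bexI ballI)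
    fix \<omega> assume "\<omega> \<in> space \<mu>"
    then have "(\<lambda>e\<in>[N1 \<union> N2]\<^bsup>2\<^esup>. relabel \<phi> \<omega> e) \<in> space (\<Pi>\<^sub>M e\<in>[N1 \<union> N2]\<^bsup>2\<^esup>. K)"
      using image_in_nsets[OF _ \<phi>] by (auto simp: space_PiM space_\<mu> relabel_def)
    then show "\<omega> e = d0 (z0 (relabel \<phi> \<omega>)) {a, b}"
      using e' by (simp add: z0_def d0_c0 relabel_def ab(1))
  next
    show "(\<lambda>x. d0 x {a, b}) \<in> borel \<rightarrow>\<^sub>M K"
      by (rule measurable_compose[OF d0 measurable_component_singleton[OF e']])
  qed
qed

lemma determined_by_z1_relabel:
  assumes \<phi>: "inj_on \<phi> (insert (\<psi> s) N1)" "\<phi> ` insert (\<psi> s) N1 \<subseteq> S" "s \<in> S" and m: "m \<in> \<phi> ` N1"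
  shows "factors_through \<mu> borel (\<lambda>\<omega>. z1 s (relabel \<phi> \<omega>)) K (\<lambda>\<omega>. \<omega> {\<phi> (\<psi> s), m})"
proof -
  from m obtain n where n: "m = \<phi> n" "n \<in> N1" by blast
  show ?thesis
    unfolding factors_through_def
  proof (intro bexI ballI)
    fix \<omega> assume "\<omega> \<in> space \<mu>"
    moreover have "\<phi> ` {\<psi> s, n} \<in> [S]\<^bsup>2\<^esup>" if "n \<in> N1" for n
      using that \<psi>_notin(1)[OF \<phi>(3)]
      by (intro image_in_nsets[OF _ \<phi>(1,2)]) (auto simp: doubleton_in_nsets)
    ultimately have "(\<lambda>n\<in>N1. relabel \<phi> \<omega> {\<psi> s, n}) \<in> space (\<Pi>\<^sub>M n\<in>N1. K)"
      unfolding relabel_def space_PiM space_\<mu> by (intro restrict_PiE_iff[THEN iffD2] ballI) (rule PiE_mem)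
    then show "\<omega> {\<phi> (\<psi> s), m} = d1 (z1 s (relabel \<phi> \<omega>)) n"
      using n by (simp add: z1_def d1_c1 relabel_def)
  next
    show "(\<lambda>x. d1 x n) \<in> borel \<rightarrow>\<^sub>M K"
      by (rule measurable_compose[OF d1 measurable_component_singleton[OF n(2)]])
  qed
qed

lemma z0_factors:
  assumes "\<And>e. e \<in> [N1 \<union> N2]\<^bsup>2\<^esup> \<Longrightarrow> factors_through \<mu> Q Y K (\<lambda>\<omega>. \<omega> e)"
  shows "factors_through \<mu> Q Y borel z0"
  using factors_through_compose[OF factors_through_PiM[of "[N1 \<union> N2]\<^bsup>2\<^esup>" \<mu> Q Y "\<lambda>_. K" "\<lambda>\<omega>. \<omega>", OF assms] c0]
  by (simp add: z0_def[abs_def])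

lemma z1_factors:
  assumes "\<And>n. n \<in> N1 \<Longrightarrow> factors_through \<mu> Q Y K (\<lambda>\<omega>. \<omega> {\<psi> s, n})"
  shows "factors_through \<mu> Q Y borel (z1 s)"
  using factors_through_compose[OF factors_through_PiM[of N1 \<mu> Q Y "\<lambda>_. K" "\<lambda>\<omega> n. \<omega> {\<psi> s, n}", OF assms] c1]
  by (simp add: z1_def[abs_def])

lemma nsets_2_mono: "e \<in> [U]\<^bsup>2\<^esup> \<Longrightarrow> U \<subseteq> V \<Longrightarrow> e \<in> [V]\<^bsup>2\<^esup>"
  by (auto simp: nsets_def)

lemma z0_restrict:
  assumes "N1 \<union> N2 \<subseteq> V"
  shows "z0 (\<lambda>e\<in>[V]\<^bsup>2\<^esup>. \<omega> e) = z0 \<omega>"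
  using nsets_2_mono[OF _ assms] by (intro z0_cong) simp

lemma z1_restrict:
  assumes "N1 \<subseteq> V" "\<psi> s \<in> V" "s \<in> S"
  shows "z1 s (\<lambda>e\<in>[V]\<^bsup>2\<^esup>. \<omega> e) = z1 s \<omega>"
  using assms \<psi>_notin(1)[OF assms(3)] by (intro z1_cong) (auto simp: doubleton_in_nsets)

lemma measurable_z0_PiM:
  assumes "N1 \<union> N2 \<subseteq> V"
  shows "z0 \<in> borel_measurable (\<Pi>\<^sub>M e\<in>[V]\<^bsup>2\<^esup>. K)"
  by (intro measurable_z0 measurable_component_singleton nsets_2_mono[OF _ assms])

lemma measurable_z1_PiM:
  assumes "N1 \<subseteq> V" "\<psi> s \<in> V" "s \<in> S"
  shows "z1 s \<in> borel_measurable (\<Pi>\<^sub>M e\<in>[V]\<^bsup>2\<^esup>. K)"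
  using assms \<psi>_notin(1)[OF assms(3)]
  by (intro measurable_z1 measurable_component_singleton) (auto simp: doubleton_in_nsets)

text \<open>
  One kernel serves all vertices, because moving \<open>\<psi> s\<close> to \<open>\<psi> t\<close> and fixing the reserve preserves the
  joint law.
\<close>

lemma vertex_kernel_exists:
  obtains \<kappa> where "\<And>s. s \<in> S \<Longrightarrow> cond_law \<mu> borel z0 borel (z1 s) \<kappa>"
proof -
  obtain s where s: "s \<in> S" using S(2) by fastforce
  obtain \<kappa> where \<kappa>: "cond_law \<mu> borel z0 borel (z1 s) \<kappa>"
    using cond_law_exists[OF prob_\<mu> measurable_z0_\<mu> measurable_z1_\<mu>[OF s]]
      standard_borel_imp_cantor_retract[OF standard_borel_real] by auto
  show thesis
  proof (rule that)
    fix t assume t: "t \<in> S"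
    define \<phi> where "\<phi> v = (if v = \<psi> s then \<psi> t else v)" for v
    define V where "V = insert (\<psi> s) (N1 \<union> N2)"
    have V: "V \<subseteq> S" "inj_on \<phi> V" "\<phi> ` V \<subseteq> S"
      using N_subset \<psi>_in[OF s] \<psi>_in[OF t] \<psi>_notin[OF s] \<psi>_notin[OF t]
      by (auto simp: V_def \<phi>_def inj_on_def)
    have fixed: "\<phi> v = v" if "v \<in> N1 \<union> N2" for v
      using that \<psi>_notin[OF s] by (auto simp: \<phi>_def)
    have sub: "N1 \<union> N2 \<subseteq> V" "N1 \<subseteq> V" "\<psi> s \<in> V" by (auto simp: V_def)
    have "distr \<mu> (borel \<Otimes>\<^sub>M borel) (\<lambda>\<omega>. (z0 (relabel \<phi> \<omega>), z1 s (relabel \<phi> \<omega>)))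
        = distr \<mu> (borel \<Otimes>\<^sub>M borel) (\<lambda>\<omega>. (z0 \<omega>, z1 s \<omega>))"
      by (rule distr_local_relabel[OF V, of "\<lambda>\<omega>. (z0 \<omega>, z1 s \<omega>)"])
        (intro measurable_Pair measurable_z0_PiM measurable_z1_PiM sub s,
          simp only: z0_restrict[OF sub(1)] z1_restrict[OF sub(2,3) s])
    moreover have "z0 (relabel \<phi> \<omega>) = z0 \<omega>" "z1 s (relabel \<phi> \<omega>) = z1 t \<omega>" for \<omega>
      using fixed by (auto intro!: z0_relabel_fixed z1_relabel_fixed simp: \<phi>_def[of "\<psi> s"])
    ultimately have "distr \<mu> (borel \<Otimes>\<^sub>M borel) (\<lambda>\<omega>. (z0 \<omega>, z1 t \<omega>)) = distr \<mu> (borel \<Otimes>\<^sub>M borel) (\<lambda>\<omega>. (z0 \<omega>, z1 s \<omega>))"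
      by simp
    then show "cond_law \<mu> borel z0 borel (z1 t) \<kappa>"
      using t by (intro cond_law_transfer[OF \<kappa>]) auto
  qed
qed

text \<open>
  As for vertices, one kernel serves all edges. Applied to the exchange of the two endpoints of one
  edge, the equality of laws is also the hypothesis of \<open>symmetric_cond_law_exists\<close>.
\<close>

lemma edge_kernel_exists:
  obtains \<kappa> where "\<And>s t. s \<in> S \<Longrightarrow> t \<in> S \<Longrightarrow> s \<noteq> t \<Longrightarrow>
      cond_law \<mu> (borel \<Otimes>\<^sub>M borel \<Otimes>\<^sub>M borel) (\<lambda>\<omega>. (z0 \<omega>, z1 s \<omega>, z1 t \<omega>)) K (\<lambda>\<omega>. \<omega> {\<psi> s, \<psi> t}) \<kappa>"
    and "\<And>z a b. \<kappa> (z, a, b) = \<kappa> (z, b, a)"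
proof -
  obtain s where s: "s \<in> S" using S(2) by fastforce
  have "S - {s} \<noteq> {}" using S(2) by (metis finite.emptyI infinite_remove)
  then obtain t where t: "t \<in> S" "s \<noteq> t" by blast
  let ?L = "(borel \<Otimes>\<^sub>M borel \<Otimes>\<^sub>M borel) \<Otimes>\<^sub>M K"
  have same_law: "distr \<mu> ?L (\<lambda>\<omega>. ((z0 \<omega>, z1 s' \<omega>, z1 t' \<omega>), \<omega> {\<psi> s', \<psi> t'}))
      = distr \<mu> ?L (\<lambda>\<omega>. ((z0 \<omega>, z1 s \<omega>, z1 t \<omega>), \<omega> {\<psi> s, \<psi> t}))"
    if s': "s' \<in> S" and t': "t' \<in> S" "s' \<noteq> t'" for s' t'
  proof -
    define \<phi> where "\<phi> v = (if v = \<psi> s then \<psi> s' else if v = \<psi> t then \<psi> t' else v)" for v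
    define V where "V = {\<psi> s, \<psi> t} \<union> (N1 \<union> N2)"
    have ne: "\<psi> s \<noteq> \<psi> t" "\<psi> s' \<noteq> \<psi> t'"
      using s t s' t' by (simp_all add: \<psi>_eq_iff)
    have V: "V \<subseteq> S" "inj_on \<phi> V" "\<phi> ` V \<subseteq> S"
      using N_subset \<psi>_in[OF s] \<psi>_in[OF s'] \<psi>_in[OF t(1)] \<psi>_in[OF t'(1)]
        \<psi>_notin[OF s] \<psi>_notin[OF s'] \<psi>_notin[OF t(1)] \<psi>_notin[OF t'(1)] ne
      by (auto simp: V_def \<phi>_def inj_on_def)
    have fixed: "\<phi> v = v" if "v \<in> N1 \<union> N2" for v
      using that \<psi>_notin[OF s] \<psi>_notin[OF t(1)] by (auto simp: \<phi>_def)
    have sub: "N1 \<union> N2 \<subseteq> V" "N1 \<subseteq> V" "\<psi> s \<in> V" "\<psi> t \<in> V" by (auto simp: V_def)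
    have st: "{\<psi> s, \<psi> t} \<in> [V]\<^bsup>2\<^esup>" using ne by (simp add: doubleton_in_nsets V_def)
    have "distr \<mu> ?L (\<lambda>\<omega>. ((z0 (relabel \<phi> \<omega>), z1 s (relabel \<phi> \<omega>), z1 t (relabel \<phi> \<omega>)), relabel \<phi> \<omega> {\<psi> s, \<psi> t}))
        = distr \<mu> ?L (\<lambda>\<omega>. ((z0 \<omega>, z1 s \<omega>, z1 t \<omega>), \<omega> {\<psi> s, \<psi> t}))"
      by (rule distr_local_relabel[OF V, of "\<lambda>\<omega>. ((z0 \<omega>, z1 s \<omega>, z1 t \<omega>), \<omega> {\<psi> s, \<psi> t})"])
        (intro measurable_Pair measurable_z0_PiM measurable_z1_PiM measurable_component_singleton sub s t(1) st,
          simp only: z0_restrict[OF sub(1)] z1_restrict[OF sub(2,3) s] z1_restrict[OF sub(2,4) t(1)] restrict_apply' st)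
    moreover have "z0 (relabel \<phi> \<omega>) = z0 \<omega>" "z1 s (relabel \<phi> \<omega>) = z1 s' \<omega>" "z1 t (relabel \<phi> \<omega>) = z1 t' \<omega>" for \<omega>
      using fixed ne by (auto intro!: z0_relabel_fixed z1_relabel_fixed simp: \<phi>_def[of "\<psi> s"] \<phi>_def[of "\<psi> t"])
    moreover have "relabel \<phi> \<omega> {\<psi> s, \<psi> t} = \<omega> {\<psi> s', \<psi> t'}" for \<omega>
      using ne by (auto simp: relabel_def \<phi>_def insert_commute intro!: arg_cong[where f = \<omega>])
    ultimately show ?thesis by simp
  qed
  have edge: "(\<lambda>\<omega>. \<omega> {\<psi> s', \<psi> t'}) \<in> \<mu> \<rightarrow>\<^sub>M K" if "s' \<in> S" "t' \<in> S" "s' \<noteq> t'" for s' t'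
    using that \<psi>_in by (intro coord) (simp add: doubleton_in_nsets \<psi>_eq_iff)
  have "distr \<mu> ?L (\<lambda>\<omega>. ((z0 \<omega>, z1 t \<omega>, z1 s \<omega>), \<omega> {\<psi> s, \<psi> t}))
      = distr \<mu> ?L (\<lambda>\<omega>. ((z0 \<omega>, z1 s \<omega>, z1 t \<omega>), \<omega> {\<psi> s, \<psi> t}))"
    using same_law[OF t(1) s] t(2) by (simp add: insert_commute)
  then obtain \<kappa> where
    \<kappa>: "cond_law \<mu> (borel \<Otimes>\<^sub>M borel \<Otimes>\<^sub>M borel) (\<lambda>\<omega>. (z0 \<omega>, z1 s \<omega>, z1 t \<omega>)) K (\<lambda>\<omega>. \<omega> {\<psi> s, \<psi> t}) \<kappa>"
    and sym: "\<And>z a b. \<kappa> (z, a, b) = \<kappa> (z, b, a)"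
    by (rule symmetric_cond_law_exists[OF prob_\<mu> K measurable_z0_\<mu> measurable_z1_\<mu>[OF s]
      measurable_z1_\<mu>[OF t(1)] edge[OF s t]]) blast
  show thesis
  proof (rule that)
    show "\<kappa> (z, a, b) = \<kappa> (z, b, a)" for z a b by (rule sym)
    fix s' t' assume *: "s' \<in> S" "t' \<in> S" "s' \<noteq> t'"
    have "(\<lambda>\<omega>. (z0 \<omega>, z1 s' \<omega>, z1 t' \<omega>)) \<in> \<mu> \<rightarrow>\<^sub>M borel \<Otimes>\<^sub>M borel \<Otimes>\<^sub>M borel"
      using * by measurable
    then show "cond_law \<mu> (borel \<Otimes>\<^sub>M borel \<Otimes>\<^sub>M borel) (\<lambda>\<omega>. (z0 \<omega>, z1 s' \<omega>, z1 t' \<omega>)) K (\<lambda>\<omega>. \<omega> {\<psi> s', \<psi> t'}) \<kappa>"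
      by (rule cond_law_transfer[OF \<kappa> _ edge[OF *] same_law[OF *]])
  qed
qed

text \<open>
  The relabelling fixes \<open>N1\<close> and \<open>\<psi> s\<close>, hence \<open>z\<^sub>s\<close>, and sends \<open>N2\<close> onto \<open>N2\<close> together with all the
  other vertices \<open>\<psi> r\<close>. The relabelled \<open>z\<^sub>\<emptyset>\<close> then determines \<open>z\<^sub>\<emptyset>\<close> and all the other \<open>z\<^sub>r\<close>.
\<close>

lemma vertex_independence:
  assumes \<kappa>: "cond_law \<mu> borel z0 borel (z1 s) \<kappa>" and s: "s \<in> S"
    and w: "w \<in> borel_measurable (borel \<Otimes>\<^sub>M (\<Pi>\<^sub>M r\<in>S - {s}. borel))" and B: "B \<in> sets borel"
  shows "(\<integral>\<^sup>+\<omega>. w (z0 \<omega>, \<lambda>r\<in>S - {s}. z1 r \<omega>) * indicator B (z1 s \<omega>) \<partial>\<mu>)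
    = (\<integral>\<^sup>+\<omega>. w (z0 \<omega>, \<lambda>r\<in>S - {s}. z1 r \<omega>) * emeasure (\<kappa> (z0 \<omega>)) B \<partial>\<mu>)"
proof -
  define P where "P = \<psi> ` (S - {s})"
  have P_disj: "P \<subseteq> S - (N1 \<union> N2)"
    unfolding P_def by (rule subset_trans[OF image_mono \<psi>(2)]) simp
  have P: "P \<subseteq> S" "P \<inter> (N1 \<union> N2) = {}" "\<psi> s \<notin> P"
    using P_disj inj_on_image_mem_iff[OF \<psi>(1) s, of "S - {s}"] by (auto simp: P_def[symmetric])
  have "countable (N2 \<union> P)"
    using P(1) N2(2) S(1) by (meson Un_least countable_subset)
  then obtain \<phi> where \<phi>: "bij_betw \<phi> N2 (N2 \<union> P)" "\<And>v. v \<notin> N2 \<Longrightarrow> \<phi> v = v"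
    by (rule absorbing_bijection_exists[OF _ N2(1)]) blast
  have \<phi>_N1: "\<phi> v = v" if "v \<in> N1" for v using that N2(3) by (intro \<phi>(2)) auto
  have \<phi>_s: "\<phi> (\<psi> s) = \<psi> s" by (rule \<phi>(2)) (rule \<psi>_notin(2)[OF s])
  define V where "V = insert (\<psi> s) (N1 \<union> N2)"
  have img: "\<phi> ` (N1 \<union> N2) = N1 \<union> N2 \<union> P"
    using \<phi>(1) \<phi>_N1 by (auto simp: bij_betw_def image_Un)
  have "bij_betw \<phi> (insert (\<psi> s) N1) (insert (\<psi> s) N1)"
    using \<phi>_N1 \<phi>_s by (subst bij_betw_cong[of _ _ id]) auto
  then have "bij_betw \<phi> (insert (\<psi> s) N1 \<union> N2) (insert (\<psi> s) N1 \<union> (N2 \<union> P))"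
    by (rule bij_betw_combine[OF _ \<phi>(1)]) (use P N2(3) \<psi>_notin[OF s] in auto)
  then have V: "V \<subseteq> S" "inj_on \<phi> V" "\<phi> ` V \<subseteq> S"
    using N_subset P(1) \<psi>_in[OF s] by (auto simp: V_def bij_betw_def)
  have inj_N: "inj_on \<phi> (N1 \<union> N2)" "\<phi> ` (N1 \<union> N2) \<subseteq> S"
    using V(2,3) by (auto simp: V_def intro: inj_on_subset)
  have sub: "N1 \<union> N2 \<subseteq> V" "N1 \<subseteq> V" "\<psi> s \<in> V" by (auto simp: V_def)
  have z1_fix: "z1 s (relabel \<phi> \<omega>) = z1 s \<omega>" for \<omega>
    by (rule z1_relabel_fixed[OF \<phi>_N1 \<phi>_s])
  have law: "distr \<mu> (borel \<Otimes>\<^sub>M borel) (\<lambda>\<omega>. (z0 (relabel \<phi> \<omega>), z1 s \<omega>)) = distr \<mu> (borel \<Otimes>\<^sub>M borel) (\<lambda>\<omega>. (z0 \<omega>, z1 s \<omega>))"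
  proof -
    have "distr \<mu> (borel \<Otimes>\<^sub>M borel) (\<lambda>\<omega>. (z0 (relabel \<phi> \<omega>), z1 s (relabel \<phi> \<omega>)))
        = distr \<mu> (borel \<Otimes>\<^sub>M borel) (\<lambda>\<omega>. (z0 \<omega>, z1 s \<omega>))"
      by (rule distr_local_relabel[OF V, of "\<lambda>\<omega>. (z0 \<omega>, z1 s \<omega>)"])
        (intro measurable_Pair measurable_z0_PiM measurable_z1_PiM sub s,
          simp only: z0_restrict[OF sub(1)] z1_restrict[OF sub(2,3) s])
    then show ?thesis by (simp add: z1_fix)
  qed
  have det: "factors_through \<mu> borel (\<lambda>\<omega>. z0 (relabel \<phi> \<omega>)) K (\<lambda>\<omega>. \<omega> e)" if "e \<in> [N1 \<union> N2 \<union> P]\<^bsup>2\<^esup>" for e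
    using that by (intro determined_by_z0_relabel[OF inj_N]) (simp add: img)
  have det_z0: "factors_through \<mu> borel (\<lambda>\<omega>. z0 (relabel \<phi> \<omega>)) borel z0"
    by (intro z0_factors det) (auto simp: nsets_def)
  have det_z1: "factors_through \<mu> borel (\<lambda>\<omega>. z0 (relabel \<phi> \<omega>)) borel (z1 r)" if "r \<in> S - {s}" for r
    using that \<psi>_notin[of r] by (intro z1_factors det) (auto simp: doubleton_in_nsets P_def)
  have "factors_through \<mu> borel (\<lambda>\<omega>. z0 (relabel \<phi> \<omega>)) (borel \<Otimes>\<^sub>M (\<Pi>\<^sub>M r\<in>S - {s}. borel))
      (\<lambda>\<omega>. (z0 \<omega>, \<lambda>r\<in>S - {s}. z1 r \<omega>))"
    by (rule factors_through_Pair[OF det_z0 factors_through_PiM[of "S - {s}" \<mu> borel _ "\<lambda>_. borel" "\<lambda>\<omega> r. z1 r \<omega>"]])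
      (rule det_z1)
  from cond_law_of_larger_conditioning[OF prob_\<mu> \<kappa> measurable_z0_relabel[OF inj_N] law det_z0 this w B]
  show ?thesis .
qed

text \<open>
  The relabelling fixes \<open>\<psi> s\<close>, \<open>\<psi> t\<close> and \<open>N2\<close>, and sends \<open>N1\<close> onto \<open>N1\<close> together with all the other
  vertices \<open>\<psi> r\<close>. The relabelled \<open>z\<^sub>\<emptyset>\<close> then records the graph on the reserve and these \<open>\<psi> r\<close>, and the
  relabelled \<open>z\<^sub>s\<close> and \<open>z\<^sub>t\<close> record the colours of the edges that join \<open>\<psi> s\<close> and \<open>\<psi> t\<close> to \<open>N1\<close> and
  to these \<open>\<psi> r\<close>. What remains undetermined on \<open>\<psi> ` S\<close> is precisely the colour of \<open>{\<psi> s, \<psi> t}\<close>.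
\<close>

lemma edge_independence:
  assumes \<kappa>: "cond_law \<mu> (borel \<Otimes>\<^sub>M borel \<Otimes>\<^sub>M borel) (\<lambda>\<omega>. (z0 \<omega>, z1 s \<omega>, z1 t \<omega>)) K (\<lambda>\<omega>. \<omega> {\<psi> s, \<psi> t}) \<kappa>"
    and s: "s \<in> S" and t: "t \<in> S" and st: "s \<noteq> t"
    and w: "w \<in> borel_measurable ((borel \<Otimes>\<^sub>M (\<Pi>\<^sub>M r\<in>S. borel)) \<Otimes>\<^sub>M (\<Pi>\<^sub>M e\<in>[S]\<^bsup>2\<^esup> - {{s, t}}. K))" and A: "A \<in> sets K"
  shows "(\<integral>\<^sup>+\<omega>. w ((z0 \<omega>, \<lambda>r\<in>S. z1 r \<omega>), \<lambda>e\<in>[S]\<^bsup>2\<^esup> - {{s, t}}. \<omega> (\<psi> ` e)) * indicator A (\<omega> {\<psi> s, \<psi> t}) \<partial>\<mu>)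
    = (\<integral>\<^sup>+\<omega>. w ((z0 \<omega>, \<lambda>r\<in>S. z1 r \<omega>), \<lambda>e\<in>[S]\<^bsup>2\<^esup> - {{s, t}}. \<omega> (\<psi> ` e))
        * emeasure (\<kappa> (z0 \<omega>, z1 s \<omega>, z1 t \<omega>)) A \<partial>\<mu>)"
proof -
  define P where "P = \<psi> ` (S - {s, t})"
  have P_disj: "P \<subseteq> S - (N1 \<union> N2)"
    unfolding P_def by (rule subset_trans[OF image_mono \<psi>(2)]) simp
  have P: "P \<subseteq> S" "P \<inter> (N1 \<union> N2) = {}" "\<psi> s \<notin> P" "\<psi> t \<notin> P"
    using P_disj inj_on_image_mem_iff[OF \<psi>(1) s, of "S - {s, t}"]
      inj_on_image_mem_iff[OF \<psi>(1) t, of "S - {s, t}"] by (auto simp: P_def[symmetric])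
  have ne: "\<psi> s \<noteq> \<psi> t" using s t st by (simp add: \<psi>_eq_iff)
  have "countable (N1 \<union> P)"
    using P(1) N1(2) S(1) by (meson Un_least countable_subset)
  then obtain \<phi> where \<phi>: "bij_betw \<phi> N1 (N1 \<union> P)" "\<And>v. v \<notin> N1 \<Longrightarrow> \<phi> v = v"
    by (rule absorbing_bijection_exists[OF _ N1(1)]) blast
  have \<phi>_N2: "\<phi> v = v" if "v \<in> N2" for v using that N2(3) by (intro \<phi>(2)) auto
  have \<phi>_s: "\<phi> (\<psi> s) = \<psi> s" and \<phi>_t: "\<phi> (\<psi> t) = \<psi> t"
    using \<psi>_notin(1)[OF s] \<psi>_notin(1)[OF t] by (simp_all add: \<phi>(2))
  define V where "V = {\<psi> s, \<psi> t} \<union> (N1 \<union> N2)"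
  have img1: "\<phi> ` N1 = N1 \<union> P" using \<phi>(1) by (auto simp: bij_betw_def)
  have img: "\<phi> ` (N1 \<union> N2) = N1 \<union> N2 \<union> P"
    using img1 \<phi>_N2 by (auto simp: image_Un)
  have "bij_betw \<phi> ({\<psi> s, \<psi> t} \<union> N2) ({\<psi> s, \<psi> t} \<union> N2)"
    using \<phi>_N2 \<phi>_s \<phi>_t by (subst bij_betw_cong[of _ _ id]) auto
  then have "bij_betw \<phi> (({\<psi> s, \<psi> t} \<union> N2) \<union> N1) (({\<psi> s, \<psi> t} \<union> N2) \<union> (N1 \<union> P))"
    by (rule bij_betw_combine[OF _ \<phi>(1)]) (use P N2(3) \<psi>_notin[OF s] \<psi>_notin[OF t] in auto)
  then have V: "V \<subseteq> S" "inj_on \<phi> V" "\<phi> ` V \<subseteq> S"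
    using N_subset P(1) \<psi>_in[OF s] \<psi>_in[OF t] by (auto simp: V_def bij_betw_def Un_ac)
  have into: "inj_on \<phi> U" "\<phi> ` U \<subseteq> S" if "U \<subseteq> V" for U
    using V(2,3) that by (blast intro: inj_on_subset)+
  have inj_N: "inj_on \<phi> (N1 \<union> N2)" "\<phi> ` (N1 \<union> N2) \<subseteq> S"
    and inj_s: "inj_on \<phi> (insert (\<psi> s) N1)" "\<phi> ` insert (\<psi> s) N1 \<subseteq> S"
    and inj_t: "inj_on \<phi> (insert (\<psi> t) N1)" "\<phi> ` insert (\<psi> t) N1 \<subseteq> S"
    by (intro into; auto simp: V_def)+
  have sub: "N1 \<union> N2 \<subseteq> V" "N1 \<subseteq> V" "\<psi> s \<in> V" "\<psi> t \<in> V" by (auto simp: V_def)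
  have st_V: "{\<psi> s, \<psi> t} \<in> [V]\<^bsup>2\<^esup>" using ne by (simp add: doubleton_in_nsets V_def)
  let ?N = "borel \<Otimes>\<^sub>M borel \<Otimes>\<^sub>M borel :: (real \<times> real \<times> real) measure"
  define Y where "Y \<omega> = (z0 (relabel \<phi> \<omega>), z1 s (relabel \<phi> \<omega>), z1 t (relabel \<phi> \<omega>))" for \<omega>
  have Y[measurable]: "Y \<in> \<mu> \<rightarrow>\<^sub>M ?N"
    unfolding Y_def[abs_def]
    by (intro measurable_Pair measurable_z0_relabel[OF inj_N] measurable_z1_relabel[OF inj_s s] measurable_z1_relabel[OF inj_t t])
  have law: "distr \<mu> (?N \<Otimes>\<^sub>M K) (\<lambda>\<omega>. (Y \<omega>, \<omega> {\<psi> s, \<psi> t}))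
      = distr \<mu> (?N \<Otimes>\<^sub>M K) (\<lambda>\<omega>. ((z0 \<omega>, z1 s \<omega>, z1 t \<omega>), \<omega> {\<psi> s, \<psi> t}))"
  proof -
    have "distr \<mu> (?N \<Otimes>\<^sub>M K) (\<lambda>\<omega>. ((z0 (relabel \<phi> \<omega>), z1 s (relabel \<phi> \<omega>), z1 t (relabel \<phi> \<omega>)), relabel \<phi> \<omega> {\<psi> s, \<psi> t}))
        = distr \<mu> (?N \<Otimes>\<^sub>M K) (\<lambda>\<omega>. ((z0 \<omega>, z1 s \<omega>, z1 t \<omega>), \<omega> {\<psi> s, \<psi> t}))"
      by (rule distr_local_relabel[OF V, of "\<lambda>\<omega>. ((z0 \<omega>, z1 s \<omega>, z1 t \<omega>), \<omega> {\<psi> s, \<psi> t})"])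
        (intro measurable_Pair measurable_z0_PiM measurable_z1_PiM measurable_component_singleton sub s t st_V,
          simp only: z0_restrict[OF sub(1)] z1_restrict[OF sub(2,3) s] z1_restrict[OF sub(2,4) t] restrict_apply' st_V)
    moreover have "relabel \<phi> \<omega> {\<psi> s, \<psi> t} = \<omega> {\<psi> s, \<psi> t}" for \<omega>
      by (simp add: relabel_def \<phi>_s \<phi>_t)
    ultimately show ?thesis by (simp add: Y_def)
  qed
  have Y_z0: "factors_through \<mu> ?N Y borel (\<lambda>\<omega>. z0 (relabel \<phi> \<omega>))"
    and Y_z1s: "factors_through \<mu> ?N Y borel (\<lambda>\<omega>. z1 s (relabel \<phi> \<omega>))"
    and Y_z1t: "factors_through \<mu> ?N Y borel (\<lambda>\<omega>. z1 t (relabel \<phi> \<omega>))"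
    using factors_through_self[of fst ?N borel \<mu> Y] factors_through_self[of "\<lambda>y. fst (snd y)" ?N borel \<mu> Y]
      factors_through_self[of "\<lambda>y. snd (snd y)" ?N borel \<mu> Y] by (simp_all add: Y_def)
  have det: "factors_through \<mu> ?N Y K (\<lambda>\<omega>. \<omega> e)" if "e \<in> [N1 \<union> N2 \<union> P]\<^bsup>2\<^esup>" for e
    using that by (intro factors_through_trans[OF Y_z0 determined_by_z0_relabel[OF inj_N]]) (simp add: img)
  have det_s: "factors_through \<mu> ?N Y K (\<lambda>\<omega>. \<omega> {\<psi> s, m})" if "m \<in> N1 \<union> P" for m
    using factors_through_trans[OF Y_z1s determined_by_z1_relabel[OF inj_s s, of m]] that by (simp add: img1 \<phi>_s)
  have det_t: "factors_through \<mu> ?N Y K (\<lambda>\<omega>. \<omega> {\<psi> t, m})" if "m \<in> N1 \<union> P" for m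
    using factors_through_trans[OF Y_z1t determined_by_z1_relabel[OF inj_t t, of m]] that by (simp add: img1 \<phi>_t)
  have det_z0: "factors_through \<mu> ?N Y borel z0"
    by (intro z0_factors det) (auto simp: nsets_def)
  have det_z1: "factors_through \<mu> ?N Y borel (z1 r)" if r: "r \<in> S" for r
  proof (rule z1_factors)
    fix n assume n: "n \<in> N1"
    consider "r = s" | "r = t" | "\<psi> r \<in> P" using r by (auto simp: P_def)
    then show "factors_through \<mu> ?N Y K (\<lambda>\<omega>. \<omega> {\<psi> r, n})"
    proof cases
      case 3
      then show ?thesis using n \<psi>_notin[OF r] by (intro det) (auto simp: doubleton_in_nsets)
    qed (use n det_s det_t in auto)
  qed
  have det_edge: "factors_through \<mu> ?N Y K (\<lambda>\<omega>. \<omega> (\<psi> ` e))" if e: "e \<in> [S]\<^bsup>2\<^esup> - {{s, t}}" for e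
  proof -
    from e have "e \<in> [S]\<^bsup>2\<^esup>" by simp
    then obtain a b where ab: "e = {a, b}" "a \<noteq> b" "a \<in> S" "b \<in> S" by (rule nsets_2E)
    have P_iff: "\<psi> r \<in> P" if "r \<in> S" "r \<noteq> s" "r \<noteq> t" for r using that by (auto simp: P_def)
    have psi_e: "\<psi> ` e = {\<psi> a, \<psi> b}" "\<psi> ` e = {\<psi> b, \<psi> a}" using ab by auto
    consider "a = s" "\<psi> b \<in> P" | "a = t" "\<psi> b \<in> P" | "b = s" "\<psi> a \<in> P" | "b = t" "\<psi> a \<in> P" | "\<psi> a \<in> P" "\<psi> b \<in> P"
      using ab e P_iff by blast
    then show ?thesis
    proof cases
      case 1 then show ?thesis unfolding psi_e(1) using det_s by simp
    next
      case 2 then show ?thesis unfolding psi_e(1) using det_t by simp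
    next
      case 3 then show ?thesis unfolding psi_e(2) using det_s by simp
    next
      case 4 then show ?thesis unfolding psi_e(2) using det_t by simp
    next
      case 5
      then show ?thesis unfolding psi_e(1) using ab by (intro det) (auto simp: doubleton_in_nsets \<psi>_eq_iff)
    qed
  qed
  have own: "factors_through \<mu> ?N Y ?N (\<lambda>\<omega>. (z0 \<omega>, z1 s \<omega>, z1 t \<omega>))"
    by (rule factors_through_Pair[OF det_z0 factors_through_Pair[OF det_z1[OF s] det_z1[OF t]]])
  have "factors_through \<mu> ?N Y ((borel \<Otimes>\<^sub>M (\<Pi>\<^sub>M r\<in>S. borel)) \<Otimes>\<^sub>M (\<Pi>\<^sub>M e\<in>[S]\<^bsup>2\<^esup> - {{s, t}}. K))
      (\<lambda>\<omega>. ((z0 \<omega>, \<lambda>r\<in>S. z1 r \<omega>), \<lambda>e\<in>[S]\<^bsup>2\<^esup> - {{s, t}}. \<omega> (\<psi> ` e)))"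
    by (rule factors_through_Pair[OF factors_through_Pair[OF det_z0
          factors_through_PiM[of S \<mu> ?N Y "\<lambda>_. borel" "\<lambda>\<omega> r. z1 r \<omega>", OF det_z1]]
        factors_through_PiM[of "[S]\<^bsup>2\<^esup> - {{s, t}}" \<mu> ?N Y "\<lambda>_. K" "\<lambda>\<omega> e. \<omega> (\<psi> ` e)", OF det_edge]])
  from cond_law_of_larger_conditioning[OF prob_\<mu> \<kappa> Y law own this w A]
  show ?thesis .
qed

section \<open>The recipe yields the given law\<close>

text \<open>
  The indicators are replaced by conditional probabilities one at a time. The weight \<open>w\<close> is arbitrary
  so that the induction can store in it the factors that have already been replaced.
\<close>

lemma nn_integral_vertex_indicators:
  fixes w :: "real \<Rightarrow> ennreal"
  assumes \<kappa>: "\<And>s. s \<in> S \<Longrightarrow> cond_law \<mu> borel z0 borel (z1 s) \<kappa>"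
    and J: "finite J" "J \<subseteq> S" and B: "\<And>s. s \<in> J \<Longrightarrow> B s \<in> sets borel"
    and w: "w \<in> borel_measurable borel"
  shows "(\<integral>\<^sup>+\<omega>. w (z0 \<omega>) * (\<Prod>s\<in>J. indicator (B s) (z1 s \<omega>)) \<partial>\<mu>)
    = (\<integral>\<^sup>+\<omega>. w (z0 \<omega>) * (\<Prod>s\<in>J. emeasure (\<kappa> (z0 \<omega>)) (B s)) \<partial>\<mu>)"
  using J B w
proof (induction J arbitrary: w rule: finite_induct)
  case (insert s J)
  have s: "s \<in> S" and J: "J \<subseteq> S - {s}" using insert.hyps insert.prems by auto
  note [measurable] = insert.prems(3)
  have B[measurable]: "r \<in> J \<Longrightarrow> B r \<in> sets borel" "B s \<in> sets borel" for r using insert.prems(2) by auto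
  have [measurable]: "(\<lambda>z. emeasure (\<kappa> z) (B s)) \<in> borel_measurable borel"
    using cond_lawD(3)[OF \<kappa>[OF s]] B(2) by (auto simp: prob_kernel_iff)
  define w' where "w' q = w (fst q) * (\<Prod>r\<in>J. indicator (B r) (snd q r))" for q :: "real \<times> ('s \<Rightarrow> real)"
  have w': "w' \<in> borel_measurable (borel \<Otimes>\<^sub>M (\<Pi>\<^sub>M r\<in>S - {s}. borel))"
  proof -
    have "(\<lambda>q. indicator (B r) (snd q r) :: ennreal) \<in> borel_measurable (borel \<Otimes>\<^sub>M (\<Pi>\<^sub>M r\<in>S - {s}. borel))"
      if r: "r \<in> J" for r
    proof -
      have "(\<lambda>q. snd q r) \<in> borel \<Otimes>\<^sub>M (\<Pi>\<^sub>M r\<in>S - {s}. borel) \<rightarrow>\<^sub>M borel"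
        using r J by (intro measurable_compose[OF measurable_snd measurable_component_singleton]) auto
      then show ?thesis using B(1)[OF r] by measurable
    qed
    then show ?thesis unfolding w'_def[abs_def] by measurable
  qed
  have w'_eq: "w' (z0 \<omega>, \<lambda>r\<in>S - {s}. z1 r \<omega>) = w (z0 \<omega>) * (\<Prod>r\<in>J. indicator (B r) (z1 r \<omega>))" for \<omega>
    using J unfolding w'_def by (auto intro!: arg_cong2[where f = "(*)"] prod.cong)
  have "(\<integral>\<^sup>+\<omega>. w (z0 \<omega>) * (\<Prod>r\<in>insert s J. indicator (B r) (z1 r \<omega>)) \<partial>\<mu>)
      = (\<integral>\<^sup>+\<omega>. w' (z0 \<omega>, \<lambda>r\<in>S - {s}. z1 r \<omega>) * indicator (B s) (z1 s \<omega>) \<partial>\<mu>)"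
    unfolding w'_eq using insert.hyps by (simp add: mult_ac)
  also have "\<dots> = (\<integral>\<^sup>+\<omega>. w' (z0 \<omega>, \<lambda>r\<in>S - {s}. z1 r \<omega>) * emeasure (\<kappa> (z0 \<omega>)) (B s) \<partial>\<mu>)"
    by (rule vertex_independence[OF \<kappa>[OF s] s w' B(2)])
  also have "\<dots> = (\<integral>\<^sup>+\<omega>. (w (z0 \<omega>) * emeasure (\<kappa> (z0 \<omega>)) (B s)) * (\<Prod>r\<in>J. indicator (B r) (z1 r \<omega>)) \<partial>\<mu>)"
    unfolding w'_eq by (simp add: mult_ac)
  also have "\<dots> = (\<integral>\<^sup>+\<omega>. (w (z0 \<omega>) * emeasure (\<kappa> (z0 \<omega>)) (B s)) * (\<Prod>r\<in>J. emeasure (\<kappa> (z0 \<omega>)) (B r)) \<partial>\<mu>)"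
    using J by (intro insert.IH[of "\<lambda>z. w z * emeasure (\<kappa> z) (B s)"]) (auto simp: B)
  also have "\<dots> = (\<integral>\<^sup>+\<omega>. w (z0 \<omega>) * (\<Prod>r\<in>insert s J. emeasure (\<kappa> (z0 \<omega>)) (B r)) \<partial>\<mu>)"
    using insert.hyps by (simp add: mult_ac)
  finally show ?case .
qed simp

lemma vertices_cond_law:
  assumes \<kappa>: "\<And>s. s \<in> S \<Longrightarrow> cond_law \<mu> borel z0 borel (z1 s) \<kappa>"
  shows "cond_law \<mu> borel z0 (\<Pi>\<^sub>M s\<in>S. borel) (\<lambda>\<omega>. \<lambda>s\<in>S. z1 s \<omega>) (\<lambda>z. \<Pi>\<^sub>M s\<in>S. \<kappa> z)"
proof -
  interpret prob_space \<mu> by (rule prob_\<mu>)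
  let ?Z = "\<lambda>\<omega>. \<lambda>s\<in>S. z1 s \<omega>"
  let ?P = "\<Pi>\<^sub>M s\<in>S. (borel :: real measure)"
  obtain s0 where "s0 \<in> S" using S(2) by fastforce
  then have ker: "prob_kernel borel borel \<kappa>" using cond_lawD(3)[OF \<kappa>] by blast
  have kerS: "prob_kernel borel ?P (\<lambda>z. \<Pi>\<^sub>M s\<in>S. \<kappa> z)"
    by (rule prob_kernel_PiM[OF ker])
  have \<kappa>_z: "prob_space (\<kappa> z)" "sets (\<kappa> z) = sets borel" for z
    using ker by (auto simp: prob_kernel_iff)
  have Z[measurable]: "?Z \<in> \<mu> \<rightarrow>\<^sub>M ?P" by (rule measurable_restrict) simp
  show ?thesis
  proof (rule cond_lawI_sets[OF measurable_z0_\<mu> Z kerS])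
    fix A C assume A: "A \<in> sets ?P" and C[measurable]: "C \<in> sets (borel :: real measure)"
    let ?\<alpha> = "distr (density \<mu> (\<lambda>\<omega>. indicator C (z0 \<omega>))) ?P ?Z"
    let ?\<nu> = "density (distr \<mu> borel z0) (indicator C)"
    have sp: "space ?\<nu> \<noteq> {}" by simp
    have kerS': "(\<lambda>z. \<Pi>\<^sub>M s\<in>S. \<kappa> z) \<in> ?\<nu> \<rightarrow>\<^sub>M subprob_algebra ?P"
      using measurable_prob_algebraD[OF kerS] by simp
    have em: "emeasure ?\<alpha> D = (\<integral>\<^sup>+\<omega>. indicator C (z0 \<omega>) * indicator D (?Z \<omega>) \<partial>\<mu>)" if "D \<in> sets ?P" for D
      using that by (intro emeasure_distr_density) auto
    have em': "emeasure (?\<nu> \<bind> (\<lambda>z. \<Pi>\<^sub>M s\<in>S. \<kappa> z)) D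
        = (\<integral>\<^sup>+\<omega>. indicator C (z0 \<omega>) * emeasure (\<Pi>\<^sub>M s\<in>S. \<kappa> (z0 \<omega>)) D \<partial>\<mu>)" if D: "D \<in> sets ?P" for D
    proof -
      have [measurable]: "(\<lambda>z. emeasure (\<Pi>\<^sub>M s\<in>S. \<kappa> z) D) \<in> borel_measurable borel"
        using kerS D by (auto simp: prob_kernel_iff)
      show ?thesis
        by (simp add: emeasure_bind[OF sp kerS' D] nn_integral_density nn_integral_distr)
    qed
    have "?\<alpha> = ?\<nu> \<bind> (\<lambda>z. \<Pi>\<^sub>M s\<in>S. \<kappa> z)"
    proof (rule measure_eqI_PiM_infinite)
      show "sets ?\<alpha> = sets ?P" by simp
      show "sets (?\<nu> \<bind> (\<lambda>z. \<Pi>\<^sub>M s\<in>S. \<kappa> z)) = sets ?P"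
        by (rule sets_bind[OF sets_kernel[OF kerS'] sp])
      show "finite_measure ?\<alpha>"
      proof (rule finite_measureI)
        have "emeasure ?\<alpha> (space ?P) \<le> (\<integral>\<^sup>+\<omega>. 1 \<partial>\<mu>)"
          by (subst em[OF sets.top]) (rule nn_integral_mono, simp split: split_indicator)
        then show "emeasure ?\<alpha> (space ?\<alpha>) \<noteq> \<infinity>"
          using emeasure_space_1 by (auto simp: top_unique)
      qed
      fix B J assume J: "finite J" "J \<subseteq> S" and B: "\<And>i. i \<in> J \<Longrightarrow> B i \<in> sets (borel :: real measure)"
      define D where "D = prod_emb S (\<lambda>_. borel :: real measure) J (Pi\<^sub>E J B)"
      have D: "D \<in> sets ?P" unfolding D_def using J B by (intro sets_PiM_I) auto
      have "indicator D (?Z \<omega>) = (\<Prod>s\<in>J. indicator (B s) (z1 s \<omega>) :: ennreal)" for \<omega>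
      proof -
        have "?Z \<omega> \<in> D \<longleftrightarrow> (\<forall>s\<in>J. z1 s \<omega> \<in> B s)"
          using J(2) by (auto simp: D_def prod_emb_def PiE_iff)
        then show ?thesis using J(1) by (auto simp: indicator_def prod_zero_iff)
      qed
      then have "emeasure ?\<alpha> D = (\<integral>\<^sup>+\<omega>. indicator C (z0 \<omega>) * (\<Prod>s\<in>J. indicator (B s) (z1 s \<omega>)) \<partial>\<mu>)"
        using em[OF D] by simp
      also have "\<dots> = (\<integral>\<^sup>+\<omega>. indicator C (z0 \<omega>) * (\<Prod>s\<in>J. emeasure (\<kappa> (z0 \<omega>)) (B s)) \<partial>\<mu>)"
        by (rule nn_integral_vertex_indicators[OF \<kappa> J B]) simp_all
      also have "\<dots> = (\<integral>\<^sup>+\<omega>. indicator C (z0 \<omega>) * emeasure (\<Pi>\<^sub>M s\<in>S. \<kappa> (z0 \<omega>)) D \<partial>\<mu>)"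
      proof -
        have "emeasure (\<Pi>\<^sub>M s\<in>S. \<kappa> z) D = (\<Prod>s\<in>J. emeasure (\<kappa> z) (B s))" for z
        proof -
          have "D = prod_emb S (\<lambda>_. \<kappa> z) J (Pi\<^sub>E J B)"
            by (simp add: D_def prod_emb_def sets_eq_imp_space_eq[OF \<kappa>_z(2)])
          then show ?thesis
            using emeasure_PiM_emb[of S "\<lambda>_. \<kappa> z" J B] \<kappa>_z J B by simp
        qed
        then show ?thesis by simp
      qed
      also have "\<dots> = emeasure (?\<nu> \<bind> (\<lambda>z. \<Pi>\<^sub>M s\<in>S. \<kappa> z)) D" by (rule em'[OF D, symmetric])
      finally show "emeasure ?\<alpha> (prod_emb S (\<lambda>_. borel) J (Pi\<^sub>E J B))
          = emeasure (?\<nu> \<bind> (\<lambda>z. \<Pi>\<^sub>M s\<in>S. \<kappa> z)) (prod_emb S (\<lambda>_. borel) J (Pi\<^sub>E J B))"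
        unfolding D_def .
    qed
    then have "(\<integral>\<^sup>+\<omega>. indicator C (z0 \<omega>) * indicator A (?Z \<omega>) \<partial>\<mu>)
        = (\<integral>\<^sup>+\<omega>. indicator C (z0 \<omega>) * emeasure (\<Pi>\<^sub>M s\<in>S. \<kappa> (z0 \<omega>)) A \<partial>\<mu>)"
      using em[OF A] em'[OF A] by simp
    then show "emeasure \<mu> {\<omega> \<in> space \<mu>. z0 \<omega> \<in> C \<and> ?Z \<omega> \<in> A}
        = (\<integral>\<^sup>+\<omega>. indicator C (z0 \<omega>) * emeasure (\<Pi>\<^sub>M s\<in>S. \<kappa> (z0 \<omega>)) A \<partial>\<mu>)"
      by (subst emeasure_conj_eq_nn_integral[OF measurable_z0_\<mu> Z C A]) (simp add: mult.commute)
  qed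
qed

lemma edge_law_doubleton:
  assumes "\<And>z a b. P (z, a, b) = P (z, b, a)" and "s \<noteq> t"
  shows "edge_law P z v {s, t} = P (z, v s, v t)"
  unfolding edge_law_def using assms by (intro the_equality) (auto simp: doubleton_eq_iff)

text \<open>
  The same scheme as in \<open>nn_integral_vertex_indicators\<close>: while one edge is treated, the remaining
  indicators are a function of the other colours.
\<close>

lemma nn_integral_edge_indicators:
  fixes w :: "real \<times> ('s \<Rightarrow> real) \<Rightarrow> ennreal"
  assumes \<kappa>: "\<And>s t. s \<in> S \<Longrightarrow> t \<in> S \<Longrightarrow> s \<noteq> t \<Longrightarrow>
      cond_law \<mu> (borel \<Otimes>\<^sub>M borel \<Otimes>\<^sub>M borel) (\<lambda>\<omega>. (z0 \<omega>, z1 s \<omega>, z1 t \<omega>)) K (\<lambda>\<omega>. \<omega> {\<psi> s, \<psi> t}) \<kappa>"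
    and sym: "\<And>z a b. \<kappa> (z, a, b) = \<kappa> (z, b, a)"
    and J: "finite J" "J \<subseteq> [S]\<^bsup>2\<^esup>" and A: "\<And>e. e \<in> J \<Longrightarrow> A e \<in> sets K"
    and w: "w \<in> borel_measurable (borel \<Otimes>\<^sub>M (\<Pi>\<^sub>M s\<in>S. borel))"
  shows "(\<integral>\<^sup>+\<omega>. w (z0 \<omega>, \<lambda>s\<in>S. z1 s \<omega>) * (\<Prod>e\<in>J. indicator (A e) (\<omega> (\<psi> ` e))) \<partial>\<mu>)
    = (\<integral>\<^sup>+\<omega>. w (z0 \<omega>, \<lambda>s\<in>S. z1 s \<omega>) * (\<Prod>e\<in>J. emeasure (edge_law \<kappa> (z0 \<omega>) (\<lambda>s\<in>S. z1 s \<omega>) e) (A e)) \<partial>\<mu>)"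
  using J A w
proof (induction J arbitrary: w rule: finite_induct)
  case (insert e J)
  let ?R = "borel \<Otimes>\<^sub>M (\<Pi>\<^sub>M s\<in>S. borel) :: (real \<times> ('s \<Rightarrow> real)) measure"
  from insert.prems(1) have "e \<in> [S]\<^bsup>2\<^esup>" by simp
  then obtain s t where st: "e = {s, t}" "s \<noteq> t" "s \<in> S" "t \<in> S" by (rule nsets_2E)
  have J: "J \<subseteq> [S]\<^bsup>2\<^esup> - {{s, t}}" using insert.hyps insert.prems st by auto
  note [measurable] = insert.prems(3)
  have A: "d \<in> J \<Longrightarrow> A d \<in> sets K" "A e \<in> sets K" for d using insert.prems(2) by auto
  define g where "g q = emeasure (edge_law \<kappa> (fst q) (snd q) e) (A e)" for q
  have g_eq: "g q = emeasure (\<kappa> (fst q, snd q s, snd q t)) (A e)" for q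
    unfolding g_def st(1) by (simp add: edge_law_doubleton[where P = \<kappa>, OF sym st(2)])
  have [measurable]: "g \<in> borel_measurable ?R"
  proof -
    have "(\<lambda>q. (fst q, snd q s, snd q t)) \<in> ?R \<rightarrow>\<^sub>M borel \<Otimes>\<^sub>M borel \<Otimes>\<^sub>M borel"
      using st by measurable
    moreover have "(\<lambda>q. emeasure (\<kappa> q) (A e)) \<in> borel_measurable (borel \<Otimes>\<^sub>M borel \<Otimes>\<^sub>M borel)"
      using cond_lawD(3)[OF \<kappa>[OF st(3,4,2)]] A(2) by (auto simp: prob_kernel_iff)
    ultimately show ?thesis
      unfolding g_eq[abs_def] by (rule measurable_compose)
  qed
  define w' where "w' q = w (fst q) * (\<Prod>d\<in>J. indicator (A d) (snd q d))" for q :: "_ \<times> ('s set \<Rightarrow> 'k)"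
  have w': "w' \<in> borel_measurable (?R \<Otimes>\<^sub>M (\<Pi>\<^sub>M d\<in>[S]\<^bsup>2\<^esup> - {{s, t}}. K))"
  proof -
    have "(\<lambda>q. indicator (A d) (snd q d) :: ennreal) \<in> borel_measurable (?R \<Otimes>\<^sub>M (\<Pi>\<^sub>M d\<in>[S]\<^bsup>2\<^esup> - {{s, t}}. K))"
      if d: "d \<in> J" for d
    proof -
      have "(\<lambda>q. snd q d) \<in> ?R \<Otimes>\<^sub>M (\<Pi>\<^sub>M d\<in>[S]\<^bsup>2\<^esup> - {{s, t}}. K) \<rightarrow>\<^sub>M K"
        using d J by (intro measurable_compose[OF measurable_snd measurable_component_singleton]) auto
      then show ?thesis using A(1)[OF d] by measurable
    qed
    then show ?thesis unfolding w'_def[abs_def] by measurable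
  qed
  let ?\<zeta> = "\<lambda>\<omega>. (z0 \<omega>, \<lambda>s\<in>S. z1 s \<omega>)"
  have w'_eq: "w' (?\<zeta> \<omega>, \<lambda>d\<in>[S]\<^bsup>2\<^esup> - {{s, t}}. \<omega> (\<psi> ` d)) = w (?\<zeta> \<omega>) * (\<Prod>d\<in>J. indicator (A d) (\<omega> (\<psi> ` d)))" for \<omega>
    using J unfolding w'_def by (auto intro!: arg_cong2[where f = "(*)"] prod.cong)
  have "(\<integral>\<^sup>+\<omega>. w (?\<zeta> \<omega>) * (\<Prod>d\<in>insert e J. indicator (A d) (\<omega> (\<psi> ` d))) \<partial>\<mu>)
      = (\<integral>\<^sup>+\<omega>. w' (?\<zeta> \<omega>, \<lambda>d\<in>[S]\<^bsup>2\<^esup> - {{s, t}}. \<omega> (\<psi> ` d)) * indicator (A e) (\<omega> {\<psi> s, \<psi> t}) \<partial>\<mu>)"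
    unfolding w'_eq using insert.hyps st(1) by (simp add: mult_ac)
  also have "\<dots> = (\<integral>\<^sup>+\<omega>. w' (?\<zeta> \<omega>, \<lambda>d\<in>[S]\<^bsup>2\<^esup> - {{s, t}}. \<omega> (\<psi> ` d)) * emeasure (\<kappa> (z0 \<omega>, z1 s \<omega>, z1 t \<omega>)) (A e) \<partial>\<mu>)"
    by (rule edge_independence[OF \<kappa>[OF st(3,4,2)] st(3,4,2) w' A(2)])
  also have "\<dots> = (\<integral>\<^sup>+\<omega>. (w (?\<zeta> \<omega>) * g (?\<zeta> \<omega>)) * (\<Prod>d\<in>J. indicator (A d) (\<omega> (\<psi> ` d))) \<partial>\<mu>)"
    unfolding w'_eq g_eq using st(3,4) by (simp add: mult_ac)
  also have "\<dots> = (\<integral>\<^sup>+\<omega>. (w (?\<zeta> \<omega>) * g (?\<zeta> \<omega>)) * (\<Prod>d\<in>J. emeasure (edge_law \<kappa> (z0 \<omega>) (\<lambda>s\<in>S. z1 s \<omega>) d) (A d)) \<partial>\<mu>)"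
    using J by (intro insert.IH[of "\<lambda>q. w q * g q"]) (auto simp: A)
  also have "\<dots> = (\<integral>\<^sup>+\<omega>. w (?\<zeta> \<omega>) * (\<Prod>d\<in>insert e J. emeasure (edge_law \<kappa> (z0 \<omega>) (\<lambda>s\<in>S. z1 s \<omega>) d) (A d)) \<partial>\<mu>)"
    using insert.hyps by (simp add: g_def mult_ac)
  finally show ?case .
qed simp

text \<open>
  On a cylinder set, first \<open>\<mu>\<close> is carried to \<open>\<psi> ` S\<close>, then the colours are integrated out given the
  latent variables, and then the vertex variables given \<open>z\<^sub>\<emptyset>\<close>. The result is the iterated integral that
  defines the recipe.
\<close>

lemma recipe_yields_\<mu>:
  assumes I: "ingredients borel (distr \<mu> borel z0) borel P1 K P2"
    and P1: "\<And>s. s \<in> S \<Longrightarrow> cond_law \<mu> borel z0 borel (z1 s) P1"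
    and P2: "\<And>s t. s \<in> S \<Longrightarrow> t \<in> S \<Longrightarrow> s \<noteq> t \<Longrightarrow>
      cond_law \<mu> (borel \<Otimes>\<^sub>M borel \<Otimes>\<^sub>M borel) (\<lambda>\<omega>. (z0 \<omega>, z1 s \<omega>, z1 t \<omega>)) K (\<lambda>\<omega>. \<omega> {\<psi> s, \<psi> t}) P2"
    and sym: "\<And>z a b. P2 (z, a, b) = P2 (z, b, a)"
  shows "recipe_law S (distr \<mu> borel z0) P1 P2 = \<mu>"
proof -
  interpret prob_space \<mu> by (rule prob_\<mu>)
  interpret \<nu>: prob_space "distr \<mu> borel z0" by (rule prob_space_distr) simp
  let ?\<zeta> = "\<lambda>\<omega>. \<lambda>s\<in>S. z1 s \<omega>"
  let ?P = "\<Pi>\<^sub>M s\<in>S. (borel :: real measure)"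
  let ?G = "coloured_graphs S K"
  have ker1: "prob_kernel borel ?P (\<lambda>z. \<Pi>\<^sub>M s\<in>S. P1 z)"
    using I by (intro prob_kernel_PiM) (simp add: ingredients_def)
  have ker2: "prob_kernel (borel \<Otimes>\<^sub>M ?P) ?G (\<lambda>(z, v). \<Pi>\<^sub>M e\<in>[S]\<^bsup>2\<^esup>. edge_law P2 z v e)"
    using prob_kernel_PiM[OF prob_kernel_edge_law[OF I]] by (simp add: coloured_graphs_def case_prod_unfold)
  have ker12: "prob_kernel borel ?G (\<lambda>z. (\<Pi>\<^sub>M s\<in>S. P1 z) \<bind> (\<lambda>v. \<Pi>\<^sub>M e\<in>[S]\<^bsup>2\<^esup>. edge_law P2 z v e))"
    by (rule measurable_bind_prob_space2[OF ker1 ker2])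
  have P1_sets: "sets (\<Pi>\<^sub>M s\<in>S. P1 z) = sets ?P" for z
    using ker1 by (auto simp: prob_kernel_iff)
  have R: "recipe_law S (distr \<mu> borel z0) P1 P2 \<in> space (prob_algebra ?G)"
    by (rule recipe_law_in_prob_algebra[OF I])
  show ?thesis
  proof (rule measure_eqI_PiM_infinite[where I = "[S]\<^bsup>2\<^esup>" and M = "\<lambda>_. K", symmetric])
    show "sets \<mu> = sets (\<Pi>\<^sub>M e\<in>[S]\<^bsup>2\<^esup>. K)" by (rule sets_\<mu>)
    show "sets (recipe_law S (distr \<mu> borel z0) P1 P2) = sets (\<Pi>\<^sub>M e\<in>[S]\<^bsup>2\<^esup>. K)"
      using R by (simp add: space_prob_algebra coloured_graphs_def)
    show "finite_measure \<mu>" by (rule finite_measure_axioms)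
    fix A J assume J: "finite J" "J \<subseteq> [S]\<^bsup>2\<^esup>" and A: "\<And>e. e \<in> J \<Longrightarrow> A e \<in> sets K"
    define D where "D = prod_emb ([S]\<^bsup>2\<^esup>) (\<lambda>_. K) J (Pi\<^sub>E J A)"
    have D: "D \<in> sets ?G" unfolding D_def coloured_graphs_def using J A by (intro sets_PiM_I) auto
    have D\<mu>: "D \<in> sets \<mu>" using D by (simp add: sets_\<mu> coloured_graphs_def)
    define h where "h z v = (\<Prod>e\<in>J. emeasure (edge_law P2 z v e) (A e))" for z v
    have h_eq: "emeasure (\<Pi>\<^sub>M e\<in>[S]\<^bsup>2\<^esup>. edge_law P2 z v e) D = h z v" if v: "v \<in> space ?P" for z v
    proof -
      have zv: "(z, v) \<in> space (borel \<Otimes>\<^sub>M ?P)" using v by (simp add: space_pair_measure)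
      have Q: "prob_space (edge_law P2 z v e)" "sets (edge_law P2 z v e) = sets K" if "e \<in> [S]\<^bsup>2\<^esup>" for e
        using prob_kernel_edge_law[OF I that] zv by (auto simp: prob_kernel_iff)
      have "D = prod_emb ([S]\<^bsup>2\<^esup>) (edge_law P2 z v) J (Pi\<^sub>E J A)"
        using sets_eq_imp_space_eq[OF Q(2)] by (auto simp: D_def prod_emb_def PiE_iff)
      moreover have "A e \<in> sets (edge_law P2 z v e)" if "e \<in> J" for e
        using A Q(2) J(2) that by blast
      ultimately show ?thesis
        using emeasure_PiM_emb[of "[S]\<^bsup>2\<^esup>" "edge_law P2 z v" J A] Q(1) J by (simp add: h_def)
    qed
    have h_meas: "(\<lambda>(z, v). h z v) \<in> borel_measurable (borel \<Otimes>\<^sub>M ?P)"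
    proof -
      have "(\<lambda>(z, v). emeasure (\<Pi>\<^sub>M e\<in>[S]\<^bsup>2\<^esup>. edge_law P2 z v e) D) \<in> borel_measurable (borel \<Otimes>\<^sub>M ?P)"
        using ker2 D by (auto simp: prob_kernel_iff case_prod_unfold)
      also have "?this \<longleftrightarrow> ?thesis"
        by (intro measurable_cong) (auto simp: space_pair_measure h_eq)
      finally show ?thesis .
    qed
    have \<psi>_img: "\<psi> ` e \<in> [S]\<^bsup>2\<^esup>" if "e \<in> [S]\<^bsup>2\<^esup>" for e
      using that \<psi> by (intro image_in_nsets) auto
    have rel: "(\<lambda>\<omega>. \<lambda>e\<in>[S]\<^bsup>2\<^esup>. \<omega> (\<psi> ` e)) \<in> \<mu> \<rightarrow>\<^sub>M ?G" and id: "(\<lambda>\<omega>. \<lambda>e\<in>[S]\<^bsup>2\<^esup>. \<omega> e) \<in> \<mu> \<rightarrow>\<^sub>M ?G"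
      unfolding coloured_graphs_def by (intro measurable_restrict coord \<psi>_img; assumption)+
    have "distr \<mu> ?G (\<lambda>\<omega>. \<lambda>e\<in>[S]\<^bsup>2\<^esup>. \<omega> (\<psi> ` e)) = distr \<mu> ?G (\<lambda>\<omega>. \<lambda>e\<in>[S]\<^bsup>2\<^esup>. \<omega> e)"
      unfolding coloured_graphs_def using \<psi> by (intro distr_relabel[OF exchangeable]) auto
    then have same_integral: "(\<integral>\<^sup>+\<omega>. indicator D (\<lambda>e\<in>[S]\<^bsup>2\<^esup>. \<omega> e) \<partial>\<mu>) = (\<integral>\<^sup>+\<omega>. indicator D (\<lambda>e\<in>[S]\<^bsup>2\<^esup>. \<omega> (\<psi> ` e)) \<partial>\<mu>)"
      using D nn_integral_distr[OF rel, of "indicator D"] nn_integral_distr[OF id, of "indicator D"] by simp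
    have "emeasure \<mu> D = (\<integral>\<^sup>+\<omega>. indicator D (\<lambda>e\<in>[S]\<^bsup>2\<^esup>. \<omega> e) \<partial>\<mu>)"
    proof (subst nn_integral_indicator[OF D\<mu>, symmetric], rule nn_integral_cong)
      fix \<omega> assume "\<omega> \<in> space \<mu>"
      then have "(\<lambda>e\<in>[S]\<^bsup>2\<^esup>. \<omega> e) = \<omega>" by (auto simp: space_\<mu> PiE_def extensional_restrict)
      then show "indicator D \<omega> = (indicator D (\<lambda>e\<in>[S]\<^bsup>2\<^esup>. \<omega> e) :: ennreal)" by simp
    qed
    also note same_integral
    also have "(\<integral>\<^sup>+\<omega>. indicator D (\<lambda>e\<in>[S]\<^bsup>2\<^esup>. \<omega> (\<psi> ` e)) \<partial>\<mu>)
        = (\<integral>\<^sup>+\<omega>. 1 * (\<Prod>e\<in>J. indicator (A e) (\<omega> (\<psi> ` e))) \<partial>\<mu>)"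
    proof (rule nn_integral_cong)
      fix \<omega> assume "\<omega> \<in> space \<mu>"
      then have "(\<lambda>e\<in>[S]\<^bsup>2\<^esup>. \<omega> (\<psi> ` e)) \<in> D \<longleftrightarrow> (\<forall>e\<in>J. \<omega> (\<psi> ` e) \<in> A e)"
        using J(2) \<psi>_img by (auto simp: D_def prod_emb_def PiE_iff space_\<mu>)
      then show "indicator D (\<lambda>e\<in>[S]\<^bsup>2\<^esup>. \<omega> (\<psi> ` e)) = (1 * (\<Prod>e\<in>J. indicator (A e) (\<omega> (\<psi> ` e))) :: ennreal)"
        using J(1) by (auto simp: indicator_def)
    qed
    also have "\<dots> = (\<integral>\<^sup>+\<omega>. 1 * (\<Prod>e\<in>J. emeasure (edge_law P2 (z0 \<omega>) (?\<zeta> \<omega>) e) (A e)) \<partial>\<mu>)"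
      by (rule nn_integral_edge_indicators[OF P2 sym J A]) auto
    also have "\<dots> = (\<integral>\<^sup>+\<omega>. (\<lambda>(z, v). h z v) (z0 \<omega>, ?\<zeta> \<omega>) \<partial>\<mu>)" by (simp add: h_def)
    also have "\<dots> = (\<integral>\<^sup>+\<omega>. (\<integral>\<^sup>+v. h (z0 \<omega>) v \<partial>(\<Pi>\<^sub>M s\<in>S. P1 (z0 \<omega>))) \<partial>\<mu>)"
      using cond_law_nn_integral[OF prob_\<mu> vertices_cond_law[OF P1] h_meas] by simp
    also have "\<dots> = (\<integral>\<^sup>+\<omega>. emeasure ((\<Pi>\<^sub>M s\<in>S. P1 (z0 \<omega>)) \<bind> (\<lambda>v. \<Pi>\<^sub>M e\<in>[S]\<^bsup>2\<^esup>. edge_law P2 (z0 \<omega>) v e)) D \<partial>\<mu>)"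
    proof (rule nn_integral_cong)
      fix \<omega>
      have sp: "space (\<Pi>\<^sub>M s\<in>S. P1 (z0 \<omega>)) = space ?P" by (rule sets_eq_imp_space_eq[OF P1_sets])
      have "(\<lambda>v. \<Pi>\<^sub>M e\<in>[S]\<^bsup>2\<^esup>. edge_law P2 (z0 \<omega>) v e) \<in> ?P \<rightarrow>\<^sub>M prob_algebra ?G"
        using measurable_compose[OF measurable_Pair1' ker2] by simp
      then have "(\<lambda>v. \<Pi>\<^sub>M e\<in>[S]\<^bsup>2\<^esup>. edge_law P2 (z0 \<omega>) v e) \<in> (\<Pi>\<^sub>M s\<in>S. P1 (z0 \<omega>)) \<rightarrow>\<^sub>M subprob_algebra ?G"
        by (simp cong: measurable_cong_sets add: P1_sets measurable_prob_algebraD)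
      then have "emeasure ((\<Pi>\<^sub>M s\<in>S. P1 (z0 \<omega>)) \<bind> (\<lambda>v. \<Pi>\<^sub>M e\<in>[S]\<^bsup>2\<^esup>. edge_law P2 (z0 \<omega>) v e)) D
          = (\<integral>\<^sup>+v. emeasure (\<Pi>\<^sub>M e\<in>[S]\<^bsup>2\<^esup>. edge_law P2 (z0 \<omega>) v e) D \<partial>(\<Pi>\<^sub>M s\<in>S. P1 (z0 \<omega>)))"
        by (rule emeasure_bind[rotated, OF _ D]) (unfold sp, simp add: space_PiM PiE_eq_empty_iff)
      also have "\<dots> = (\<integral>\<^sup>+v. h (z0 \<omega>) v \<partial>(\<Pi>\<^sub>M s\<in>S. P1 (z0 \<omega>)))"
        by (intro nn_integral_cong) (simp add: sp h_eq)
      finally show "(\<integral>\<^sup>+v. h (z0 \<omega>) v \<partial>(\<Pi>\<^sub>M s\<in>S. P1 (z0 \<omega>)))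
          = emeasure ((\<Pi>\<^sub>M s\<in>S. P1 (z0 \<omega>)) \<bind> (\<lambda>v. \<Pi>\<^sub>M e\<in>[S]\<^bsup>2\<^esup>. edge_law P2 (z0 \<omega>) v e)) D" by simp
    qed
    also have "\<dots> = emeasure (recipe_law S (distr \<mu> borel z0) P1 P2) D"
      unfolding recipe_law_def
      using measurable_prob_algebraD[OF ker12] ker12 D
      by (subst emeasure_bind[OF \<nu>.not_empty _ D]) (auto simp: nn_integral_distr prob_kernel_iff)
    finally show "emeasure \<mu> (prod_emb ([S]\<^bsup>2\<^esup>) (\<lambda>_. K) J (Pi\<^sub>E J A))
        = emeasure (recipe_law S (distr \<mu> borel z0) P1 P2) (prod_emb ([S]\<^bsup>2\<^esup>) (\<lambda>_. K) J (Pi\<^sub>E J A))"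
      unfolding D_def .
  qed
qed

lemma ingredients_exist:
  assumes "standard_borel K"
  shows "\<exists>\<mu>\<^sub>0 P1 P2. ingredients (borel :: real measure) \<mu>\<^sub>0 (borel :: real measure) P1 K P2 \<and> recipe_law S \<mu>\<^sub>0 P1 P2 = \<mu>"
proof -
  obtain P1 where P1: "\<And>s. s \<in> S \<Longrightarrow> cond_law \<mu> borel z0 borel (z1 s) P1"
    by (rule vertex_kernel_exists) blast
  obtain P2 where P2: "\<And>s t. s \<in> S \<Longrightarrow> t \<in> S \<Longrightarrow> s \<noteq> t \<Longrightarrow>
      cond_law \<mu> (borel \<Otimes>\<^sub>M borel \<Otimes>\<^sub>M borel) (\<lambda>\<omega>. (z0 \<omega>, z1 s \<omega>, z1 t \<omega>)) K (\<lambda>\<omega>. \<omega> {\<psi> s, \<psi> t}) P2"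
    and sym: "\<And>z a b. P2 (z, a, b) = P2 (z, b, a)"
    by (rule edge_kernel_exists) blast
  obtain s where s: "s \<in> S" using S(2) by fastforce
  have "S - {s} \<noteq> {}" using S(2) by (metis finite.emptyI infinite_remove)
  then obtain t where t: "t \<in> S" "s \<noteq> t" by blast
  have "ingredients borel (distr \<mu> borel z0) borel P1 K P2"
    unfolding ingredients_def
    using assms standard_borel_real cond_lawD(3)[OF P1[OF s]] cond_lawD(3)[OF P2[OF s t]] sym
      prob_space.prob_space_distr[OF prob_\<mu> measurable_z0_\<mu>] by auto
  with recipe_yields_\<mu>[OF this P1 P2 sym] show ?thesis by blast
qed

end

lemma three_disjoint_infinite_subsets:
  fixes S :: "'s set"
  assumes "countable S" "infinite S"
  obtains N1 N2 and \<psi> :: "'s \<Rightarrow> 's" where "infinite N1" "N1 \<subseteq> S" "infinite N2" "N2 \<subseteq> S" "N1 \<inter> N2 = {}"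
    "inj_on \<psi> S" "\<psi> ` S \<subseteq> S - (N1 \<union> N2)"
proof -
  obtain C :: "nat \<Rightarrow> 's set" where C: "pairwise (\<lambda>i j. disjnt (C i) (C j)) UNIV" "(\<Union>i. C i) \<subseteq> S" "\<And>i. infinite (C i)"
    using infinite_infinite_partition[OF assms(2)] by metis
  have disj: "C i \<inter> C j = {}" if "i \<noteq> j" for i j
    using C(1) that by (auto simp: pairwise_def disjnt_def)
  have "countable (C 2)" using C(2) assms(1) by (meson UNIV_I UN_subset_iff countable_subset)
  then have "bij_betw (from_nat_into (C 2) \<circ> to_nat_on S) S (C 2)"
    using assms C(3) by (intro bij_betw_trans[OF to_nat_on_infinite bij_betw_from_nat_into])
  then show thesis
    using C(2,3) disj[of 0 1] disj[of 0 2] disj[of 1 2]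
    by (intro that[of "C 0" "C 1" "from_nat_into (C 2) \<circ> to_nat_on S"]) (auto simp: bij_betw_def)
qed

theorem corollary3p5:
  fixes S :: "'s set" and K :: "'k measure" and \<mu> :: "('s set \<Rightarrow> 'k) measure"
  assumes "countable S" and "infinite S"
    and "standard_borel K"
    and "exchangeable_random_coloured_graph S K \<mu>"
  shows "\<exists>(Z\<^sub>0 :: real measure) \<mu>\<^sub>0 (Z\<^sub>1 :: real measure) P\<^sub>1 P\<^sub>2.
           ingredients Z\<^sub>0 \<mu>\<^sub>0 Z\<^sub>1 P\<^sub>1 K P\<^sub>2 \<and> recipe_law S \<mu>\<^sub>0 P\<^sub>1 P\<^sub>2 = \<mu>"
proof -
  obtain N1 N2 and \<psi> :: "'s \<Rightarrow> 's" where N: "infinite N1" "N1 \<subseteq> S" "infinite N2" "N2 \<subseteq> S" "N1 \<inter> N2 = {}"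
    and \<psi>: "inj_on \<psi> S" "\<psi> ` S \<subseteq> S - (N1 \<union> N2)"
    by (rule three_disjoint_infinite_subsets[OF assms(1,2)]) blast
  obtain a where a: "a \<in> N1" using N(1) by fastforce
  obtain b where b: "b \<in> N2" using N(3) by fastforce
  have ab: "{a, b} \<in> [N1 \<union> N2]\<^bsup>2\<^esup>" using a b N(5) by (auto simp: doubleton_in_nsets)
  have "space K \<noteq> {}"
  proof -
    have "{a, b} \<in> [S]\<^bsup>2\<^esup>" using a b N by (auto simp: doubleton_in_nsets)
    then have "(\<lambda>\<omega>. \<omega> {a, b}) \<in> coloured_graphs S K \<rightarrow>\<^sub>M K"
      unfolding coloured_graphs_def by (rule measurable_component_singleton)
    moreover have "space \<mu> = space (coloured_graphs S K)"
      using assms(4) by (intro sets_eq_imp_space_eq) (simp add: exchangeable_random_coloured_graph_def)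
    moreover have "prob_space \<mu>"
      using assms(4) by (simp add: exchangeable_random_coloured_graph_def)
    ultimately show ?thesis using prob_space.not_empty[of \<mu>] by (metis ex_in_conv measurable_space)
  qed
  then have K: "cantor_retract K" by (rule standard_borel_imp_cantor_retract[OF assms(3)])
  have N_count: "countable N1" "countable (N1 \<union> N2)"
    using countable_subset[OF N(2) assms(1)] countable_subset[OF N(4) assms(1)] by simp_all
  have "countable {e. finite e \<and> e \<subseteq> N1 \<union> N2}"
    by (rule countable_Collect_finite_subset[OF N_count(2)])
  then have edges_count: "countable ([N1 \<union> N2]\<^bsup>2\<^esup>)"
    by (rule countable_subset[rotated]) (auto simp: nsets_def)
  have "[N1 \<union> N2]\<^bsup>2\<^esup> \<noteq> {}" using ab by blast
  then obtain c0 :: "('s set \<Rightarrow> 'k) \<Rightarrow> real" and d0 where cd0: "c0 \<in> borel_measurable (\<Pi>\<^sub>M e\<in>[N1 \<union> N2]\<^bsup>2\<^esup>. K)"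
    "d0 \<in> borel \<rightarrow>\<^sub>M (\<Pi>\<^sub>M e\<in>[N1 \<union> N2]\<^bsup>2\<^esup>. K)" "\<And>x. x \<in> space (\<Pi>\<^sub>M e\<in>[N1 \<union> N2]\<^bsup>2\<^esup>. K) \<Longrightarrow> d0 (c0 x) = x"
    using cantor_retract_real[OF cantor_retract_PiM[OF edges_count _ K]] by metis
  have "N1 \<noteq> {}" using N(1) by auto
  then obtain c1 :: "('s \<Rightarrow> 'k) \<Rightarrow> real" and d1 where cd1: "c1 \<in> borel_measurable (\<Pi>\<^sub>M n\<in>N1. K)"
    "d1 \<in> borel \<rightarrow>\<^sub>M (\<Pi>\<^sub>M n\<in>N1. K)" "\<And>x. x \<in> space (\<Pi>\<^sub>M n\<in>N1. K) \<Longrightarrow> d1 (c1 x) = x"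
    using cantor_retract_real[OF cantor_retract_PiM[OF N_count(1) _ K]] by metis
  interpret graph_with_reserve S K \<mu> N1 N2 \<psi> c0 d0 c1 d1
    by unfold_locales (fact assms K N \<psi> cd0 cd1)+
  show ?thesis using ingredients_exist[OF assms(3)] by blast
qed

end
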